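(* Let $\mathbb H=\mathbb H(V,R,\Delta,c)$ be an arbitrary graded Hecke algebra with a positive parameter function $c$. Then an irreducible $\mathbb H$-module $X$ is anti-spherical if and only if $X$ has an anti-dominant weight.
   Context: Setting: $V_0$ is a finite-dimensional real inner product space, $R\subset V_0$ a finite reduced root system (a finite set of nonzero vectors, stable under all reflections $s_\alpha$, $\alpha\in R$, with $R\cap\mathbb R\alpha=\{\pm\alpha\}$; not necessarily crystallographic, and not necessarily spanning $V_0$), $\Delta$ a set of simple roots, $R^+$ the positive roots, $W$ the reflection group generated by the $s_\alpha$. $V=\mathbb C\otimes_{\mathbb R}V_0$, $V^\vee=\mathrm{Hom}_{\mathbb C}(V,\mathbb C)$, $\langle v,\chi\rangle=\chi(v)$, and $\alpha^\vee$ is defined by $s_\alpha(v)=v-\alpha^\vee(v)\alpha$. A parameter function is a $W$-invariant function $c:R\to\mathbb C$, $\alpha\mapsto c_\alpha$; it is positive if $c_\alpha>0$ for all $\alpha$. The graded Hecke algebra $\mathbb H(V,R,\Delta,c)$ is the unital associative complex algebra generated by $\{t_w:w\in W\}$ and $V$ such that $w\mapsto t_w$ gives an algebra injection $\mathbb C[W]\to\mathbb H$, $V\subset\mathbb H$ extends to an algebra injection $S(V)\to\mathbb H$, and $t_{s_\alpha}v-s_\alpha(v)t_{s_\alpha}=c_\alpha\langle v,\alpha^\vee\rangle$ for all $\alpha\in\Delta$, $v\in V$. A weight of a finite-dimensional $\mathbb H$-module $M$ is $\chi\in V^\vee$ with nonzero generalized weight space $\{m:(v-\chi(v))^km=0\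 \forall v\in V,\ k\gg0\}$. A character $\chi\in V^\vee$ is anti-dominant if $\mathrm{Re}\,\chi(\alpha)\le 0$ for all $\alpha\in R^+$. An $\mathbb H$-module is anti-spherical if its restriction to $W$ contains the sign representation of $W$. *)

theory Defs
  imports "HOL-Analysis.Analysis" "HOL-Library.Poly_Mapping"
begin

text \<open>The space $V_0$ is a type of class \<^class>\<open>real_inner\<close> on which finite-dimensionality is
  imposed as a hypothesis (unlike \<^class>\<open>euclidean_space\<close>, this allows dimension zero).\<close>

section \<open>Reflections and root systems\<close>

definition coroot :: "'v::real_inner \<Rightarrow> 'v \<Rightarrow> real" where
  "coroot \<alpha> v = 2 * (v \<bullet> \<alpha>) / (\<alpha> \<bullet> \<alpha>)"

definition reflection :: "'v::real_inner \<Rightarrow> 'v \<Rightarrow> 'v" where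
  "reflection \<alpha> v = v - coroot \<alpha> v *\<^sub>R \<alpha>"

locale root_system =
  fixes R :: "'v::real_inner set"
  assumes finite_dimensional: "\<exists>B::'v set. finite B \<and> span B = UNIV"
    and finite_roots: "finite R"
    and roots_nonzero: "0 \<notin> R"
    and roots_stable: "\<alpha> \<in> R \<Longrightarrow> reflection \<alpha> ` R \<subseteq> R"
    and reduced: "\<alpha> \<in> R \<Longrightarrow> R \<inter> span {\<alpha>} = {\<alpha>, - \<alpha>}"

definition positive_roots :: "'v::real_inner set \<Rightarrow> 'v set \<Rightarrow> 'v set" where
  "positive_roots R \<Delta> =
    {\<alpha> \<in> R. \<exists>k. (\<forall>\<delta>\<in>\<Delta>. 0 \<le> k \<delta>) \<and> \<alpha> = (\<Sum>\<delta>\<in>\<Delta>. k \<delta> *\<^sub>R \<delta>)}"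

locale based_root_system = root_system R for R :: "'v::real_inner set" +
  fixes \<Delta> :: "'v set"
  assumes simple_roots_subset: "\<Delta> \<subseteq> R"
    and simple_roots_independent: "independent \<Delta>"
    and positive_or_negative:
      "\<alpha> \<in> R \<Longrightarrow> \<alpha> \<in> positive_roots R \<Delta> \<or> - \<alpha> \<in> positive_roots R \<Delta>"

text \<open>Reflections are involutions, so the monoid generated by them is the reflection group.\<close>

inductive_set reflection_group :: "('v::real_inner) set \<Rightarrow> ('v \<Rightarrow> 'v) set"
  for R :: "'v set" where
    one: "id \<in> reflection_group R"
  | step: "\<alpha> \<in> R \<Longrightarrow> w \<in> reflection_group R \<Longrightarrow> reflection \<alpha> \<circ> w \<in> reflection_group R"

definition coxeter_length :: "'v::real_inner set \<Rightarrow> ('v \<Rightarrow> 'v) \<Rightarrow> nat" where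
  "coxeter_length \<Delta> w =
    (LEAST n. \<exists>ds. set ds \<subseteq> \<Delta> \<and> length ds = n \<and> w = foldr (\<lambda>\<alpha> f. reflection \<alpha> \<circ> f) ds id)"

definition sgn_char :: "'v::real_inner set \<Rightarrow> ('v \<Rightarrow> 'v) \<Rightarrow> int" where
  "sgn_char \<Delta> w = (- 1) ^ coxeter_length \<Delta> w"

section \<open>Complexification\<close>

text \<open>The pair $(x, y)$ stands for $1 \otimes x + i \otimes y$ in
  $V = \mathbb{C} \otimes_{\mathbb{R}} V_0$.\<close>

type_synonym 'v cplx = "'v \<times> 'v"

definition scaleV :: "complex \<Rightarrow> 'v::real_vector cplx \<Rightarrow> 'v cplx" where
  "scaleV a v = (Re a *\<^sub>R fst v - Im a *\<^sub>R snd v, Re a *\<^sub>R snd v + Im a *\<^sub>R fst v)"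

lemma vector_space_scaleV: "vector_space (scaleV :: complex \<Rightarrow> 'v::real_vector cplx \<Rightarrow> 'v cplx)"
  by unfold_locales (auto simp: scaleV_def algebra_simps)

definition embedV :: "'v::real_vector \<Rightarrow> 'v cplx" where
  "embedV x = (x, 0)"

definition corootV :: "'v::real_inner \<Rightarrow> 'v cplx \<Rightarrow> complex" where
  "corootV \<alpha> v = Complex (coroot \<alpha> (fst v)) (coroot \<alpha> (snd v))"

definition reflectionV :: "'v::real_inner \<Rightarrow> 'v cplx \<Rightarrow> 'v cplx" where
  "reflectionV \<alpha> = map_prod (reflection \<alpha>) (reflection \<alpha>)"

definition dualV :: "('v::real_inner cplx \<Rightarrow> complex) set" where
  "dualV = {\<mu>. Vector_Spaces.linear scaleV (*) \<mu>}"

section \<open>The symmetric algebra\<close>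

text \<open>$S(V)$ is presented as the polynomial ring on symbols $X_v$, one for each $v \in V$, modulo the
  ideal generated by $X_{u+v} - X_u - X_v$ and $X_{av} - a X_v$. Power products of the symbols are
  finitely supported functions from $V$ to the naturals.\<close>

type_synonym 'v free_poly = "('v cplx \<Rightarrow>\<^sub>0 nat) \<Rightarrow>\<^sub>0 complex"

definition var :: "'v::real_vector cplx \<Rightarrow> 'v free_poly" where
  "var v = Poly_Mapping.single (Poly_Mapping.single v 1) 1"

definition const :: "complex \<Rightarrow> 'v::real_vector free_poly" where
  "const a = Poly_Mapping.single 0 a"

definition linear_relations :: "'v::real_vector free_poly set" where
  "linear_relations =
    {var (u + v) - var u - var v |u v. True} \<union> {var (scaleV a v) - const a * var v |a v. True}"

text \<open>The span of a subset of a commutative ring, as a module over itself, is the ideal it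
  generates.\<close>

definition sym_ideal :: "'v::real_vector free_poly set" where
  "sym_ideal = module.span (*) linear_relations"

section \<open>Graded Hecke algebras\<close>

locale complex_algebra = vector_space scaleH
  for scaleH :: "complex \<Rightarrow> 'h::ring_1 \<Rightarrow> 'h" +
  assumes scale_mult_left: "scaleH a x * y = scaleH a (x * y)"
    and scale_mult_right: "x * scaleH a y = scaleH a (x * y)"

definition is_subalgebra :: "(complex \<Rightarrow> 'h::ring_1 \<Rightarrow> 'h) \<Rightarrow> 'h set \<Rightarrow> bool" where
  "is_subalgebra scaleH S \<longleftrightarrow>
    1 \<in> S \<and> (\<forall>x\<in>S. \<forall>y\<in>S. x + y \<in> S \<and> x * y \<in> S) \<and> (\<forall>a. \<forall>x\<in>S. scaleH a x \<in> S)"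

definition sym_algebra_hom ::
    "(complex \<Rightarrow> 'h::ring_1 \<Rightarrow> 'h) \<Rightarrow> ('v::real_vector free_poly \<Rightarrow> 'h) \<Rightarrow> bool" where
  "sym_algebra_hom scaleH \<phi> \<longleftrightarrow>
    \<phi> 1 = 1 \<and> (\<forall>p q. \<phi> (p + q) = \<phi> p + \<phi> q) \<and> (\<forall>p q. \<phi> (p * q) = \<phi> p * \<phi> q) \<and>
    (\<forall>a p. \<phi> (const a * p) = scaleH a (\<phi> p))"

text \<open>A parameter function is given by a function on all of $V_0$ of which only the values on $R$
  matter; likewise \<open>t\<close> matters only on $W$. The map \<open>\<iota>\<close> is the inclusion of $V$. In
  \<open>group_algebra_inj\<close> the elements of $\mathbb{C}[W]$ are the coefficient functions supported on the (finite) group $W$. In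
  \<open>sym_algebra_inj\<close>, a homomorphism from the polynomial ring with kernel exactly \<^const>\<open>sym_ideal\<close>
  is the same as an injective one from $S(V)$.\<close>

locale graded_hecke_algebra =
  based_root_system R \<Delta> + complex_algebra scaleH
  for R \<Delta> :: "'v::real_inner set"
    and scaleH :: "complex \<Rightarrow> 'h::ring_1 \<Rightarrow> 'h" +
  fixes c :: "'v \<Rightarrow> complex"
    and t :: "('v \<Rightarrow> 'v) \<Rightarrow> 'h"
    and \<iota> :: "'v cplx \<Rightarrow> 'h"
  assumes parameter_invariant: "w \<in> reflection_group R \<Longrightarrow> \<alpha> \<in> R \<Longrightarrow> c (w \<alpha>) = c \<alpha>"
    and generated: "is_subalgebra scaleH S \<Longrightarrow> t ` reflection_group R \<subseteq> S \<Longrightarrow> range \<iota> \<subseteq> S \<Longrightarrow> S = UNIV"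
    and t_one: "t id = 1"
    and t_mult: "u \<in> reflection_group R \<Longrightarrow> w \<in> reflection_group R \<Longrightarrow> t (u \<circ> w) = t u * t w"
    and group_algebra_inj:
      "inj_on (\<lambda>f. \<Sum>w\<in>reflection_group R. scaleH (f w) (t w)) {f. \<forall>w. w \<notin> reflection_group R \<longrightarrow> f w = 0}"
    and sym_algebra_inj:
      "\<exists>\<phi>. sym_algebra_hom scaleH \<phi> \<and> (\<forall>v. \<phi> (var v) = \<iota> v) \<and> {p. \<phi> p = 0} = sym_ideal"
    and cross_relation:
      "\<alpha> \<in> \<Delta> \<Longrightarrow>
        t (reflection \<alpha>) * \<iota> v - \<iota> (reflectionV \<alpha> v) * t (reflection \<alpha>) = scaleH (c \<alpha> * corootV \<alpha> v) 1"

definition positive_parameter :: "'v set \<Rightarrow> ('v \<Rightarrow> complex) \<Rightarrow> bool" where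
  "positive_parameter R c \<longleftrightarrow> (\<forall>\<alpha>\<in>R. c \<alpha> \<in> \<real> \<and> 0 < Re (c \<alpha>))"

section \<open>Modules\<close>

text \<open>The complex scalars act on a module over a unital complex algebra through the multiples of
  the unit, so no separate scalar multiplication is needed.\<close>

locale left_module =
  fixes act :: "'h::ring_1 \<Rightarrow> 'm::ab_group_add \<Rightarrow> 'm"
  assumes act_add_left: "act (g + h) m = act g m + act h m"
    and act_add_right: "act g (m + n) = act g m + act g n"
    and act_mult: "act (g * h) m = act g (act h m)"
    and act_one: "act 1 m = m"

definition is_submodule :: "('h::ring_1 \<Rightarrow> 'm::ab_group_add \<Rightarrow> 'm) \<Rightarrow> 'm set \<Rightarrow> bool" where
  "is_submodule act N \<longleftrightarrow> 0 \<in> N \<and> (\<forall>m\<in>N. \<forall>n\<in>N. m + n \<in> N) \<and> (\<forall>h. \<forall>m\<in>N. act h m \<in> N)"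

definition irreducible_module :: "('h::ring_1 \<Rightarrow> 'm::ab_group_add \<Rightarrow> 'm) \<Rightarrow> bool" where
  "irreducible_module act \<longleftrightarrow> left_module act \<and> (UNIV :: 'm set) \<noteq> {0} \<and>
    (\<forall>N. is_submodule act N \<longrightarrow> N = {0} \<or> N = UNIV)"

definition generalized_weight_space ::
    "(complex \<Rightarrow> 'h::ring_1 \<Rightarrow> 'h) \<Rightarrow> ('v::real_inner cplx \<Rightarrow> 'h) \<Rightarrow>
     ('h \<Rightarrow> 'm::ab_group_add \<Rightarrow> 'm) \<Rightarrow> ('v cplx \<Rightarrow> complex) \<Rightarrow> 'm set" where
  "generalized_weight_space scaleH \<iota> act \<mu> =
    {m. \<forall>v. \<forall>\<^sub>F k in sequentially. act ((\<iota> v - scaleH (\<mu> v) 1) ^ k) m = 0}"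

definition is_weight ::
    "(complex \<Rightarrow> 'h::ring_1 \<Rightarrow> 'h) \<Rightarrow> ('v::real_inner cplx \<Rightarrow> 'h) \<Rightarrow>
     ('h \<Rightarrow> 'm::ab_group_add \<Rightarrow> 'm) \<Rightarrow> ('v cplx \<Rightarrow> complex) \<Rightarrow> bool" where
  "is_weight scaleH \<iota> act \<mu> \<longleftrightarrow>
    \<mu> \<in> dualV \<and> generalized_weight_space scaleH \<iota> act \<mu> \<noteq> {0}"

definition anti_dominant :: "'v::real_inner set \<Rightarrow> 'v set \<Rightarrow> ('v cplx \<Rightarrow> complex) \<Rightarrow> bool" where
  "anti_dominant R \<Delta> \<mu> \<longleftrightarrow> (\<forall>\<alpha>\<in>positive_roots R \<Delta>. Re (\<mu> (embedV \<alpha>)) \<le> 0)"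

text \<open>A copy of the sign representation of $W$ is a line spanned by some nonzero \<open>m\<close> on which $W$
  acts through the sign character.\<close>

definition anti_spherical ::
    "'v::real_inner set \<Rightarrow> 'v set \<Rightarrow> (('v \<Rightarrow> 'v) \<Rightarrow> 'h::ring_1) \<Rightarrow>
     ('h \<Rightarrow> 'm::ab_group_add \<Rightarrow> 'm) \<Rightarrow> bool" where
  "anti_spherical R \<Delta> t act \<longleftrightarrow>
    (\<exists>m. m \<noteq> 0 \<and> (\<forall>w\<in>reflection_group R. act (t w) m = act (of_int (sgn_char \<Delta> w)) m))"

end

(* Write l for the length function of W, V_chi for generalized weight spaces, and
   tau_a = t_{s_a} a - c_a = c_a - a t_{s_a}, an intertwiner: tau_a v = s_a(v) tau_a and
   tau_a^2 = c_a^2 - a^2.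

   If X has an anti-dominant weight, applying tau_a at simple roots with chi(a) in i R_{> 0} makes the
   weight chi anti-dominant for the lexicographic order on (Re, Im). Let m be an eigenvector of weight
   chi and y = sum of sgn(z) t_z m over the stabilizer of chi. A high power of rho - chi(rho) maps y to
   a nonzero multiple of m, because c > 0; hence y is nonzero. The vectors sgn(u) t_u y depend only
   on u chi. Their components T(u chi) in V_{u chi} satisfy a T(s_a mu) = tau_a T(mu) when mu(a) < 0
   and span a sign representation when mu(a) = 0. Multiplying T(mu) by the product of the positive
   roots b with mu(b) > 0 and of the c_b - b with mu(b) < 0 and summing over the orbit of chi gives a
   vector on which W acts by sgn; it is nonzero since its component at chi is an invertible multiple
   of y.

   Conversely, let m span a sign representation of W in X, so that X = S(V) m. On a simple quotient of
   the S(V)-module X each v acts by a scalar, as X has countable dimension. This yields an eigenvector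
   of V in X, and therefore X is the sum of the V_mu with mu in one W-orbit. Let V_mu be nonzero with
   Re mu(rho) minimal. If Re mu(a) > 0 for a simple root a, then V_{s_a mu} = 0, so tau_a kills V_mu,
   which forces t_{s_a} = 1 on V_mu. So the component of m in V_mu vanishes, contradicting
   X = S(V) m. *)

theory Submission
  imports Defs "HOL-Computational_Algebra.Fundamental_Theorem_Algebra"
begin

section \<open>Root systems and the length function\<close>

text \<open>X is not assumed finite-dimensional, so for an anti-spherical X even the existence of a
  weight has to be proved. The countability argument only gives a character of S(V) on a quotient
  X/N. To pass from a quotient to a subspace, send x to the family of classes of t_{w^{-1}} x modulo
  N, w in W. This embeds X into a module coinduced from S(V), on which V acts triangularly with
  respect to the length, and a nonzero x whose classes vanish for as many short w as possible is an
  eigenvector. In the other direction, the lexicographic order makes the stabilizer of chi a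
  standard parabolic subgroup: every inversion b of a stabilizing w satisfies chi(b) = 0. The weight
  can be moved there by tau_a because a purely imaginary chi(a) never equals c_a or -c_a. The
  products of roots and of c_b - b replace division: they turn the relation between T(mu) and T(s_a
  mu) into one that is symmetric in the two weights and says that tau_a acts as c_a + a, which is
  how it must act where t_{s_a} = -1.\<close>

lemma coroot_add: "coroot a (u + v) = coroot a u + coroot a v"
  by (simp add: coroot_def inner_add_left add_divide_distrib distrib_left)

lemma coroot_diff: "coroot a (u - v) = coroot a u - coroot a v"
  by (simp add: coroot_def inner_diff_left diff_divide_distrib right_diff_distrib)

lemma coroot_scaleR: "coroot a (r *\<^sub>R v) = r * coroot a v"
  by (simp add: coroot_def)

lemma coroot_self [simp]: "a \<noteq> 0 \<Longrightarrow> coroot a a = 2"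
  by (simp add: coroot_def)

lemma linear_reflection: "linear (reflection a)"
  by (rule linearI) (simp_all add: reflection_def coroot_add coroot_scaleR algebra_simps)

lemma reflection_self [simp]: "reflection a a = - a"
  by (cases "a = 0") (simp_all add: reflection_def scaleR_2)

lemma reflection_reflection [simp]: "reflection a (reflection a v) = v"
  by (cases "a = 0") (simp_all add: reflection_def coroot_diff coroot_scaleR)

lemma reflection_comp_reflection [simp]: "reflection a \<circ> reflection a = id"
  by (simp add: fun_eq_iff)

lemma reflection_uminus: "reflection (- a) = reflection a"
  by (simp add: fun_eq_iff reflection_def coroot_def)

lemma inner_reflection: "reflection a u \<bullet> reflection a v = u \<bullet> v"
proof (cases "a = 0")
  case False
  then have "coroot a u * (a \<bullet> a) = 2 * (u \<bullet> a)" "coroot a v * (a \<bullet> a) = 2 * (v \<bullet> a)"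
    by (simp_all add: coroot_def)
  moreover have "reflection a u \<bullet> reflection a v
      = u \<bullet> v - coroot a v * (u \<bullet> a) - coroot a u * (v \<bullet> a) + coroot a u * (coroot a v * (a \<bullet> a))"
    by (simp add: reflection_def inner_diff_left inner_diff_right inner_commute algebra_simps)
  moreover have "coroot a v * (coroot a u * (a \<bullet> a)) = coroot a v * (2 * (u \<bullet> a))"
    using calculation(1) by simp
  ultimately show ?thesis
    by (simp add: coroot_def inner_commute algebra_simps)
qed (simp add: reflection_def)

lemma reflection_group_comp:
  "u \<in> reflection_group S \<Longrightarrow> w \<in> reflection_group S \<Longrightarrow> u \<circ> w \<in> reflection_group S"
  by (induction rule: reflection_group.induct) (auto simp: comp_assoc intro: reflection_group.step)

lemma reflection_in_reflection_group: "a \<in> S \<Longrightarrow> reflection a \<in> reflection_group S"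
  using reflection_group.step[OF _ reflection_group.one] by fastforce

lemma reflection_group_comp_reflection:
  "w \<in> reflection_group S \<Longrightarrow> a \<in> S \<Longrightarrow> w \<circ> reflection a \<in> reflection_group S"
  by (simp add: reflection_group_comp reflection_in_reflection_group)

lemma reflection_group_inverse:
  "w \<in> reflection_group S \<Longrightarrow> \<exists>w'\<in>reflection_group S. w \<circ> w' = id \<and> w' \<circ> w = id"
proof (induction rule: reflection_group.induct)
  case one
  then show ?case by (intro bexI[of _ id]) (simp_all add: reflection_group.one)
next
  case (step a w)
  then obtain w' where "w' \<in> reflection_group S" "w \<circ> w' = id" "w' \<circ> w = id" by blast
  then show ?case using step(1)
    by (intro bexI[of _ "w' \<circ> reflection a"])
      (auto simp: fun_eq_iff intro: reflection_group_comp_reflection)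
qed

lemma reflection_group_bij: "w \<in> reflection_group S \<Longrightarrow> bij w"
  using reflection_group_inverse o_bij by metis

lemma reflection_group_inv: "w \<in> reflection_group S \<Longrightarrow> inv w \<in> reflection_group S"
  using reflection_group_inverse inv_unique_comp by metis

lemma reflection_group_inv_apply [simp]:
  "w \<in> reflection_group S \<Longrightarrow> inv w (w v) = v" "w \<in> reflection_group S \<Longrightarrow> w (inv w v) = v"
  by (auto dest!: reflection_group_bij simp: bij_is_inj bij_is_surj surj_f_inv_f)

lemma reflection_group_inv_comp:
  "u \<in> reflection_group S \<Longrightarrow> w \<in> reflection_group S \<Longrightarrow> inv (u \<circ> w) = inv w \<circ> inv u"
  using reflection_group_bij o_inv_distrib by blast

lemma inv_reflection [simp]: "inv (reflection a) = reflection a"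
  by (rule inv_unique_comp) auto

lemma reflection_group_linear: "w \<in> reflection_group S \<Longrightarrow> linear w"
  by (induction rule: reflection_group.induct)
    (simp_all only: linear_compose linear_reflection linear_id)

lemma reflection_group_inner: "w \<in> reflection_group S \<Longrightarrow> w u \<bullet> w v = u \<bullet> v"
  by (induction rule: reflection_group.induct) (auto simp: inner_reflection)

lemma reflection_group_coroot: "w \<in> reflection_group S \<Longrightarrow> coroot (w a) (w v) = coroot a v"
  by (simp add: coroot_def reflection_group_inner)

lemma reflection_group_conj:
  assumes "w \<in> reflection_group S"
  shows "w \<circ> reflection a = reflection (w a) \<circ> w"
proof
  fix v
  have "linear w" using assms by (rule reflection_group_linear)
  then show "(w \<circ> reflection a) v = (reflection (w a) \<circ> w) v"
    by (simp add: reflection_def linear_diff linear_scale reflection_group_coroot[OF assms])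
qed

lemma reflection_group_minus: "w \<in> reflection_group S \<Longrightarrow> w (- v) = - w v"
  using reflection_group_linear linear_neg by blast

lemma reflection_group_mono: "S \<subseteq> T \<Longrightarrow> w \<in> reflection_group S \<Longrightarrow> w \<in> reflection_group T"
  by (rotate_tac 1, induction rule: reflection_group.induct) (auto intro: reflection_group.intros)

section \<open>Words in reflections and the length function\<close>

definition word_prod :: "'v::real_inner list \<Rightarrow> 'v \<Rightarrow> 'v" where
  "word_prod ds = foldr (\<lambda>\<alpha> f. reflection \<alpha> \<circ> f) ds id"

lemma word_prod_simps [simp]:
  "word_prod [] = id" "word_prod (a # ds) = reflection a \<circ> word_prod ds"
  by (simp_all add: word_prod_def)

lemma word_prod_append: "word_prod (ds @ es) = word_prod ds \<circ> word_prod es"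
  by (induction ds) (simp_all add: comp_assoc)

lemma word_prod_in: "set ds \<subseteq> S \<Longrightarrow> word_prod ds \<in> reflection_group S"
  by (induction ds) (auto intro: reflection_group.intros)

lemma word_prod_ex: "w \<in> reflection_group S \<Longrightarrow> \<exists>ds. set ds \<subseteq> S \<and> w = word_prod ds"
proof (induction rule: reflection_group.induct)
  case one
  then show ?case by (intro exI[of _ "[]"]) simp
next
  case (step a w)
  then obtain ds where "set ds \<subseteq> S" "w = word_prod ds" by blast
  then show ?case using step by (intro exI[of _ "a # ds"]) simp
qed

lemma coxeter_length_word:
  assumes "w \<in> reflection_group S"
  obtains ds where "set ds \<subseteq> S" "length ds = coxeter_length S w" "w = word_prod ds"
proof -
  obtain ds where "set ds \<subseteq> S" "w = word_prod ds" using word_prod_ex[OF assms] by blast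
  then have "\<exists>n ds. set ds \<subseteq> S \<and> length ds = n \<and> w = foldr (\<lambda>\<alpha> f. reflection \<alpha> \<circ> f) ds id"
    unfolding word_prod_def by blast
  from LeastI_ex[OF this] obtain es where "set es \<subseteq> S" "length es = coxeter_length S w"
      "w = word_prod es"
    unfolding coxeter_length_def word_prod_def by blast
  then show ?thesis using that by blast
qed

lemma coxeter_length_le: "set ds \<subseteq> S \<Longrightarrow> coxeter_length S (word_prod ds) \<le> length ds"
  unfolding coxeter_length_def word_prod_def by (rule Least_le) blast

lemma coxeter_length_eq_0: "w \<in> reflection_group S \<Longrightarrow> coxeter_length S w = 0 \<Longrightarrow> w = id"
  by (metis coxeter_length_word length_0_conv word_prod_simps(1))

lemma coxeter_length_id [simp]: "coxeter_length S id = 0"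
  using coxeter_length_le[of "[]" S] by simp

lemma coxeter_length_comp_reflection:
  assumes "w \<in> reflection_group S" "a \<in> S"
  shows "coxeter_length S (w \<circ> reflection a) \<le> coxeter_length S w + 1"
proof -
  obtain ds where ds: "set ds \<subseteq> S" "length ds = coxeter_length S w" "w = word_prod ds"
    using coxeter_length_word[OF assms(1)] .
  have "w \<circ> reflection a = word_prod (ds @ [a])" using ds by (simp add: word_prod_append)
  then show ?thesis using coxeter_length_le[of "ds @ [a]" S] ds assms by simp
qed

context root_system
begin

abbreviation W :: "('v \<Rightarrow> 'v) set" where "W \<equiv> reflection_group R"

lemma W_root: "w \<in> W \<Longrightarrow> a \<in> R \<Longrightarrow> w a \<in> R"
  by (induction rule: reflection_group.induct) (use roots_stable in auto)

lemma root_nonzero: "a \<in> R \<Longrightarrow> a \<noteq> 0"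
  using roots_nonzero by blast

end

section \<open>Positive roots and generation by simple reflections\<close>

context based_root_system
begin

abbreviation P :: "'v set" where "P \<equiv> positive_roots R \<Delta>"

lemma simple_root: "a \<in> \<Delta> \<Longrightarrow> a \<in> R"
  using simple_roots_subset by blast

lemma positive_root: "b \<in> P \<Longrightarrow> b \<in> R"
  by (simp add: positive_roots_def)

lemma finite_simple_roots: "finite \<Delta>"
  using finite_subset[OF simple_roots_subset finite_roots] .

lemma finite_positive_roots: "finite P"
  using finite_roots by (simp add: positive_roots_def)

lemma simple_root_positive: "a \<in> \<Delta> \<Longrightarrow> a \<in> P"
  unfolding positive_roots_def using finite_simple_roots simple_root
  by (auto intro!: exI[of _ "\<lambda>d. if d = a then 1 else 0"] simp: if_distrib[of "\<lambda>x. x *\<^sub>R _"] cong: if_cong)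

lemma positive_rootE:
  assumes "b \<in> P"
  obtains k where "\<forall>d\<in>\<Delta>. 0 \<le> k d" "b = (\<Sum>d\<in>\<Delta>. k d *\<^sub>R d)"
  using assms unfolding positive_roots_def by blast

lemma linear_functional_ex: "\<exists>f. linear f \<and> (\<forall>d\<in>\<Delta>. f d = (g d :: real))"
  using linear_independent_extend[OF simple_roots_independent, of g] by blast

text \<open>Determined only on the span of the simple roots, which may be a proper subspace; it is
  evaluated at roots only.\<close>

definition height :: "'v \<Rightarrow> real" where
  "height = (SOME f. linear f \<and> (\<forall>d\<in>\<Delta>. f d = 1))"

lemma linear_height: "linear height" and height_simple: "d \<in> \<Delta> \<Longrightarrow> height d = 1"
  using someI_ex[OF linear_functional_ex[of "\<lambda>_. 1"]] unfolding height_def by auto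

lemma linear_functional_nonneg:
  assumes "linear f" "\<And>d. d \<in> \<Delta> \<Longrightarrow> (0::real) \<le> f d" "b \<in> P"
  shows "0 \<le> f b"
proof -
  obtain k where "\<forall>d\<in>\<Delta>. 0 \<le> k d" "b = (\<Sum>d\<in>\<Delta>. k d *\<^sub>R d)"
    using positive_rootE[OF assms(3)] by blast
  then show ?thesis using assms by (auto simp: linear_sum linear_scale intro!: sum_nonneg)
qed

lemma linear_functional_pos:
  assumes "linear f" "\<And>d. d \<in> \<Delta> \<Longrightarrow> (0::real) < f d" "b \<in> P"
  shows "0 < f b"
proof -
  obtain k where k: "\<forall>d\<in>\<Delta>. 0 \<le> k d" "b = (\<Sum>d\<in>\<Delta>. k d *\<^sub>R d)"
    using positive_rootE[OF assms(3)] by blast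
  have "\<exists>d\<in>\<Delta>. k d \<noteq> 0"
  proof (rule ccontr)
    assume "\<not> ?thesis"
    then have "b = 0" using k(2) by simp
    then show False using root_nonzero[OF positive_root[OF assms(3)]] by simp
  qed
  then obtain d where "d \<in> \<Delta>" "k d > 0" using k(1) by force
  then have "0 < (\<Sum>d\<in>\<Delta>. k d * f d)"
    using k assms(2) finite_simple_roots
    by (intro sum_pos2[of _ d]) (auto intro: mult_nonneg_nonneg order_less_imp_le)
  then show ?thesis using k assms by (simp add: linear_sum linear_scale)
qed

lemma height_pos: "b \<in> P \<Longrightarrow> 0 < height b"
  using linear_functional_pos[OF linear_height] height_simple by simp

lemma not_positive_uminus: "b \<in> P \<Longrightarrow> - b \<notin> P"
  using height_pos[of b] height_pos[of "- b"] linear_neg[OF linear_height, of b] by linarith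

lemma uminus_positive: "b \<in> R \<Longrightarrow> b \<notin> P \<Longrightarrow> - b \<in> P"
  using positive_or_negative by blast

text \<open>Reflection in \<open>a\<close> changes only the coefficient of \<open>a\<close>. Since
  the root system is reduced, \<open>b\<close> has a positive coefficient at some other simple root
  \<open>d\<close>. The functional \<open>g\<close> dual to \<open>d\<close> shows that this
  coefficient survives, so the image cannot be negative.\<close>

lemma reflection_positive:
  assumes "a \<in> \<Delta>" "b \<in> P" "b \<noteq> a"
  shows "reflection a b \<in> P"
proof (rule ccontr)
  assume "reflection a b \<notin> P"
  moreover have "reflection a b \<in> R"
    using roots_stable simple_root assms positive_root by blast
  ultimately have neg: "- reflection a b \<in> P" by (rule uminus_positive[rotated])
  obtain k where k: "\<forall>d\<in>\<Delta>. 0 \<le> k d" "b = (\<Sum>d\<in>\<Delta>. k d *\<^sub>R d)"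
    using positive_rootE[OF assms(2)] by blast
  have "\<exists>d\<in>\<Delta>. d \<noteq> a \<and> k d \<noteq> 0"
  proof (rule ccontr)
    assume "\<not> ?thesis"
    then have "b = (\<Sum>d\<in>\<Delta>. if d = a then k a *\<^sub>R a else 0)"
      using k(2) by (auto intro!: sum.cong)
    then have "b = k a *\<^sub>R a" using assms(1) finite_simple_roots by simp
    then have "b \<in> R \<inter> span {a}" using positive_root[OF assms(2)] by (auto simp: span_singleton)
    then have "b = - a" using reduced[OF simple_root[OF assms(1)]] assms(3) by auto
    then show False using not_positive_uminus[OF simple_root_positive[OF assms(1)]] assms(2) by blast
  qed
  then obtain d where d: "d \<in> \<Delta>" "d \<noteq> a" "k d > 0" using k(1) by force
  obtain g where g: "linear g" "\<forall>e\<in>\<Delta>. g e = (if e = d then 1 else 0 :: real)"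
    using linear_functional_ex[of "\<lambda>e. if e = d then 1 else 0"] by blast
  have "g b = (\<Sum>e\<in>\<Delta>. k e * g e)" using k(2) g(1) by (simp add: linear_sum linear_scale)
  also have "\<dots> = (\<Sum>e\<in>\<Delta>. if e = d then k d else 0)" using g(2) by (intro sum.cong) auto
  finally have "g b = k d" using d finite_simple_roots by simp
  then have "g (reflection a b) > 0"
    using g d assms(1) by (simp add: reflection_def linear_diff linear_scale)
  moreover have "0 \<le> g (- reflection a b)"
    by (rule linear_functional_nonneg[OF g(1) _ neg]) (use g(2) in auto)
  ultimately show False using linear_neg[OF g(1), of "reflection a b"] by linarith
qed

lemma reflection_not_positive:
  "a \<in> \<Delta> \<Longrightarrow> b \<in> P \<Longrightarrow> reflection a b \<notin> P \<longleftrightarrow> b = a"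
  using reflection_positive[of a b] not_positive_uminus[of b] by (cases "b = a") simp_all

lemma reflection_permutes: "a \<in> \<Delta> \<Longrightarrow> bij_betw (reflection a) (P - {a}) (P - {a})"
proof (rule bij_betwI[where g = "reflection a"])
  assume a: "a \<in> \<Delta>"
  have "reflection a b \<noteq> a" if "b \<in> P" for b
  proof
    assume "reflection a b = a"
    then have "b = - a" by (metis reflection_reflection reflection_self)
    then show False using that not_positive_uminus[OF simple_root_positive[OF a]] by blast
  qed
  then show "reflection a \<in> P - {a} \<rightarrow> P - {a}" using reflection_positive[OF a] by auto
  then show "reflection a \<in> P - {a} \<rightarrow> P - {a}" .
qed auto

text \<open>Twice the usual rho, hence the value 2 in \<open>coroot_simple_rho\<close>.\<close>

definition rho :: 'v where "rho = (\<Sum>b\<in>P. b)"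

text \<open>The reflection in \<open>a\<close> permutes the positive roots other than
  \<open>a\<close>, so their sum is fixed and pairs to zero with the coroot of \<open>a\<close>.
  Only the summand \<open>a\<close> contributes.\<close>

lemma coroot_simple_rho: "a \<in> \<Delta> \<Longrightarrow> coroot a rho = 2"
proof -
  assume a: "a \<in> \<Delta>"
  have nz: "a \<noteq> 0" using a simple_root root_nonzero by blast
  have split: "rho = a + (\<Sum>b\<in>P - {a}. b)"
    unfolding rho_def using finite_positive_roots simple_root_positive[OF a] by (simp add: sum.remove)
  have "reflection a (\<Sum>b\<in>P - {a}. b) = (\<Sum>b\<in>P - {a}. reflection a b)"
    by (simp add: linear_sum[OF linear_reflection])
  also have "\<dots> = (\<Sum>b\<in>P - {a}. b)" using sum.reindex_bij_betw[OF reflection_permutes[OF a]] .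
  finally have "coroot a (\<Sum>b\<in>P - {a}. b) = 0" using nz by (simp add: reflection_def)
  then show ?thesis using nz by (simp add: split coroot_add)
qed

text \<open>Together with c > 0 this makes every coefficient in \<open>shift_rho_stab\<close>
  positive, so that no cancellation can occur there.\<close>

lemma coroot_rho_pos: "b \<in> P \<Longrightarrow> 0 < coroot b rho"
proof -
  assume b: "b \<in> P"
  have "linear (\<lambda>x. rho \<bullet> x)" by (simp add: inner_add_right linearI)
  moreover have "0 < rho \<bullet> d" if "d \<in> \<Delta>" for d
    using coroot_simple_rho[OF that] unfolding coroot_def
    by (metis inner_ge_zero mult_2 not_less div_by_0 divide_le_0_iff le_less add_nonpos_nonpos zero_less_numeral)
  ultimately have "0 < rho \<bullet> b" using linear_functional_pos b by blast
  then show ?thesis using root_nonzero[OF positive_root[OF b]] by (simp add: coroot_def)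
qed

abbreviation len :: "('v \<Rightarrow> 'v) \<Rightarrow> nat" where "len \<equiv> coxeter_length \<Delta>"

text \<open>As \<open>b \<bullet> b > 0\<close>, some simple \<open>a\<close> has positive inner
  product with \<open>b\<close>, and reflecting in \<open>a\<close> lowers the height. Heights are
  real numbers here, so the induction counts the positive roots of smaller height.\<close>

lemma positive_root_conj_simple:
  "b \<in> P \<Longrightarrow> \<exists>w\<in>reflection_group \<Delta>. \<exists>d\<in>\<Delta>. b = w d"
proof (induction "card {g \<in> P. height g < height b}" arbitrary: b rule: less_induct)
  case less
  show ?case
  proof (cases "b \<in> \<Delta>")
    case True
    then show ?thesis by (intro bexI[of _ id] bexI[of _ b]) (auto intro: reflection_group.one)
  next
    case False
    have "\<exists>a\<in>\<Delta>. 0 < b \<bullet> a"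
    proof (rule ccontr)
      assume "\<not> ?thesis"
      moreover have "linear (\<lambda>x. - (b \<bullet> x))" by (simp add: inner_add_right linearI)
      ultimately have "0 \<le> - (b \<bullet> b)"
        using linear_functional_nonneg[of "\<lambda>x. - (b \<bullet> x)" b] less(2) by force
      then show False using root_nonzero[OF positive_root[OF less(2)]]
        by (metis inner_gt_zero_iff neg_0_le_iff_le not_le)
    qed
    then obtain a where a: "a \<in> \<Delta>" "0 < b \<bullet> a" by blast
    then have cor: "0 < coroot a b" using root_nonzero[OF simple_root] by (simp add: coroot_def)
    have rb: "reflection a b \<in> P" using reflection_positive a less(2) False by metis
    have lt: "height (reflection a b) < height b"
      using cor a by (simp add: reflection_def linear_diff[OF linear_height] linear_scale[OF linear_height] height_simple)
    have "{g \<in> P. height g < height (reflection a b)} \<subset> {g \<in> P. height g < height b}"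
      using lt rb by fastforce
    then have "card {g \<in> P. height g < height (reflection a b)} < card {g \<in> P. height g < height b}"
      using finite_positive_roots by (intro psubset_card_mono) auto
    from less(1)[OF this rb] obtain w d where "w \<in> reflection_group \<Delta>" "d \<in> \<Delta>" "reflection a b = w d"
      by blast
    then show ?thesis using a
      by (intro bexI[of _ "reflection a \<circ> w"] bexI[of _ d]) (auto intro: reflection_group.step simp flip: \<open>reflection a b = w d\<close>)
  qed
qed

text \<open>If \<open>b = w d\<close> with \<open>d\<close> simple, then the reflection in
  \<open>b\<close> is the conjugate by \<open>w\<close> of the reflection in \<open>d\<close>. This
  lets the length, which counts words in simple reflections, be used on all of
  \<open>W\<close>.\<close>

lemma simple_reflections_generate: "reflection_group \<Delta> = W"
proof
  show "reflection_group \<Delta> \<subseteq> W" using reflection_group_mono simple_roots_subset by blast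
  have pos: "reflection b \<in> reflection_group \<Delta>" if b: "b \<in> P" for b
  proof -
    obtain w d where w: "w \<in> reflection_group \<Delta>" "d \<in> \<Delta>" "b = w d"
      using positive_root_conj_simple[OF b] by blast
    have "w \<circ> reflection d \<circ> inv w = reflection (w d) \<circ> w \<circ> inv w"
      by (simp add: reflection_group_conj[OF w(1)])
    also have "\<dots> = reflection b" using w by (simp add: fun_eq_iff)
    finally show ?thesis using w
      by (metis reflection_group_comp reflection_group_comp_reflection reflection_group_inv)
  qed
  have refl: "reflection b \<in> reflection_group \<Delta>" if "b \<in> R" for b
    using pos[of b] pos[of "- b"] positive_or_negative[OF that] by (auto simp: reflection_uminus)
  show "W \<subseteq> reflection_group \<Delta>"
  proof
    fix w assume "w \<in> W"
    then show "w \<in> reflection_group \<Delta>"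
    proof (induction rule: reflection_group.induct)
      case one
      show ?case by (rule reflection_group.one)
    next
      case (step a w)
      then show ?case using refl reflection_group_comp by blast
    qed
  qed
qed

section \<open>Exchange condition, descents and the sign character\<close>

lemma word_prod_W: "set ds \<subseteq> \<Delta> \<Longrightarrow> word_prod ds \<in> W"
  using word_prod_in simple_reflections_generate by blast

lemma reflection_W: "a \<in> R \<Longrightarrow> reflection a \<in> W"
  by (rule reflection_in_reflection_group)

lemma len_word:
  assumes "w \<in> W" obtains ds where "set ds \<subseteq> \<Delta>" "length ds = len w" "w = word_prod ds"
  using assms coxeter_length_word simple_reflections_generate by metis

text \<open>Strong exchange condition. Apply the letters to \<open>b\<close> from right to left. At
  the letter where the image turns negative, the image was that simple root itself, and multiplying
  by the reflection in \<open>b\<close> deletes this letter.\<close>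

lemma exchange:
  "set ds \<subseteq> \<Delta> \<Longrightarrow> b \<in> P \<Longrightarrow> word_prod ds b \<notin> P \<Longrightarrow>
    \<exists>es. set es \<subseteq> \<Delta> \<and> length es < length ds \<and> word_prod ds \<circ> reflection b = word_prod es"
proof (induction ds)
  case (Cons a ds)
  show ?case
  proof (cases "word_prod ds b \<in> P")
    case True
    then have "word_prod ds b = a" using Cons reflection_not_positive by auto
    then have "word_prod (a # ds) \<circ> reflection b = reflection a \<circ> (reflection a \<circ> word_prod ds)"
      using reflection_group_conj[OF word_prod_W, of ds b] Cons by (simp add: comp_assoc)
    then have "word_prod (a # ds) \<circ> reflection b = word_prod ds" by (simp add: fun_eq_iff)
    moreover have "set ds \<subseteq> \<Delta>" "length ds < length (a # ds)" using Cons.prems by auto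
    ultimately show ?thesis by blast
  next
    case False
    moreover have "set ds \<subseteq> \<Delta>" using Cons.prems by simp
    ultimately obtain es where "set es \<subseteq> \<Delta>" "length es < length ds"
        "word_prod ds \<circ> reflection b = word_prod es"
      using Cons.IH Cons.prems(2) by blast
    moreover from this have "word_prod (a # ds) \<circ> reflection b = word_prod (a # es)"
      by (simp only: word_prod_simps comp_assoc)
    moreover have "set (a # es) \<subseteq> \<Delta>" "length (a # es) < length (a # ds)"
      using calculation Cons.prems by auto
    ultimately show ?thesis by blast
  qed
qed simp

lemma len_comp_reflection_less:
  assumes "w \<in> W" "b \<in> P" "w b \<notin> P"
  shows "len (w \<circ> reflection b) < len w"
proof -
  obtain ds where ds: "set ds \<subseteq> \<Delta>" "length ds = len w" "w = word_prod ds"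
    using len_word[OF assms(1)] .
  then obtain es where es: "set es \<subseteq> \<Delta>" "length es < length ds" "w \<circ> reflection b = word_prod es"
    using exchange[of ds b] assms by blast
  show ?thesis unfolding es(3) using coxeter_length_le[OF es(1)] es(2) ds(2) by linarith
qed

lemma W_comp_reflection: "w \<in> W \<Longrightarrow> b \<in> R \<Longrightarrow> w \<circ> reflection b \<in> W"
  by (rule reflection_group_comp_reflection)

lemma len_comp_reflection_greater:
  assumes "w \<in> W" "b \<in> P" "w b \<in> P"
  shows "len w < len (w \<circ> reflection b)"
proof -
  have "(w \<circ> reflection b) b \<notin> P"
    using assms not_positive_uminus[of "w b"] by (simp add: reflection_group_minus)
  then have "len (w \<circ> reflection b \<circ> reflection b) < len (w \<circ> reflection b)"
    using len_comp_reflection_less[of "w \<circ> reflection b" b] W_comp_reflection[OF assms(1)]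
      positive_root assms(2) by blast
  then show ?thesis by (simp only: comp_assoc reflection_comp_reflection comp_id)
qed

text \<open>The second claim guarantees that the subtraction of natural numbers in the first one is
  not truncated.\<close>

lemma len_comp_simple:
  assumes "w \<in> W" "a \<in> \<Delta>"
  shows "len (w \<circ> reflection a) = (if w a \<in> P then len w + 1 else len w - 1)"
    and "w a \<notin> P \<Longrightarrow> 0 < len w"
proof -
  have le: "len (u \<circ> reflection a) \<le> len u + 1" if "u \<in> W" for u
    using coxeter_length_comp_reflection that assms simple_reflections_generate by metis
  have "len w \<le> len (w \<circ> reflection a) + 1"
    using le[OF W_comp_reflection[OF assms(1) simple_root[OF assms(2)]]]
    by (simp only: comp_assoc reflection_comp_reflection comp_id)
  then show "len (w \<circ> reflection a) = (if w a \<in> P then len w + 1 else len w - 1)"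
    using le[OF assms(1)] len_comp_reflection_greater[OF assms(1) simple_root_positive[OF assms(2)]]
      len_comp_reflection_less[OF assms(1) simple_root_positive[OF assms(2)]] by auto
  show "w a \<notin> P \<Longrightarrow> 0 < len w"
    using len_comp_reflection_less[OF assms(1) simple_root_positive[OF assms(2)]] by auto
qed

lemma descent_ex:
  assumes "w \<in> W" "w \<noteq> id"
  obtains a where "a \<in> \<Delta>" "w a \<notin> P"
proof -
  obtain ds where ds: "set ds \<subseteq> \<Delta>" "length ds = len w" "w = word_prod ds"
    using len_word[OF assms(1)] .
  have "ds \<noteq> []" using ds assms by auto
  then obtain es a where es: "ds = es @ [a]" by (metis rev_exhaust)
  have "w \<circ> reflection a = word_prod es" using ds es by (simp add: word_prod_append comp_assoc)
  then have "len (w \<circ> reflection a) < len w" using coxeter_length_le[of es \<Delta>] ds es by auto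
  then have "w a \<notin> P" using len_comp_simple(1)[OF assms(1), of a] ds es by auto
  then show ?thesis using that ds es by auto
qed

abbreviation sg :: "('v \<Rightarrow> 'v) \<Rightarrow> int" where "sg \<equiv> sgn_char \<Delta>"

lemma sg_comp_simple: "w \<in> W \<Longrightarrow> a \<in> \<Delta> \<Longrightarrow> sg (w \<circ> reflection a) = - sg w"
  using len_comp_simple[of w a] unfolding sgn_char_def
  by (cases "len w") (auto split: if_splits)

lemma sg_comp_word: "w \<in> W \<Longrightarrow> set ds \<subseteq> \<Delta> \<Longrightarrow> sg (w \<circ> word_prod ds) = sg w * (- 1) ^ length ds"
proof (induction ds rule: rev_induct)
  case (snoc a ds)
  have "w \<circ> word_prod (ds @ [a]) = (w \<circ> word_prod ds) \<circ> reflection a"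
    by (simp add: word_prod_append comp_assoc)
  moreover have "w \<circ> word_prod ds \<in> W" using snoc word_prod_W reflection_group_comp by auto
  ultimately show ?case using snoc sg_comp_simple[of "w \<circ> word_prod ds" a] by (simp add: comp_def)
qed auto

lemma sg_comp: "u \<in> W \<Longrightarrow> w \<in> W \<Longrightarrow> sg (u \<circ> w) = sg u * sg w"
  using sg_comp_word len_word sgn_char_def by metis

lemma sg_simple: "a \<in> \<Delta> \<Longrightarrow> sg (reflection a) = - 1"
  using sg_comp_simple[OF reflection_group.one, of a] by (simp add: sgn_char_def)

lemma sg_square [simp]: "sg w * sg w = 1"
  by (simp add: sgn_char_def flip: power_add)

text \<open>\<open>W\<close> acts faithfully on \<open>R\<close>, even if \<open>R\<close> does not
  span: an element fixing all roots sends no simple root to a negative one, hence has no descent and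
  is the identity.\<close>

lemma finite_W: "finite W"
proof -
  have "inj_on (\<lambda>w. restrict w R) W"
  proof (rule inj_onI)
    fix u w assume uw: "u \<in> W" "w \<in> W" "restrict u R = restrict w R"
    then have eq: "u a = w a" if "a \<in> R" for a using that by (metis restrict_apply')
    let ?z = "inv w \<circ> u"
    have z: "?z \<in> W" using uw reflection_group_comp reflection_group_inv by blast
    have "?z a = a" if "a \<in> R" for a using eq[OF that] uw by simp
    then have "?z = id" using descent_ex[OF z] simple_root simple_root_positive by metis
    then have "w \<circ> (inv w \<circ> u) = w" by simp
    then show "u = w" using uw by (simp add: fun_eq_iff)
  qed
  moreover have "(\<lambda>w. restrict w R) ` W \<subseteq> R \<rightarrow>\<^sub>E R" using W_root by auto
  ultimately show ?thesis using finite_roots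
    by (meson finite_PiE finite_imageD finite_subset)
qed

end

section \<open>Commutation relations in the graded Hecke algebra\<close>

abbreviation cx :: "('v \<Rightarrow> 'v) \<Rightarrow> 'v cplx \<Rightarrow> 'v cplx" where
  "cx w \<equiv> map_prod w w"

lemma cx_id [simp]: "cx id = id"
  by (simp add: fun_eq_iff)

lemma cx_comp: "cx (u \<circ> w) = cx u \<circ> cx w"
  by (simp add: fun_eq_iff)

lemma reflectionV_eq: "reflectionV a v = v - scaleV (corootV a v) (embedV a)"
  by (cases v) (simp add: reflectionV_def reflection_def scaleV_def embedV_def corootV_def)

lemma reflectionV_embedV [simp]: "reflectionV a (embedV b) = embedV (reflection a b)"
  by (simp add: reflectionV_def embedV_def reflection_def coroot_def)

lemma reflectionV_reflectionV [simp]: "reflectionV a (reflectionV a v) = v"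
  by (cases v) (simp add: reflectionV_def)

lemma reflectionV_cx: "reflectionV a = cx (reflection a)"
  by (simp add: reflectionV_def)

lemma corootV_embedV [simp]: "corootV a (embedV v) = of_real (coroot a v)"
  by (simp add: corootV_def embedV_def complex_of_real_def coroot_def)

lemma corootV_scaleV: "corootV a (scaleV z v) = z * corootV a v"
  by (cases v) (simp add: corootV_def scaleV_def coroot_add coroot_diff coroot_scaleR complex_eq_iff)

lemma corootV_diff: "corootV a (u - v) = corootV a u - corootV a v"
  by (simp add: corootV_def coroot_diff complex_eq_iff)

lemma corootV_reflectionV: "a \<noteq> 0 \<Longrightarrow> corootV a (reflectionV a v) = - corootV a v"
  by (simp add: reflectionV_eq corootV_diff corootV_scaleV)

lemma corootV_cx: "w \<in> reflection_group S \<Longrightarrow> corootV (w b) (cx w v) = corootV b v"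
  by (simp add: corootV_def reflection_group_coroot)

lemma embedV_minus: "embedV (- a) = - embedV a"
  by (simp add: embedV_def)

lemma cx_embedV: "linear w \<Longrightarrow> cx w (embedV a) = embedV (w a)"
  by (simp add: embedV_def linear_0)

lemma dualV_add: "\<mu> \<in> dualV \<Longrightarrow> \<mu> (u + v) = \<mu> u + \<mu> v"
  and dualV_scale: "\<mu> \<in> dualV \<Longrightarrow> \<mu> (scaleV a v) = a * \<mu> v"
  unfolding dualV_def Vector_Spaces.linear_iff by blast+

lemma vector_space_complex: "vector_space ((*) :: complex \<Rightarrow> complex \<Rightarrow> complex)"
  by unfold_locales (simp_all add: algebra_simps)

lemma dualV_I:
  "(\<And>u v. \<mu> (u + v) = \<mu> u + \<mu> v) \<Longrightarrow> (\<And>a v. \<mu> (scaleV a v) = a * \<mu> v) \<Longrightarrow> \<mu> \<in> dualV"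
  unfolding dualV_def Vector_Spaces.linear_iff
  using vector_space_scaleV vector_space_complex by blast

lemma scaleV_minus_one: "scaleV (- 1) v = - v"
  by (cases v) (simp add: scaleV_def)

lemma dualV_minus: "\<mu> \<in> dualV \<Longrightarrow> \<mu> (- v) = - \<mu> v"
  using dualV_scale[of \<mu> "- 1" v] by (simp add: scaleV_minus_one)

lemma dualV_diff: "\<mu> \<in> dualV \<Longrightarrow> \<mu> (u - v) = \<mu> u - \<mu> v"
  using dualV_add[of \<mu> u "- v"] by (simp add: dualV_minus)

lemma dualV_reflectionV: "\<mu> \<in> dualV \<Longrightarrow> \<mu> (reflectionV a v) = \<mu> v - corootV a v * \<mu> (embedV a)"
  by (simp add: reflectionV_eq dualV_diff dualV_scale)

lemma linear_embedV_functional: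
  assumes "\<mu> \<in> dualV"
  shows "linear (\<lambda>v. Re (\<mu> (embedV v)))" "linear (\<lambda>v. Im (\<mu> (embedV v)))"
proof -
  have "\<mu> (embedV (u + v)) = \<mu> (embedV u) + \<mu> (embedV v)" for u v
    using dualV_add[OF assms, of "embedV u" "embedV v"] by (simp add: embedV_def)
  moreover have "\<mu> (embedV (r *\<^sub>R v)) = r * \<mu> (embedV v)" for r v
    using dualV_scale[OF assms, of "of_real r" "embedV v"] by (simp add: embedV_def scaleV_def)
  ultimately show "linear (\<lambda>v. Re (\<mu> (embedV v)))" "linear (\<lambda>v. Im (\<mu> (embedV v)))"
    by (simp_all add: linear_iff)
qed

lemma dualV_cx:
  assumes "\<mu> \<in> dualV" "linear w"
  shows "\<mu> \<circ> cx w \<in> dualV"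
proof (rule dualV_I)
  have "cx w (u + v) = cx w u + cx w v" for u v
    using assms(2) by (cases u, cases v) (simp add: linear_add)
  then show "(\<mu> \<circ> cx w) (u + v) = (\<mu> \<circ> cx w) u + (\<mu> \<circ> cx w) v" for u v
    using assms(1) by (simp add: dualV_add del: map_prod_simp)
  have "cx w (scaleV a v) = scaleV a (cx w v)" for a v
    using assms(2) by (cases v) (simp add: scaleV_def linear_add linear_diff linear_scale)
  then show "(\<mu> \<circ> cx w) (scaleV a v) = a * (\<mu> \<circ> cx w) v" for a v
    using assms(1) by (simp add: dualV_scale)
qed

context root_system
begin

text \<open>A finite spanning set is enough to reduce statements about all of V to finitely many
  vectors: it is used for common eigenvectors and for a countable set of monomials.\<close>

lemma complex_basis:
  obtains B :: "'v cplx set" where "finite B"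
    "\<And>v. \<exists>k. v = (\<Sum>b\<in>B. scaleV (k b) b)"
proof -
  obtain B :: "'v set" where B: "finite B" "span B = UNIV" using finite_dimensional by blast
  have "\<exists>k. v = (\<Sum>b\<in>embedV ` B. scaleV (k b) b)" for v :: "'v cplx"
  proof -
    have "fst v \<in> span B" "snd v \<in> span B" using B by auto
    then obtain f g where fg: "fst v = (\<Sum>b\<in>B. f b *\<^sub>R b)" "snd v = (\<Sum>b\<in>B. g b *\<^sub>R b)"
      using span_finite[OF B(1)] by auto
    have "v = (fst v, snd v)" by simp
    also have "\<dots> = (\<Sum>b\<in>B. scaleV (Complex (f b) (g b)) (embedV b))"
      by (simp add: fg scaleV_def embedV_def sum_prod)
    also have "\<dots> = (\<Sum>b\<in>embedV ` B. scaleV (Complex (f (fst b)) (g (fst b))) b)"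
      by (subst sum.reindex) (auto simp: embedV_def inj_on_def)
    finally show ?thesis by (rule exI[of _ "\<lambda>b. Complex (f (fst b)) (g (fst b))"])
  qed
  then show ?thesis using that[of "embedV ` B"] B(1) by blast
qed

end

section \<open>Scalars, the symmetric algebra and the intertwiners\<close>

context graded_hecke_algebra
begin

text \<open>Scalars are written as central elements of the algebra, so that they act on modules
  through \<open>act\<close> and move past any factor by \<open>K_commute\<close>.\<close>

definition K :: "complex \<Rightarrow> 'h" where "K a = scaleH a 1"

lemma scaleH_eq: "scaleH a x = K a * x"
  by (simp add: K_def scale_mult_left)

lemma K_commute: "x * K a = K a * x"
  by (simp add: K_def scale_mult_left scale_mult_right)

lemma K_add: "K (a + b) = K a + K b"
  by (simp add: K_def scale_left_distrib)

lemma K_mult: "K (a * b) = K a * K b"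
  by (simp add: K_def scale_mult_left)

lemma K_simps [simp]: "K 0 = 0" "K 1 = 1"
  by (simp_all add: K_def)

lemma K_minus: "K (- a) = - K a"
  by (simp add: K_def)

lemma K_diff: "K (a - b) = K a - K b"
  by (simp add: K_def scale_left_diff_distrib)

text \<open>Working with preimages in the polynomial ring allows products over sets of roots, for
  which the noncommutative algebra itself has no unordered product.\<close>

definition sym_map :: "'v free_poly \<Rightarrow> 'h" where
  "sym_map = (SOME \<phi>. sym_algebra_hom scaleH \<phi> \<and> (\<forall>v. \<phi> (var v) = \<iota> v) \<and> {p. \<phi> p = 0} = sym_ideal)"

lemma sym_hom: "sym_algebra_hom scaleH sym_map"
  and sym_var [simp]: "sym_map (var v) = \<iota> v"
  and sym_kernel: "{p. sym_map p = 0} = sym_ideal"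
  using someI_ex[OF sym_algebra_inj] unfolding sym_map_def by blast+

lemma sym_add: "sym_map (p + q) = sym_map p + sym_map q"
  and sym_mult: "sym_map (p * q) = sym_map p * sym_map q"
  and sym_one [simp]: "sym_map 1 = 1"
  using sym_hom by (simp_all only: sym_algebra_hom_def)

lemma sym_const_mult: "sym_map (const a * p) = K a * sym_map p"
proof -
  have "\<forall>a p. sym_map (const a * p) = scaleH a (sym_map p)"
    using sym_hom unfolding sym_algebra_hom_def by (elim conjE) assumption
  then have "sym_map (const a * p) = scaleH a (sym_map p)" by (elim allE)
  then show ?thesis by (simp only: scaleH_eq)
qed

lemma sym_const [simp]: "sym_map (const a) = K a"
  using sym_const_mult[of a 1] by simp

lemma sym_diff: "sym_map (p - q) = sym_map p - sym_map q"
  using sym_add[of "p - q" q] by (simp add: algebra_simps)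

lemma sym_commute: "sym_map p * sym_map q = sym_map q * sym_map p"
  by (metis sym_mult mult.commute)

lemma iota_sym_map: "\<iota> v * sym_map p = sym_map p * \<iota> v"
  using sym_commute[of "var v" p] by simp

lemma iota_commute: "\<iota> u * \<iota> v = \<iota> v * \<iota> u"
  using sym_commute[of "var u" "var v"] by simp

lemma sym_linear_relation: "p \<in> linear_relations \<Longrightarrow> sym_map p = 0"
proof -
  have "module ((*) :: 'v free_poly \<Rightarrow> 'v free_poly \<Rightarrow> 'v free_poly)"
    by unfold_locales (simp_all add: algebra_simps)
  then have "linear_relations \<subseteq> (sym_ideal :: 'v free_poly set)"
    unfolding sym_ideal_def by (rule module.span_superset)
  then show "p \<in> linear_relations \<Longrightarrow> sym_map p = 0" using sym_kernel by blast
qed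

text \<open>Linearity of \<open>\<iota>\<close> comes from the relations that generate the kernel
  \<open>sym_ideal\<close>.\<close>

lemma iota_add: "\<iota> (u + v) = \<iota> u + \<iota> v"
proof -
  have "sym_map (var (u + v) - var u - var v) = 0"
    by (rule sym_linear_relation) (unfold linear_relations_def, blast)
  then show ?thesis by (simp add: sym_diff) (metis diff_diff_add eq_iff_diff_eq_0)
qed

lemma iota_scale: "\<iota> (scaleV a v) = K a * \<iota> v"
proof -
  have "sym_map (var (scaleV a v) - const a * var v) = 0"
    by (rule sym_linear_relation) (unfold linear_relations_def, blast)
  then show ?thesis by (simp only: sym_diff sym_const_mult sym_var right_minus_eq)
qed

lemma iota_minus: "\<iota> (- v) = - \<iota> v"
  using iota_scale[of "- 1" v] by (simp add: scaleV_minus_one K_minus)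

lemma iota_diff: "\<iota> (u - v) = \<iota> u - \<iota> v"
  using iota_add[of u "- v"] by (simp add: iota_minus)

abbreviation s :: "'v \<Rightarrow> 'h" where "s a \<equiv> t (reflection a)"
abbreviation rt :: "'v \<Rightarrow> 'h" where "rt a \<equiv> \<iota> (embedV a)"

lemma s_square: "a \<in> \<Delta> \<Longrightarrow> s a * s a = 1"
  using t_mult[of "reflection a" "reflection a"] reflection_W[OF simple_root] t_one by simp

lemma s_iota: "a \<in> \<Delta> \<Longrightarrow> s a * \<iota> v = \<iota> (reflectionV a v) * s a + K (c a * corootV a v)"
  using cross_relation[of a v] by (simp add: K_def algebra_simps)

lemma iota_s:
  assumes "a \<in> \<Delta>" shows "\<iota> v * s a = s a * \<iota> (reflectionV a v) + K (c a * corootV a v)"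
  using s_iota[OF assms, of "reflectionV a v"] root_nonzero[OF simple_root[OF assms]]
  by (simp add: corootV_reflectionV K_minus)

definition tau :: "'v \<Rightarrow> 'h" where "tau a = s a * rt a - K (c a)"

lemma tau_eq:
  assumes "a \<in> \<Delta>" shows "tau a = K (c a) - rt a * s a"
proof -
  have "s a * rt a = - (rt a * s a) + K (c a * 2)"
    using s_iota[OF assms, of "embedV a"] root_nonzero[OF simple_root[OF assms]]
    by (simp add: embedV_minus iota_minus)
  also have "K (c a * 2) = K (c a) + K (c a)" by (simp only: mult_2_right K_add)
  finally show ?thesis by (simp add: tau_def)
qed

lemma tau_iota:
  assumes "a \<in> \<Delta>" shows "tau a * \<iota> v = \<iota> (reflectionV a v) * tau a"
proof -
  have "tau a * \<iota> v = (s a * \<iota> v) * rt a - K (c a) * \<iota> v"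
    by (simp add: tau_def left_diff_distrib mult.assoc iota_commute)
  also have "\<dots> = \<iota> (reflectionV a v) * (s a * rt a) + K (c a) * (K (corootV a v) * rt a - \<iota> v)"
    by (simp add: s_iota[OF assms] K_mult algebra_simps)
  also have "K (corootV a v) * rt a - \<iota> v = - \<iota> (reflectionV a v)"
    by (simp add: reflectionV_eq iota_diff iota_scale)
  finally show ?thesis by (simp add: tau_def right_diff_distrib K_commute[of "\<iota> (reflectionV a v)"])
qed

lemma iota_tau: "a \<in> \<Delta> \<Longrightarrow> \<iota> v * tau a = tau a * \<iota> (reflectionV a v)"
  by (simp add: tau_iota)

text \<open>One factor is used in the form with the root on the right of \<open>s a\<close>, the
  other with the root on the left, so that the two reflections meet and cancel.\<close>

lemma tau_square:
  assumes "a \<in> \<Delta>" shows "tau a * tau a = (K (c a) - rt a) * (K (c a) + rt a)"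
proof -
  have "tau a * tau a = tau a * (s a * rt a) - tau a * K (c a)"
    by (simp only: tau_def right_diff_distrib)
  also have "\<dots> = tau a * s a * rt a - K (c a) * tau a"
    by (simp only: K_commute[of "tau a"] mult.assoc)
  also have "tau a * s a = K (c a) * s a - rt a"
    by (simp add: tau_eq[OF assms] left_diff_distrib mult.assoc s_square[OF assms])
  finally have "tau a * tau a = (K (c a) * s a - rt a) * rt a - K (c a) * (s a * rt a - K (c a))"
    by (simp only: tau_def)
  then show ?thesis using K_commute[of "rt a" "c a"]
    by (simp only: left_diff_distrib right_diff_distrib distrib_left mult.assoc) simp
qed

text \<open>With the inverse, a right factor \<open>reflection a\<close> of \<open>w\<close> becomes a left factor \<open>s a\<close>.\<close>

definition ti :: "('v \<Rightarrow> 'v) \<Rightarrow> 'h" where "ti w = t (inv w)"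

lemma ti_id [simp]: "ti id = 1"
  by (simp add: ti_def t_one)

lemma ti_comp: "u \<in> W \<Longrightarrow> w \<in> W \<Longrightarrow> ti (u \<circ> w) = ti w * ti u"
  by (simp add: ti_def reflection_group_inv_comp t_mult reflection_group_inv)

lemma ti_reflection: "ti (reflection a) = s a"
  by (simp add: ti_def)

lemma ti_comp_reflection: "u \<in> W \<Longrightarrow> a \<in> R \<Longrightarrow> ti (u \<circ> reflection a) = s a * ti u"
  by (simp add: ti_comp reflection_W ti_reflection)

definition inversions :: "('v \<Rightarrow> 'v) \<Rightarrow> 'v set" where
  "inversions w = {b \<in> P. w b \<notin> P}"

lemma inversions_D: "b \<in> inversions w \<Longrightarrow> b \<in> P" "b \<in> inversions w \<Longrightarrow> w b \<notin> P"
  by (simp_all add: inversions_def)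

lemma finite_inversions: "finite (inversions w)"
  using finite_positive_roots by (simp add: inversions_def)

lemma inversions_comp_simple:
  assumes "u \<in> W" "a \<in> \<Delta>" "u a \<in> P"
  shows "inversions (u \<circ> reflection a) = insert a (reflection a ` inversions u)"
    and "a \<notin> reflection a ` inversions u"
proof -
  show "a \<notin> reflection a ` inversions u"
  proof
    assume "a \<in> reflection a ` inversions u"
    then obtain b where "b \<in> P" "a = reflection a b" by (auto simp: inversions_def)
    then have "b = - a" by (metis reflection_reflection reflection_self)
    then show False using \<open>b \<in> P\<close> not_positive_uminus simple_root_positive assms by blast
  qed
  show "inversions (u \<circ> reflection a) = insert a (reflection a ` inversions u)"
  proof
    show "inversions (u \<circ> reflection a) \<subseteq> insert a (reflection a ` inversions u)"
    proof
      fix b assume "b \<in> inversions (u \<circ> reflection a)"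
      then have b: "b \<in> P" "u (reflection a b) \<notin> P" by (auto simp: inversions_def)
      show "b \<in> insert a (reflection a ` inversions u)"
      proof (cases "b = a")
        case False
        then have "reflection a b \<in> inversions u"
          using b reflection_positive[OF assms(2)] by (simp add: inversions_def)
        then have "reflection a (reflection a b) \<in> reflection a ` inversions u" by (rule imageI)
        then show ?thesis by simp
      qed simp
    qed
    have "a \<in> inversions (u \<circ> reflection a)"
      using not_positive_uminus[OF assms(3)] simple_root_positive[OF assms(2)] assms(1)
      by (simp add: inversions_def reflection_group_minus)
    moreover have "reflection a b \<in> inversions (u \<circ> reflection a)" if "b \<in> inversions u" for b
      using that assms reflection_positive[OF assms(2), of b] by (auto simp: inversions_def)
    ultimately show "insert a (reflection a ` inversions u) \<subseteq> inversions (u \<circ> reflection a)" by blast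
  qed
qed

text \<open>The cross relation for arbitrary \<open>w\<close>, by induction on the length. Moving v
  past the first simple reflection creates the term of \<open>a\<close>; the reflection in
  \<open>a\<close> carries the terms for the shorter \<open>u\<close> to the remaining inversions of
  \<open>w\<close>. All correction terms belong to strictly shorter elements, so V acts
  triangularly.\<close>

lemma iota_ti:
  "w \<in> W \<Longrightarrow> \<iota> v * ti w = ti w * \<iota> (cx w v)
    + (\<Sum>b\<in>inversions w. K (c b * corootV b v) * ti (w \<circ> reflection b))"
proof (induction "len w" arbitrary: w v rule: less_induct)
  case less
  show ?case
  proof (cases "w = id")
    case True
    then show ?thesis by (simp add: inversions_def)
  next
    case False
    then obtain a where a: "a \<in> \<Delta>" "w a \<notin> P" using descent_ex less(2) by blast
    define u where "u = w \<circ> reflection a"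
    have aR: "a \<in> R" using a simple_root by blast
    have u: "u \<in> W" unfolding u_def using W_comp_reflection[OF less(2) aR] .
    have w: "w = u \<circ> reflection a" by (simp add: u_def comp_assoc)
    have ua: "u a \<in> P"
      using uminus_positive[OF W_root[OF less(2) aR] a(2)] less(2) by (simp add: u_def reflection_group_minus)
    have lt: "len u < len w"
      unfolding u_def by (rule len_comp_reflection_less[OF less(2) simple_root_positive[OF a(1)] a(2)])
    let ?r = "reflection a"
    \<comment> \<open>The parameter and the pairing are invariant under \<open>W\<close>, and
      conjugation by the reflection in \<open>a\<close> turns \<open>u \<circ> reflection b\<close>,
      followed on the right by that reflection, into
      \<open>w \<circ> reflection (?r b)\<close>.\<close>
    have step: "s a * (K (c b * corootV b (reflectionV a v)) * ti (u \<circ> reflection b))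
        = K (c (?r b) * corootV (?r b) v) * ti (w \<circ> reflection (?r b))" if b: "b \<in> inversions u" for b
    proof -
      have bR: "b \<in> R" using b inversions_D positive_root by blast
      have c: "c (?r b) = c b" using parameter_invariant[OF reflection_W[OF aR] bR] .
      have "corootV (?r b) v = corootV (?r b) (cx ?r (reflectionV a v))"
        by (simp only: reflectionV_cx[symmetric] reflectionV_reflectionV)
      then have cor: "corootV (?r b) v = corootV b (reflectionV a v)"
        by (simp only: corootV_cx[OF reflection_W[OF aR]])
      have "?r \<circ> reflection (?r b) = reflection b \<circ> ?r"
        using reflection_group_conj[OF reflection_W[OF aR], of "?r b"] by simp
      then have "w \<circ> reflection (?r b) = u \<circ> reflection b \<circ> ?r"
        by (simp only: w comp_assoc)
      then have "ti (w \<circ> reflection (?r b)) = s a * ti (u \<circ> reflection b)"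
        by (simp only: ti_comp_reflection[OF W_comp_reflection[OF u bR] aR])
      then show ?thesis by (simp only: c cor mult.assoc[symmetric] K_commute[of "s a"])
    qed
    have "\<iota> v * ti w = (\<iota> v * s a) * ti u"
      by (simp add: w ti_comp_reflection[OF u aR] mult.assoc)
    also have "\<dots> = s a * (\<iota> (reflectionV a v) * ti u) + K (c a * corootV a v) * ti u"
      by (simp add: iota_s[OF a(1)] distrib_right mult.assoc)
    also have "\<iota> (reflectionV a v) * ti u = ti u * \<iota> (cx u (reflectionV a v))
        + (\<Sum>b\<in>inversions u. K (c b * corootV b (reflectionV a v)) * ti (u \<circ> reflection b))"
      by (rule less(1)[OF lt u])
    also have "cx u (reflectionV a v) = cx w v"
      by (simp add: w reflectionV_cx cx_comp)
    also have "s a * (ti u * \<iota> (cx w v)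
        + (\<Sum>b\<in>inversions u. K (c b * corootV b (reflectionV a v)) * ti (u \<circ> reflection b)))
      = ti w * \<iota> (cx w v) + (\<Sum>b\<in>inversions u. K (c (?r b) * corootV (?r b) v) * ti (w \<circ> reflection (?r b)))"
      by (simp add: w ti_comp_reflection[OF u aR] distrib_left mult.assoc sum_distrib_left step[unfolded w] cong: sum.cong)
    also have "(\<Sum>b\<in>inversions u. K (c (?r b) * corootV (?r b) v) * ti (w \<circ> reflection (?r b)))
      = (\<Sum>b\<in>?r ` inversions u. K (c b * corootV b v) * ti (w \<circ> reflection b))"
      by (rule sum.reindex_cong[symmetric, where l = ?r]) (auto intro!: inj_onI dest: arg_cong[of _ _ ?r])
    finally have "\<iota> v * ti w = ti w * \<iota> (cx w v)
      + (\<Sum>b\<in>?r ` inversions u. K (c b * corootV b v) * ti (w \<circ> reflection b))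
      + K (c a * corootV a v) * ti u" .
    moreover have "inversions w = insert a (?r ` inversions u)" "a \<notin> ?r ` inversions u"
      using inversions_comp_simple[OF u a(1) ua] w by auto
    ultimately show ?thesis using finite_inversions[of u]
      by (simp add: u_def add.commute add.left_commute)
  qed
qed

end

section \<open>Generalized weight spaces\<close>

locale hecke_module = graded_hecke_algebra R \<Delta> scaleH c t \<iota> + left_module act
  for R \<Delta> :: "'v::real_inner set"
    and scaleH :: "complex \<Rightarrow> 'h::ring_1 \<Rightarrow> 'h"
    and c :: "'v \<Rightarrow> complex"
    and t :: "('v \<Rightarrow> 'v) \<Rightarrow> 'h"
    and \<iota> :: "'v cplx \<Rightarrow> 'h"
    and act :: "'h \<Rightarrow> 'm::ab_group_add \<Rightarrow> 'm" +
  assumes positive: "positive_parameter R c"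
begin

notation act (infixr "\<star>" 75)

lemma act_zero_right [simp]: "h \<star> 0 = 0"
  using act_add_right[of h 0 0] by simp

lemma act_zero_left [simp]: "0 \<star> m = 0"
  using act_add_left[of 0 0 m] by simp

lemma act_minus_right: "h \<star> (- m) = - (h \<star> m)"
  using act_add_right[of h m "- m"] by (simp add: eq_neg_iff_add_eq_0 add.commute)

lemma act_minus_left: "(- h) \<star> m = - (h \<star> m)"
  using act_add_left[of h "- h" m] by (simp add: eq_neg_iff_add_eq_0 add.commute)

lemma act_diff_right: "h \<star> (m - n) = h \<star> m - h \<star> n"
  using act_add_right[of h m "- n"] by (simp add: act_minus_right)

lemma act_diff_left: "(g - h) \<star> m = g \<star> m - h \<star> m"
  using act_add_left[of g "- h" m] by (simp add: act_minus_left)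

lemma act_sum_right: "h \<star> (\<Sum>i\<in>I. f i) = (\<Sum>i\<in>I. h \<star> f i)"
  by (induction I rule: infinite_finite_induct) (simp_all add: act_add_right)

lemma act_sum_left: "(\<Sum>i\<in>I. f i) \<star> m = (\<Sum>i\<in>I. f i \<star> m)"
  by (induction I rule: infinite_finite_induct) (simp_all add: act_add_left)

lemmas act_simps = act_add_left act_add_right act_diff_left act_diff_right act_mult act_one
  act_minus_left act_minus_right

sublocale M: vector_space "\<lambda>a. act (K a)"
  by unfold_locales (simp_all add: act_simps K_add K_mult)

lemma K_act_commute: "h \<star> K a \<star> m = K a \<star> h \<star> m"
  by (simp only: act_mult[symmetric] K_commute[of h])

lemma K_act_eq_0: "K a \<star> m = 0 \<longleftrightarrow> a = 0 \<or> m = 0"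
  by (rule M.scale_eq_0_iff)

abbreviation gws :: "('v cplx \<Rightarrow> complex) \<Rightarrow> 'm set" where
  "gws \<equiv> generalized_weight_space scaleH \<iota> act"

abbreviation shift :: "('v cplx \<Rightarrow> complex) \<Rightarrow> 'v cplx \<Rightarrow> 'h" where
  "shift \<mu> v \<equiv> \<iota> v - K (\<mu> v)"

lemma power_act_zero_mono: "h ^ k \<star> m = 0 \<Longrightarrow> k \<le> j \<Longrightarrow> h ^ j \<star> m = 0"
  by (metis act_mult act_zero_right le_add_diff_inverse2 power_add)

lemma gws_iff: "m \<in> gws \<mu> \<longleftrightarrow> (\<forall>v. \<exists>k. shift \<mu> v ^ k \<star> m = 0)"
  unfolding generalized_weight_space_def eventually_sequentially mem_Collect_eq K_def[symmetric]
  using power_act_zero_mono by blast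

lemma gws_zero [simp]: "0 \<in> gws \<mu>"
  by (simp add: gws_iff)

lemma gws_add: "m \<in> gws \<mu> \<Longrightarrow> n \<in> gws \<mu> \<Longrightarrow> m + n \<in> gws \<mu>"
  unfolding gws_iff
proof
  fix v
  assume "\<forall>v. \<exists>k. shift \<mu> v ^ k \<star> m = 0" "\<forall>v. \<exists>k. shift \<mu> v ^ k \<star> n = 0"
  then obtain k l where "shift \<mu> v ^ k \<star> m = 0" "shift \<mu> v ^ l \<star> n = 0" by blast
  then have "shift \<mu> v ^ max k l \<star> (m + n) = 0"
    using power_act_zero_mono[of "shift \<mu> v" k m "max k l"] power_act_zero_mono[of "shift \<mu> v" l n "max k l"]
    by (simp add: act_add_right)
  then show "\<exists>k. shift \<mu> v ^ k \<star> (m + n) = 0" by blast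
qed

text \<open>The vector u may depend on v: it is v itself for elements commuting with V, and the
  reflected vector for \<open>tau a\<close>.\<close>

lemma gws_intertwine:
  assumes "m \<in> gws \<mu>" "\<And>v. \<exists>u. shift \<nu> v * h = h * shift \<mu> u"
  shows "h \<star> m \<in> gws \<nu>"
  unfolding gws_iff
proof
  fix v
  obtain u where u: "shift \<nu> v * h = h * shift \<mu> u" using assms(2) by blast
  obtain k where k: "shift \<mu> u ^ k \<star> m = 0" using assms(1) unfolding gws_iff by blast
  have "shift \<nu> v ^ k * h = h * shift \<mu> u ^ k"
  proof (induction k)
    case (Suc k)
    have "shift \<nu> v ^ Suc k * h = shift \<nu> v * h * shift \<mu> u ^ k"
      by (simp only: power_Suc mult.assoc Suc)
    then show ?case by (simp only: u mult.assoc power_Suc)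
  qed simp
  then have "shift \<nu> v ^ k \<star> h \<star> m = 0" using k by (metis act_mult act_zero_right)
  then show "\<exists>k. shift \<nu> v ^ k \<star> h \<star> m = 0" by blast
qed

lemma gws_central:
  assumes "m \<in> gws \<mu>" "\<And>v. \<iota> v * h = h * \<iota> v"
  shows "h \<star> m \<in> gws \<mu>"
proof (rule gws_intertwine[OF assms(1)], rule exI)
  show "shift \<mu> v * h = h * shift \<mu> v" for v
    by (simp only: left_diff_distrib right_diff_distrib assms(2) K_commute[of h])
qed

lemma gws_K: "m \<in> gws \<mu> \<Longrightarrow> K a \<star> m \<in> gws \<mu>"
  by (rule gws_central) (simp_all add: K_commute[of "\<iota> _"])

lemma gws_iota: "m \<in> gws \<mu> \<Longrightarrow> \<iota> u \<star> m \<in> gws \<mu>"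
  by (rule gws_central) (simp_all add: iota_commute)

lemma gws_minus: "m \<in> gws \<mu> \<Longrightarrow> - m \<in> gws \<mu>"
  using gws_K[of m \<mu> "- 1"] by (simp add: K_minus act_simps)

lemma gws_diff: "m \<in> gws \<mu> \<Longrightarrow> n \<in> gws \<mu> \<Longrightarrow> m - n \<in> gws \<mu>"
  using gws_add[of m \<mu> "- n"] gws_minus by simp

lemma subspace_gws: "M.subspace (gws \<mu>)"
  by (intro M.subspaceI gws_zero gws_add gws_K)

lemma gws_tau:
  assumes "a \<in> \<Delta>" "m \<in> gws \<mu>"
  shows "tau a \<star> m \<in> gws (\<mu> \<circ> reflectionV a)"
proof (rule gws_intertwine[OF assms(2)], rule exI)
  show "shift (\<mu> \<circ> reflectionV a) v * tau a = tau a * shift \<mu> (reflectionV a v)" for v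
    by (simp only: left_diff_distrib right_diff_distrib iota_tau[OF assms(1)] K_commute[of "tau a"] comp_apply)
qed

text \<open>If v acts on m by \<open>a\<close>, then the powers of \<open>shift \<mu> v\<close> act
  on m by powers of the nonzero number \<open>a - \<mu> v\<close>, and one of these powers kills
  m.\<close>

lemma gws_shift_injective:
  assumes "m \<in> gws \<mu>" "\<mu> v \<noteq> a" "(\<iota> v - K a) \<star> m = 0"
  shows "m = 0"
proof -
  obtain k where k: "shift \<mu> v ^ k \<star> m = 0" using assms(1) unfolding gws_iff by blast
  have "shift \<mu> v \<star> m = K (a - \<mu> v) \<star> m" using assms(3) by (simp add: act_simps K_diff)
  then have "shift \<mu> v ^ k \<star> m = K ((a - \<mu> v) ^ k) \<star> m"
  proof (induction k)
    case (Suc k)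
    have "shift \<mu> v ^ Suc k \<star> m = shift \<mu> v ^ k \<star> shift \<mu> v \<star> m"
      by (simp only: power_Suc2 act_mult)
    also have "\<dots> = K (a - \<mu> v) \<star> shift \<mu> v ^ k \<star> m"
      by (simp only: Suc.prems K_act_commute)
    also have "\<dots> = K ((a - \<mu> v) ^ Suc k) \<star> m" by (simp only: Suc power_Suc K_mult act_mult)
    finally show ?case .
  qed (simp add: act_one)
  then show ?thesis using k assms(2) by (simp add: K_act_eq_0)
qed

text \<open>The operator is the nonzero scalar \<open>\<mu> v - a\<close> plus the locally nilpotent
  \<open>shift \<mu> v\<close>. The induction on the exponent builds the finite geometric series
  that inverts it on m, so finite dimension is not involved.\<close>

lemma gws_shift_surjective:
  assumes "m \<in> gws \<mu>" "\<mu> v \<noteq> a"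
  shows "\<exists>n\<in>gws \<mu>. (\<iota> v - K a) \<star> n = m"
proof -
  obtain k where k: "shift \<mu> v ^ k \<star> m = 0" using assms(1) unfolding gws_iff by blast
  then show ?thesis using assms(1)
  proof (induction k arbitrary: m)
    case 0
    then show ?case by (intro bexI[of _ 0]) (simp_all add: act_one)
  next
    case (Suc k)
    have "shift \<mu> v ^ k \<star> (shift \<mu> v \<star> m) = 0"
      using Suc.prems(1) by (simp only: power_Suc2 act_mult)
    moreover have sm: "shift \<mu> v \<star> m \<in> gws \<mu>"
      using gws_diff[OF gws_iota gws_K] Suc.prems(2) by (simp add: act_diff_left)
    ultimately obtain n where n: "n \<in> gws \<mu>" "(\<iota> v - K a) \<star> n = shift \<mu> v \<star> m"
      using Suc.IH by blast
    define b where "b = \<mu> v - a"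
    have b: "b \<noteq> 0" using assms(2) by (simp add: b_def)
    have "(\<iota> v - K a) \<star> (m - n) = (\<iota> v - K a - shift \<mu> v) \<star> m"
      by (simp only: act_diff_right n(2) act_diff_left[of "\<iota> v - K a" "shift \<mu> v"])
    also have "\<iota> v - K a - shift \<mu> v = K b" by (simp add: b_def K_diff)
    finally have "(\<iota> v - K a) \<star> (m - n) = K b \<star> m" .
    then have "(\<iota> v - K a) \<star> K (1 / b) \<star> (m - n) = K (1 / b) \<star> K b \<star> m"
      by (simp only: K_act_commute[of "\<iota> v - K a"])
    also have "\<dots> = m" using b by (simp only: act_mult[symmetric] K_mult[symmetric]) (simp add: act_one)
    finally show ?case using gws_K[OF gws_diff[OF Suc.prems(2) n(1)]] by blast
  qed
qed

text \<open>Products of factors that are injective on \<open>gws \<mu>\<close>. Closed under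
  multiplication and commutative, they can kill sums of vectors of other weights without killing
  anything nonzero of weight \<open>\<mu>\<close>.\<close>

inductive_set separators :: "('v cplx \<Rightarrow> complex) \<Rightarrow> 'h set" for \<mu> where
  one: "1 \<in> separators \<mu>"
| step: "p \<in> separators \<mu> \<Longrightarrow> \<mu> v \<noteq> a \<Longrightarrow> (\<iota> v - K a) * p \<in> separators \<mu>"

lemma separators_mult: "p \<in> separators \<mu> \<Longrightarrow> q \<in> separators \<mu> \<Longrightarrow> p * q \<in> separators \<mu>"
  by (induction rule: separators.induct) (auto simp: mult.assoc intro: separators.step)

lemma shift_commute: "(\<iota> u - K a) * (\<iota> v - K b) = (\<iota> v - K b) * (\<iota> u - K a)"
  using K_commute[of "\<iota> u" b] K_commute[of "\<iota> v" a] K_commute[of "K a" b]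
  by (simp add: left_diff_distrib right_diff_distrib iota_commute[of u v])

lemma separators_iota: "p \<in> separators \<mu> \<Longrightarrow> \<iota> v * p = p * \<iota> v"
proof (induction rule: separators.induct)
  case (step p u a)
  have "\<iota> v * (\<iota> u - K a) = (\<iota> u - K a) * \<iota> v"
    using shift_commute[of v 0 u a] by simp
  then show ?case by (metis mult.assoc step.IH)
qed simp

lemma separators_commute: "p \<in> separators \<mu> \<Longrightarrow> q \<in> separators \<mu> \<Longrightarrow> p * q = q * p"
proof (induction rule: separators.induct)
  case (step p u a)
  have "q * (\<iota> u - K a) = (\<iota> u - K a) * q"
    by (simp only: left_diff_distrib right_diff_distrib separators_iota[OF step.prems] K_commute[of q])
  then show ?case by (metis mult.assoc step.IH step.prems)
qed simp

lemma separators_injective: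
  "p \<in> separators \<mu> \<Longrightarrow> m \<in> gws \<mu> \<Longrightarrow> p \<star> m = 0 \<Longrightarrow> m = 0"
proof (induction rule: separators.induct)
  case one
  then show ?case by (simp add: act_one)
next
  case (step p v a)
  have "p \<star> m \<in> gws \<mu>"
    by (rule gws_central[OF step.prems(1)]) (rule separators_iota[OF step.hyps(1)])
  then have "p \<star> m = 0" using gws_shift_injective step by (simp add: act_mult)
  then show ?case using step by blast
qed

definition gsum :: "('v cplx \<Rightarrow> complex) set \<Rightarrow> 'm set" where
  "gsum A = M.span (\<Union>\<mu>\<in>A. gws \<mu>)"

lemma subspace_gsum: "M.subspace (gsum A)"
  by (simp add: gsum_def M.subspace_span)

lemmas gsum_zero = M.subspace_0[OF subspace_gsum]
  and gsum_add = M.subspace_add[OF subspace_gsum]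
  and gsum_K = M.subspace_scale[OF subspace_gsum]
  and gsum_diff = M.subspace_diff[OF subspace_gsum]
  and gsum_minus = M.subspace_neg[OF subspace_gsum]
  and gsum_sum = M.subspace_sum[OF subspace_gsum]

lemma gsum_mono: "A \<subseteq> B \<Longrightarrow> m \<in> gsum A \<Longrightarrow> m \<in> gsum B"
  unfolding gsum_def using M.span_mono[of "\<Union> (gws ` A)" "\<Union> (gws ` B)"] by blast

lemma gws_gsum: "\<mu> \<in> A \<Longrightarrow> m \<in> gws \<mu> \<Longrightarrow> m \<in> gsum A"
  unfolding gsum_def by (rule M.span_base) blast

lemma gsum_singleton: "gsum {\<mu>} = gws \<mu>"
  unfolding gsum_def using M.span_eq_iff[THEN iffD2, OF subspace_gws] by simp

lemma gsum_induct [consumes 1, case_names gws subspace]: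
  assumes "m \<in> gsum A" "\<And>\<mu> m. \<mu> \<in> A \<Longrightarrow> m \<in> gws \<mu> \<Longrightarrow> Q m" "M.subspace {m. Q m}"
  shows "Q m"
proof -
  have "(\<Union>\<mu>\<in>A. gws \<mu>) \<subseteq> {m. Q m}" using assms(2) by blast
  then have "gsum A \<subseteq> {m. Q m}" unfolding gsum_def using assms(3) by (rule M.span_minimal)
  then show ?thesis using assms(1) by blast
qed

lemma subspace_preimage: "M.subspace N \<Longrightarrow> M.subspace {m. h \<star> m \<in> N}"
  by (rule M.subspaceI) (simp_all add: M.subspace_0 M.subspace_add M.subspace_scale act_add_right K_act_commute)

lemma gsum_iota: "m \<in> gsum A \<Longrightarrow> \<iota> v \<star> m \<in> gsum A"
  by (induction rule: gsum_induct) (auto intro: gws_gsum gws_iota subspace_preimage subspace_gsum)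

text \<open>A vector of weight \<open>\<nu>\<close> is killed by a power of
  \<open>shift \<nu> v\<close>, where v is chosen with \<open>\<mu> v \<noteq> \<nu> v\<close>. For
  a sum, multiply the separators of the summands.\<close>

lemma gsum_separated:
  assumes "m \<in> gsum A" "\<mu> \<notin> A"
  shows "\<exists>p\<in>separators \<mu>. p \<star> m = 0"
  using assms(1)
proof (induction rule: gsum_induct)
  case (gws \<nu> m)
  then have "\<nu> \<noteq> \<mu>" using assms(2) by blast
  then obtain v where v: "\<mu> v \<noteq> \<nu> v" by (metis ext)
  obtain k where k: "shift \<nu> v ^ k \<star> m = 0" using gws(2) unfolding gws_iff by blast
  have "shift \<nu> v ^ k \<in> separators \<mu>"
    using v by (induction k) (simp_all add: separators.intros)
  then show ?case using k by blast
next
  case subspace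
  show ?case
  proof (rule M.subspaceI)
    show "0 \<in> {m. \<exists>p\<in>separators \<mu>. p \<star> m = 0}" by (auto intro: separators.one)
  next
    fix m n assume "m \<in> {m. \<exists>p\<in>separators \<mu>. p \<star> m = 0}" "n \<in> {m. \<exists>p\<in>separators \<mu>. p \<star> m = 0}"
    then obtain p q where pq: "p \<in> separators \<mu>" "q \<in> separators \<mu>" "p \<star> m = 0" "q \<star> n = 0" by blast
    have "(p * q) \<star> (m + n) = (q * p) \<star> m + (p * q) \<star> n"
      using separators_commute[OF pq(1,2)] by (simp add: act_add_right)
    then have "(p * q) \<star> (m + n) = 0" using pq by (simp add: act_mult)
    then show "m + n \<in> {m. \<exists>p\<in>separators \<mu>. p \<star> m = 0}"
      using separators_mult pq by blast
  next
    fix b m assume "m \<in> {m. \<exists>p\<in>separators \<mu>. p \<star> m = 0}"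
    then show "K b \<star> m \<in> {m. \<exists>p\<in>separators \<mu>. p \<star> m = 0}"
      by (auto simp: K_act_commute)
  qed
qed

text \<open>Independence of the generalized weight spaces, for an arbitrary set of weights. It is
  what allows components of equal weight to be compared later.\<close>

lemma gws_gsum_disjoint: "m \<in> gws \<mu> \<Longrightarrow> m \<in> gsum A \<Longrightarrow> \<mu> \<notin> A \<Longrightarrow> m = 0"
  using gsum_separated separators_injective by blast

lemma gws_disjoint: "m \<in> gws \<mu> \<Longrightarrow> m \<in> gws \<nu> \<Longrightarrow> \<mu> \<noteq> \<nu> \<Longrightarrow> m = 0"
  using gws_gsum_disjoint[of m \<mu> "{\<nu>}"] gws_gsum[of \<nu> "{\<nu>}"] by blast

lemma gsum_component:
  assumes "m \<in> gsum A" "\<mu> \<in> A"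
  shows "\<exists>n\<in>gws \<mu>. m - n \<in> gsum (A - {\<mu>})"
proof -
  have "(\<Union>\<nu>\<in>A. gws \<nu>) = gws \<mu> \<union> (\<Union>\<nu>\<in>A - {\<mu>}. gws \<nu>)"
    using assms(2) by blast
  then have "gsum A = {x + y |x y. x \<in> M.span (gws \<mu>) \<and> y \<in> gsum (A - {\<mu>})}"
    by (simp add: gsum_def M.span_Un)
  moreover have "M.span (gws \<mu>) = gws \<mu>" using subspace_gws M.span_eq_iff by blast
  ultimately obtain x y where "m = x + y" "x \<in> gws \<mu>" "y \<in> gsum (A - {\<mu>})" using assms(1)
    by blast
  then show ?thesis by (intro bexI[of _ x]) simp_all
qed

text \<open>Moving \<open>?A\<close> past \<open>s a\<close> turns it into \<open>?B\<close>, up to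
  a scalar multiple of the vector. The induction is on the exponent l of \<open>?B\<close>: one
  further power of \<open>?A\<close> either trades m for \<open>?B \<star> m\<close>, with smaller
  l, or leaves a multiple of m, which \<open>?A ^ k\<close> kills.\<close>

lemma gws_fixed:
  assumes "a \<in> \<Delta>" "m \<in> gws \<mu>" "\<mu> \<circ> reflectionV a = \<mu>"
  shows "s a \<star> m \<in> gws \<mu>"
  unfolding gws_iff
proof
  fix v
  let ?A = "shift \<mu> v" and ?B = "shift \<mu> (reflectionV a v)" and ?r = "c a * corootV a v"
  have mu: "\<mu> (reflectionV a v) = \<mu> v" using fun_cong[OF assms(3), of v] by simp
  have AB: "?A * ?B = ?B * ?A" by (rule shift_commute)
  have As: "?A \<star> s a \<star> n = s a \<star> ?B \<star> n + K ?r \<star> n" for n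
    unfolding act_mult[symmetric] act_add_left[symmetric]
    by (simp only: left_diff_distrib right_diff_distrib iota_s[OF assms(1)] K_commute[of "s a"] mu)
      (simp add: act_simps)
  obtain k l where kl: "?A ^ k \<star> m = 0" "?B ^ l \<star> m = 0" using assms(2) unfolding gws_iff by blast
  then have "?A ^ (k + l) \<star> s a \<star> m = 0"
  proof (induction l arbitrary: m)
    case 0
    then show ?case by (simp add: act_one)
  next
    case (Suc l)
    have "?A ^ k \<star> ?B \<star> m = ?B \<star> ?A ^ k \<star> m"
      by (simp only: act_mult[symmetric] power_commuting_commutes[OF AB])
    moreover have "?B ^ l \<star> ?B \<star> m = 0" using Suc.prems(2) by (simp only: power_Suc2 act_mult)
    ultimately have 1: "?A ^ (k + l) \<star> s a \<star> ?B \<star> m = 0" using Suc by simp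
    have "?A ^ (k + Suc l) \<star> s a \<star> m = ?A ^ (k + l) \<star> ?A \<star> s a \<star> m"
      by (simp only: add_Suc_right power_Suc2 act_mult)
    also have "\<dots> = ?A ^ (k + l) \<star> s a \<star> ?B \<star> m + K ?r \<star> ?A ^ (k + l) \<star> m"
      by (simp only: As act_add_right K_act_commute)
    also have "\<dots> = 0" using 1 power_act_zero_mono[OF Suc.prems(1), of "k + l"] by simp
    finally show ?case .
  qed
  then show "\<exists>k. ?A ^ k \<star> s a \<star> m = 0" by blast
qed

lemma reflectionV_fixed: "\<mu> \<in> dualV \<Longrightarrow> \<mu> (embedV a) = 0 \<Longrightarrow> \<mu> \<circ> reflectionV a = \<mu>"
  by (rule ext) (simp add: dualV_reflectionV)

lemma comp_reflectionV_root: "\<mu> \<in> dualV \<Longrightarrow> (\<mu> \<circ> reflectionV a) (embedV a) = - \<mu> (embedV a)"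
  by (simp add: embedV_minus dualV_minus)

lemma comp_reflectionV_twice [simp]: "\<mu> \<circ> reflectionV a \<circ> reflectionV a = \<mu>"
  by (rule ext) (simp only: comp_apply reflectionV_reflectionV)

lemma reflectionV_fixed_iff:
  assumes "\<mu> \<in> dualV" shows "\<mu> \<circ> reflectionV a = \<mu> \<longleftrightarrow> \<mu> (embedV a) = 0"
proof
  assume "\<mu> \<circ> reflectionV a = \<mu>"
  then have "\<mu> (embedV a) = - \<mu> (embedV a)" using comp_reflectionV_root[OF assms, of a] by simp
  then show "\<mu> (embedV a) = 0" by simp
qed (rule reflectionV_fixed[OF assms])

text \<open>If \<open>\<mu>\<close> does not vanish at \<open>a\<close>, the root acts invertibly on
  \<open>gws \<mu>\<close>, and \<open>s a\<close> equals \<open>tau a + c a\<close> applied after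
  the inverse of the root. Both summands have known weights.\<close>

lemma gws_s:
  assumes "a \<in> \<Delta>" "\<mu> \<in> dualV" "m \<in> gws \<mu>"
  shows "s a \<star> m \<in> gsum {\<mu>, \<mu> \<circ> reflectionV a}"
proof (cases "\<mu> (embedV a) = 0")
  case True
  then show ?thesis
    using gws_fixed[OF assms(1,3) reflectionV_fixed] assms(2) gws_gsum[of \<mu>] by blast
next
  case False
  then obtain n where n: "n \<in> gws \<mu>" "rt a \<star> n = m"
    using gws_shift_surjective[OF assms(3), of "embedV a" 0] by auto
  have "s a \<star> m = tau a \<star> n + K (c a) \<star> n"
    by (simp add: n(2)[symmetric] tau_def act_diff_left act_mult)
  moreover have "tau a \<star> n \<in> gsum {\<mu>, \<mu> \<circ> reflectionV a}"
    using gws_tau[OF assms(1) n(1)] gws_gsum by blast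
  moreover have "K (c a) \<star> n \<in> gsum {\<mu>, \<mu> \<circ> reflectionV a}"
    using gws_K[OF n(1)] gws_gsum by blast
  ultimately show ?thesis using gsum_add by simp
qed

text \<open>Weights with zero weight space impose no condition. This matters at the end, where the
  reflection of an extremal weight does not occur in the module.\<close>

lemma gsum_s:
  assumes "a \<in> \<Delta>" "A \<subseteq> dualV" "m \<in> gsum A"
    and "\<And>\<mu>. \<mu> \<in> A \<Longrightarrow> gws \<mu> \<noteq> {0} \<Longrightarrow> \<mu> \<in> B \<and> (\<mu> \<circ> reflectionV a \<in> B \<or> gws (\<mu> \<circ> reflectionV a) = {0})"
  shows "s a \<star> m \<in> gsum B"
  using assms(3)
proof (induction rule: gsum_induct)
  case (gws \<mu> m)
  show ?case
  proof (cases "gws \<mu> = {0}")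
    case False
    have "s a \<star> m \<in> gsum {\<mu>, \<mu> \<circ> reflectionV a}" using gws_s assms gws by blast
    moreover have "gsum {\<mu>, \<mu> \<circ> reflectionV a} \<subseteq> gsum B"
      unfolding gsum_def
    proof (rule M.span_minimal)
      show "(\<Union> (gws ` {\<mu>, \<mu> \<circ> reflectionV a})) \<subseteq> M.span (\<Union> (gws ` B))"
        using assms(4)[OF gws(1) False] gws_gsum[of _ B] gsum_zero[of B] unfolding gsum_def by auto
    qed (rule M.subspace_span)
    ultimately show ?thesis by blast
  qed (use gws gsum_zero in simp)
qed (intro subspace_preimage subspace_gsum)

definition eigenvector :: "('v cplx \<Rightarrow> complex) \<Rightarrow> 'm \<Rightarrow> bool" where
  "eigenvector \<mu> m \<longleftrightarrow> m \<noteq> 0 \<and> (\<forall>v. \<iota> v \<star> m = K (\<mu> v) \<star> m)"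

lemma eigenvector_gws: "eigenvector \<mu> m \<Longrightarrow> m \<in> gws \<mu>"
  unfolding gws_iff eigenvector_def by (intro allI exI[of _ 1]) (simp add: act_diff_left del: split_paired_All)

lemma iota_sum: "\<iota> (\<Sum>i\<in>I. f i) = (\<Sum>i\<in>I. \<iota> (f i))"
  using iota_add[of 0 0] by (induction I rule: infinite_finite_induct) (simp_all add: iota_add)

lemma dualV_sum: "\<mu> \<in> dualV \<Longrightarrow> \<mu> (\<Sum>i\<in>I. f i) = (\<Sum>i\<in>I. \<mu> (f i))"
  using dualV_add[of \<mu> 0 0] by (induction I rule: infinite_finite_induct) (simp_all add: dualV_add)

text \<open>Commuting locally nilpotent operators have a common kernel vector: treat the members of
  a finite spanning set one at a time, replacing m by its last nonzero image under powers of the new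
  operator. Linearity of \<open>\<mu>\<close> extends the result to all v.\<close>

lemma eigenvector_ex:
  assumes "\<mu> \<in> dualV" "gws \<mu> \<noteq> {0}"
  obtains m where "eigenvector \<mu> m"
proof -
  obtain B :: "'v cplx set" where B: "finite B" "\<And>v. \<exists>k. v = (\<Sum>b\<in>B. scaleV (k b) b)"
    using complex_basis by blast
  have "\<exists>m\<in>gws \<mu>. m \<noteq> 0 \<and> (\<forall>b\<in>B. shift \<mu> b \<star> m = 0)"
    using B(1)
  proof (induction rule: finite_induct)
    case empty
    then show ?case using assms(2) gws_zero by blast
  next
    case (insert b F)
    then obtain m where m: "m \<in> gws \<mu>" "m \<noteq> 0" "\<forall>b\<in>F. shift \<mu> b \<star> m = 0" by blast
    have ex: "\<exists>k. shift \<mu> b ^ k \<star> m = 0" using m(1) unfolding gws_iff by blast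
    define k where "k = (LEAST k. shift \<mu> b ^ k \<star> m = 0)"
    have k: "shift \<mu> b ^ k \<star> m = 0" unfolding k_def by (rule LeastI_ex[OF ex])
    then have "k \<noteq> 0" using m(2) by (metis act_one power_0)
    then obtain j where j: "k = Suc j" by (cases k) auto
    have "shift \<mu> b ^ j \<star> m \<noteq> 0"
      using not_less_Least[of j "\<lambda>k. shift \<mu> b ^ k \<star> m = 0"] j k_def by auto
    moreover have "shift \<mu> b \<star> shift \<mu> b ^ j \<star> m = 0" using k j by (simp add: act_mult)
    moreover have "shift \<mu> d \<star> shift \<mu> b ^ j \<star> m = 0" if "d \<in> F" for d
    proof -
      have "shift \<mu> d * shift \<mu> b ^ j = shift \<mu> b ^ j * shift \<mu> d"
        using power_commuting_commutes[OF shift_commute] by metis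
      then show ?thesis using m(3) that by (metis act_mult act_zero_right)
    qed
    moreover have "shift \<mu> b ^ j \<star> m \<in> gws \<mu>"
      using m(1)
    proof (induction j)
      case (Suc j)
      then show ?case using gws_diff[OF gws_iota gws_K] by (simp add: act_mult act_diff_left)
    qed (simp add: act_one)
    ultimately show ?case by blast
  qed
  then obtain m where m: "m \<noteq> 0" "\<And>b. b \<in> B \<Longrightarrow> \<iota> b \<star> m = K (\<mu> b) \<star> m"
    by (auto simp: act_diff_left)
  have "\<iota> v \<star> m = K (\<mu> v) \<star> m" for v
  proof -
    obtain k where "v = (\<Sum>b\<in>B. scaleV (k b) b)" using B(2) by blast
    then have "\<iota> v \<star> m = (\<Sum>b\<in>B. K (k b) \<star> \<iota> b \<star> m)"
      by (simp only: iota_sum iota_scale act_sum_left act_mult)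
    also have "\<dots> = (\<Sum>b\<in>B. K (k b * \<mu> b) \<star> m)"
      by (intro sum.cong refl) (simp only: m(2) K_mult act_mult)
    also have "\<dots> = K (\<Sum>b\<in>B. k b * \<mu> b) \<star> m" by (rule M.scale_sum_left[symmetric])
    also have "(\<Sum>b\<in>B. k b * \<mu> b) = \<mu> v"
      by (simp only: \<open>v = _\<close> dualV_sum[OF assms(1)] dualV_scale[OF assms(1)])
    finally show ?thesis .
  qed
  then show ?thesis using that m(1) unfolding eigenvector_def by blast
qed

lemma s_act_square: "a \<in> \<Delta> \<Longrightarrow> s a \<star> s a \<star> m = m"
  by (simp flip: act_mult add: s_square act_one)

lemma c_positive: "a \<in> R \<Longrightarrow> 0 < Re (c a)" "a \<in> R \<Longrightarrow> c a = of_real (Re (c a))"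
  using positive by (auto simp: positive_parameter_def)

end

section \<open>The sign vector of an anti-dominant weight\<close>

text \<open>Nonpositivity in a total order of the real vector space of complex numbers. Unlike
  \<open>Re z \<le> 0\<close>, it holds for both z and -z only if z vanishes, which
  \<open>stab_inversion\<close> relies on.\<close>

definition lex_le0 :: "complex \<Rightarrow> bool" where
  "lex_le0 z \<longleftrightarrow> Re z < 0 \<or> Re z = 0 \<and> Im z \<le> 0"

lemma lex_le0_uminus: "lex_le0 z \<Longrightarrow> lex_le0 (- z) \<Longrightarrow> z = 0"
  by (auto simp: lex_le0_def complex_eq_iff)

lemma lex_le0_total: "lex_le0 z \<or> lex_le0 (- z)"
  by (auto simp: lex_le0_def)

lemma (in based_root_system) lex_le0_positive_root:
  assumes "\<mu> \<in> dualV" "\<And>a. a \<in> \<Delta> \<Longrightarrow> lex_le0 (\<mu> (embedV a))" "b \<in> P"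
  shows "lex_le0 (\<mu> (embedV b))"
proof -
  let ?f = "\<lambda>v. Re (\<mu> (embedV v))" and ?g = "\<lambda>v. Im (\<mu> (embedV v))"
  obtain k where k: "\<forall>d\<in>\<Delta>. 0 \<le> k d" "b = (\<Sum>d\<in>\<Delta>. k d *\<^sub>R d)"
    using positive_rootE[OF assms(3)] by blast
  note lin = linear_embedV_functional[OF assms(1)]
  have f: "?f b = (\<Sum>d\<in>\<Delta>. k d * ?f d)"
    using linear_sum[OF lin(1), of "\<lambda>d. k d *\<^sub>R d" \<Delta>]
      by (simp only: k(2) linear_scale[OF lin(1)] real_scaleR_def)
  have g: "?g b = (\<Sum>d\<in>\<Delta>. k d * ?g d)"
    using linear_sum[OF lin(2), of "\<lambda>d. k d *\<^sub>R d" \<Delta>]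
      by (simp only: k(2) linear_scale[OF lin(2)] real_scaleR_def)
  have neg: "k d * ?f d \<le> 0" if "d \<in> \<Delta>" for d
    using k(1) assms(2)[OF that] that by (auto simp: lex_le0_def intro: mult_nonneg_nonpos)
  then have le: "?f b \<le> 0" unfolding f by (rule sum_nonpos)
  have "?g b \<le> 0" if "?f b = 0"
  proof -
    have "(\<Sum>d\<in>\<Delta>. - (k d * ?f d)) = 0" using f that by (simp add: sum_negf)
    then have "\<forall>d\<in>\<Delta>. - (k d * ?f d) = 0"
      using neg by (subst (asm) sum_nonneg_eq_0_iff[OF finite_simple_roots]) auto
    then have "k d * ?g d \<le> 0" if "d \<in> \<Delta>" for d
      using k(1) assms(2)[OF that] that by (auto simp: lex_le0_def intro: mult_nonneg_nonpos)
    then show ?thesis unfolding g by (rule sum_nonpos)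
  qed
  then show ?thesis using le by (auto simp: lex_le0_def)
qed

context graded_hecke_algebra
begin

lemma K_of_int: "K (of_int n) = of_int n"
  by (induction n rule: int_induct[of _ 0]) (simp_all add: K_add K_diff)

lemma tau_sym_map_prod:
  assumes "finite I" "\<And>i. i \<in> I \<Longrightarrow> tau a * sym_map (f i) = sym_map (g i) * tau a"
  shows "tau a * sym_map (\<Prod>i\<in>I. f i) = sym_map (\<Prod>i\<in>I. g i) * tau a"
  using assms
proof (induction rule: finite_induct)
  case (insert i I)
  have f: "sym_map (\<Prod>i\<in>insert i I. f i) = sym_map (f i) * sym_map (\<Prod>i\<in>I. f i)"
    and g: "sym_map (\<Prod>i\<in>insert i I. g i) = sym_map (g i) * sym_map (\<Prod>i\<in>I. g i)"
    using insert.hyps by (simp_all add: sym_mult)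
  have i: "tau a * sym_map (f i) = sym_map (g i) * tau a"
    and I: "tau a * sym_map (\<Prod>i\<in>I. f i) = sym_map (\<Prod>i\<in>I. g i) * tau a"
    using insert by simp_all
  have "tau a * sym_map (\<Prod>i\<in>insert i I. f i) = sym_map (g i) * (tau a * sym_map (\<Prod>i\<in>I. f i))"
    unfolding f by (simp only: mult.assoc[symmetric] i)
  then show ?case unfolding g I by (simp only: mult.assoc)
qed simp

text \<open>The products of the factors at \<open>b\<close> and \<open>\<sigma> b\<close> are symmetric, hence commute with \<open>s a\<close>.\<close>

lemma s_sym_map_prod:
  assumes "finite B" "\<sigma> ` B \<subseteq> B" "\<And>b. b \<in> B \<Longrightarrow> \<sigma> (\<sigma> b) = b"
    and "\<And>b. b \<in> B \<Longrightarrow> \<exists>z. s a * sym_map (f b) = sym_map (f (\<sigma> b)) * s a + K z \<and>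
      s a * sym_map (f (\<sigma> b)) = sym_map (f b) * s a - K z \<and> (\<sigma> b = b \<longrightarrow> z = 0)"
  shows "s a * sym_map (\<Prod>b\<in>B. f b) = sym_map (\<Prod>b\<in>B. f b) * s a"
  using assms
proof (induction rule: finite_psubset_induct)
  case (psubset B)
  show ?case
  proof (cases "B = {}")
    case False
    then obtain b where b: "b \<in> B" by blast
    then obtain z where z: "s a * sym_map (f b) = sym_map (f (\<sigma> b)) * s a + K z"
        "s a * sym_map (f (\<sigma> b)) = sym_map (f b) * s a - K z" "\<sigma> b = b \<Longrightarrow> z = 0"
      using psubset.prems(3) by blast
    define C where "C = B - {b, \<sigma> b}"
    have sb: "\<sigma> b \<in> B" using psubset.prems(1) b by blast
    have "\<sigma> x \<in> C" if "x \<in> C" for x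
    proof -
      have x: "x \<in> B" "x \<noteq> b" "x \<noteq> \<sigma> b" using that by (auto simp: C_def)
      have "\<sigma> x \<noteq> b" using psubset.prems(2)[OF x(1)] x by metis
      moreover have "\<sigma> x \<noteq> \<sigma> b" using psubset.prems(2) x b by metis
      ultimately show ?thesis using psubset.prems(1) x(1) by (auto simp: C_def)
    qed
    then have C: "s a * sym_map (\<Prod>b\<in>C. f b) = sym_map (\<Prod>b\<in>C. f b) * s a"
      using b by (intro psubset.IH psubset.prems) (auto simp: C_def)
    define g where "g = (\<Prod>x\<in>{b, \<sigma> b}. f x)"
    have g: "s a * sym_map g = sym_map g * s a"
    proof (cases "\<sigma> b = b")
      case True
      then show ?thesis using z by (simp add: g_def)
    next
      case False
      have "s a * sym_map g = (s a * sym_map (f b)) * sym_map (f (\<sigma> b))"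
        using False by (simp add: g_def sym_mult mult.assoc)
      also have "\<dots> = sym_map (f (\<sigma> b)) * (s a * sym_map (f (\<sigma> b))) + K z * sym_map (f (\<sigma> b))"
        by (simp add: z(1) distrib_right mult.assoc)
      also have "\<dots> = sym_map (f (\<sigma> b)) * sym_map (f b) * s a"
        by (simp add: z(2) right_diff_distrib mult.assoc K_commute[of "sym_map (f (\<sigma> b))"])
      finally show ?thesis using False by (simp add: g_def sym_mult[symmetric] mult.commute)
    qed
    have "(\<Prod>b\<in>B. f b) = (\<Prod>b\<in>C. f b) * g"
      unfolding g_def C_def using b sb psubset.hyps(1) by (intro prod.subset_diff) auto
    then have B: "sym_map (\<Prod>b\<in>B. f b) = sym_map (\<Prod>b\<in>C. f b) * sym_map g"
      by (simp only: sym_mult)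
    have "s a * sym_map (\<Prod>b\<in>B. f b) = sym_map (\<Prod>b\<in>C. f b) * (s a * sym_map g)"
      unfolding B by (simp only: mult.assoc[symmetric] C)
    then show ?thesis unfolding B g by (simp only: mult.assoc)
  qed simp
qed

end

text \<open>A genuine eigenvector is taken, not just a generalized one, so that V acts on the
  vectors \<open>ti w \<star> m\<close> with correction terms of the same form.\<close>

locale lex_antidominant_module = hecke_module R \<Delta> scaleH c t \<iota> act
  for R \<Delta> :: "'v::real_inner set"
    and scaleH :: "complex \<Rightarrow> 'h::ring_1 \<Rightarrow> 'h"
    and c :: "'v \<Rightarrow> complex"
    and t :: "('v \<Rightarrow> 'v) \<Rightarrow> 'h"
    and \<iota> :: "'v cplx \<Rightarrow> 'h"
    and act :: "'h \<Rightarrow> 'm::ab_group_add \<Rightarrow> 'm" +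
  fixes \<xi> :: "'v cplx \<Rightarrow> complex" and m :: 'm
  assumes xi_dual: "\<xi> \<in> dualV"
    and xi_lex: "b \<in> positive_roots R \<Delta> \<Longrightarrow> lex_le0 (\<xi> (embedV b))"
    and eigenvector: "eigenvector \<xi> m"
begin

section \<open>The stabilizer of the weight and its sign vector\<close>

definition stab :: "('v \<Rightarrow> 'v) set" where
  "stab = {w \<in> W. \<xi> \<circ> cx w = \<xi>}"

lemma stab_W: "w \<in> stab \<Longrightarrow> w \<in> W"
  by (simp add: stab_def)

lemma stab_xi: "w \<in> stab \<Longrightarrow> \<xi> \<circ> cx w = \<xi>"
  by (simp add: stab_def)

lemma finite_stab: "finite stab"
  using finite_W by (simp add: stab_def)

lemma id_stab: "id \<in> stab"
  by (simp add: stab_def reflection_group.one)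

lemma stab_comp: "u \<in> stab \<Longrightarrow> w \<in> stab \<Longrightarrow> u \<circ> w \<in> stab"
  unfolding stab_def by (auto simp: cx_comp reflection_group_comp simp flip: comp_assoc)

lemma xi_cx_embedV: "w \<in> W \<Longrightarrow> (\<xi> \<circ> cx w) (embedV b) = \<xi> (embedV (w b))"
  by (simp only: comp_apply cx_embedV[OF reflection_group_linear])

text \<open>Since \<open>w\<close> fixes \<open>\<xi>\<close>, the values at \<open>b\<close> and at
  the negative root \<open>w b\<close> agree, so the value at \<open>b\<close> and its negative are
  both lexicographically nonpositive and it is zero. Thus the correction terms of
  \<open>iota_ti\<close> stay within the stabilizer.\<close>

lemma stab_inversion:
  assumes "w \<in> stab" "b \<in> inversions w"
  shows "w \<circ> reflection b \<in> stab"
proof -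
  have b: "b \<in> P" "w b \<notin> P" using inversions_D assms(2) by auto
  then have "- w b \<in> P" using uminus_positive W_root[OF stab_W[OF assms(1)] positive_root] by blast
  have "\<xi> (embedV b) = \<xi> (embedV (w b))"
    using xi_cx_embedV[OF stab_W[OF assms(1)], of b] by (simp only: stab_xi[OF assms(1)])
  then have "lex_le0 (- \<xi> (embedV b))"
    using xi_lex[OF \<open>- w b \<in> P\<close>] by (simp add: embedV_minus dualV_minus[OF xi_dual])
  then have "\<xi> (embedV b) = 0" using xi_lex[OF b(1)] lex_le0_uminus by blast
  then have "\<xi> \<circ> cx (reflection b) = \<xi>"
    using reflectionV_fixed[OF xi_dual] by (simp add: reflectionV_cx)
  then have "reflection b \<in> stab"
    using reflection_W[OF positive_root[OF b(1)]] by (simp add: stab_def)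
  then show ?thesis using stab_comp assms(1) by blast
qed

lemma shift_stab:
  assumes "w \<in> stab"
  shows "shift \<xi> v \<star> ti w \<star> m
    = (\<Sum>b\<in>inversions w. K (c b * corootV b v) \<star> ti (w \<circ> reflection b) \<star> m)"
proof -
  have "\<xi> (cx w v) = \<xi> v" using assms by (auto simp: stab_def dest: fun_cong[of _ _ v])
  then have ev: "\<iota> (cx w v) \<star> m = K (\<xi> v) \<star> m" using eigenvector
    unfolding eigenvector_def by metis
  have "\<iota> v \<star> ti w \<star> m = (\<iota> v * ti w) \<star> m" by (simp only: act_mult)
  also have "\<dots> = K (\<xi> v) \<star> ti w \<star> m
      + (\<Sum>b\<in>inversions w. K (c b * corootV b v) \<star> ti (w \<circ> reflection b) \<star> m)"
    by (simp only: iota_ti[OF stab_W[OF assms]] act_add_left act_mult act_sum_left ev K_act_commute[of "ti w"])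
  finally show ?thesis by (simp add: act_diff_left)
qed

text \<open>Each application of the shift replaces \<open>w\<close> by strictly shorter
  elements.\<close>

lemma shift_stab_nilpotent: "w \<in> stab \<Longrightarrow> len w < k \<Longrightarrow> shift \<xi> v ^ k \<star> ti w \<star> m = 0"
proof (induction k arbitrary: w)
  case (Suc k)
  have "shift \<xi> v ^ Suc k \<star> ti w \<star> m = shift \<xi> v ^ k \<star> shift \<xi> v \<star> ti w \<star> m"
    by (simp only: power_Suc2 act_mult)
  also have "\<dots> = (\<Sum>b\<in>inversions w. K (c b * corootV b v) \<star> shift \<xi> v ^ k \<star> ti (w \<circ> reflection b) \<star> m)"
    by (simp only: shift_stab[OF Suc.prems(1)] act_sum_right K_act_commute[of "shift \<xi> v ^ k"])
  also have "\<dots> = 0"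
  proof (rule sum.neutral, rule ballI)
    fix b assume b: "b \<in> inversions w"
    have "len (w \<circ> reflection b) < len w"
      using len_comp_reflection_less[OF stab_W[OF Suc.prems(1)] inversions_D[OF b]] .
    then have "shift \<xi> v ^ k \<star> ti (w \<circ> reflection b) \<star> m = 0"
      using Suc.prems(2) by (intro Suc.IH[OF stab_inversion[OF Suc.prems(1) b]]) linarith
    then show "K (c b * corootV b v) \<star> shift \<xi> v ^ k \<star> ti (w \<circ> reflection b) \<star> m = 0" by simp
  qed
  finally show ?case .
qed simp

lemma ti_stab_gws: "w \<in> stab \<Longrightarrow> ti w \<star> m \<in> gws \<xi>"
  unfolding gws_iff using shift_stab_nilpotent by blast

text \<open>After as many shifts as the length of \<open>w\<close>, only chains that lower the
  length by exactly one at each step survive. Each contributes a product of numbers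
  \<open>c b * coroot b rho > 0\<close>, and a simple descent shows that there is such a
  chain.\<close>

lemma shift_rho_stab:
  "w \<in> stab \<Longrightarrow> len w = k \<Longrightarrow>
    \<exists>\<kappa>>0. shift \<xi> (embedV rho) ^ k \<star> ti w \<star> m = K (of_real \<kappa>) \<star> m"
proof (induction k arbitrary: w)
  case 0
  then have "w = id" using coxeter_length_eq_0 stab_W simple_reflections_generate by blast
  then have "ti w \<star> m = m" by (simp only: ti_id act_one)
  then show ?case by (intro exI[of _ 1]) (simp add: act_one)
next
  case (Suc k)
  let ?D = "shift \<xi> (embedV rho)"
  have w: "w \<in> W" using Suc.prems stab_W by blast
  have "w \<noteq> id" using Suc.prems(2) by (metis coxeter_length_id nat.distinct(1))
  then obtain a where a: "a \<in> \<Delta>" "w a \<notin> P" using descent_ex[OF w] by blast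
  have ainv: "a \<in> inversions w" using a simple_root_positive by (simp add: inversions_def)
  \<comment> \<open>An inversion that lowers the length by more than one contributes
    \<open>q = 0\<close>, because the remaining \<open>k\<close> shifts already annihilate its
    term.\<close>
  have "\<exists>q. 0 \<le> q \<and> (len (w \<circ> reflection b) = k \<longrightarrow> 0 < q) \<and>
      K (c b * corootV b (embedV rho)) \<star> ?D ^ k \<star> ti (w \<circ> reflection b) \<star> m = K (of_real q) \<star> m"
    if b: "b \<in> inversions w" for b
  proof (cases "len (w \<circ> reflection b) = k")
    case True
    obtain \<kappa> where \<kappa>: "\<kappa> > 0" "?D ^ k \<star> ti (w \<circ> reflection b) \<star> m = K (of_real \<kappa>) \<star> m"
      using Suc.IH[OF stab_inversion[OF Suc.prems(1) b] True] by blast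
    have bP: "b \<in> P" using inversions_D b by blast
    let ?q = "Re (c b) * coroot b rho * \<kappa>"
    have "0 < ?q" using c_positive(1)[OF positive_root[OF bP]] coroot_rho_pos[OF bP] \<kappa> by simp
    moreover have "c b * corootV b (embedV rho) * of_real \<kappa> = of_real ?q"
      by (subst c_positive(2)[OF positive_root[OF bP]]) simp
    moreover from this have "K (c b * corootV b (embedV rho)) \<star> K (of_real \<kappa>) \<star> m = K (of_real ?q) \<star> m"
      by (simp only: act_mult[symmetric] K_mult[symmetric])
    ultimately show ?thesis unfolding \<kappa>(2) by (intro exI[of _ ?q]) simp
  next
    case False
    have "len (w \<circ> reflection b) < len w" by (rule len_comp_reflection_less[OF w inversions_D[OF b]])
    then have "?D ^ k \<star> ti (w \<circ> reflection b) \<star> m = 0"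
      using False Suc.prems(2) by (intro shift_stab_nilpotent[OF stab_inversion[OF Suc.prems(1) b]]) linarith
    then show ?thesis using False by (intro exI[of _ 0]) simp
  qed
  then obtain q where q: "\<And>b. b \<in> inversions w \<Longrightarrow> 0 \<le> q b"
      "\<And>b. b \<in> inversions w \<Longrightarrow> len (w \<circ> reflection b) = k \<Longrightarrow> 0 < q b"
      "\<And>b. b \<in> inversions w \<Longrightarrow> K (c b * corootV b (embedV rho)) \<star> ?D ^ k \<star> ti (w \<circ> reflection b) \<star> m
        = K (of_real (q b)) \<star> m"
    by metis
  have "len (w \<circ> reflection a) = k" using len_comp_simple(1)[OF w a(1)] a(2) Suc.prems(2) by simp
  then have "0 < (\<Sum>b\<in>inversions w. q b)"
    using sum_pos2[OF finite_inversions ainv] q ainv by blast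
  moreover have "?D ^ Suc k \<star> ti w \<star> m = K (of_real (\<Sum>b\<in>inversions w. q b)) \<star> m"
  proof -
    have "?D ^ Suc k \<star> ti w \<star> m = ?D ^ k \<star> ?D \<star> ti w \<star> m"
      by (simp only: power_Suc2 act_mult)
    also have "\<dots> = (\<Sum>b\<in>inversions w. K (c b * corootV b (embedV rho)) \<star> ?D ^ k \<star> ti (w \<circ> reflection b) \<star> m)"
      by (simp only: shift_stab[OF Suc.prems(1)] act_sum_right K_act_commute[of "?D ^ k"])
    also have "\<dots> = (\<Sum>b\<in>inversions w. K (of_real (q b)) \<star> m)" using q(3)
      by (rule sum.cong[OF refl])
    finally show ?thesis by (simp only: M.scale_sum_left of_real_sum)
  qed
  ultimately show ?case by blast
qed

definition stab_vector :: 'm where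
  "stab_vector = (\<Sum>z\<in>stab. K (of_int (sg z)) \<star> ti z \<star> m)"

lemma stab_vector_gws: "stab_vector \<in> gws \<xi>"
  unfolding stab_vector_def by (intro M.subspace_sum[OF subspace_gws] gws_K ti_stab_gws)

lemma stab_inv: "w \<in> stab \<Longrightarrow> inv w \<in> stab"
proof -
  assume w: "w \<in> stab"
  have "\<xi> \<circ> cx (inv w) = (\<xi> \<circ> cx w) \<circ> cx (inv w)" using w by (simp add: stab_def)
  also have "\<dots> = \<xi> \<circ> cx (w \<circ> inv w)" by (simp only: comp_assoc cx_comp)
  also have "w \<circ> inv w = id" using stab_W[OF w] by (simp add: fun_eq_iff)
  finally have "\<xi> \<circ> cx (inv w) = \<xi>" by (simp only: cx_id comp_id)
  then show ?thesis using reflection_group_inv[OF stab_W[OF w]] unfolding stab_def by blast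
qed

lemma ti_stab_vector:
  assumes "w \<in> stab" shows "ti w \<star> stab_vector = K (of_int (sg w)) \<star> stab_vector"
proof -
  have inv1: "inv w \<circ> w = id" "w \<circ> inv w = id" using stab_W[OF assms] by (simp_all add: fun_eq_iff)
  have bij: "bij_betw (\<lambda>z. z \<circ> w) stab stab"
    by (rule bij_betwI[where g = "\<lambda>z. z \<circ> inv w"])
      (auto simp: comp_assoc inv1 intro: stab_comp stab_inv assms)
  have "K (of_int (sg w)) \<star> ti w \<star> stab_vector = (\<Sum>z\<in>stab. K (of_int (sg (z \<circ> w))) \<star> ti (z \<circ> w) \<star> m)"
    unfolding stab_vector_def act_sum_right
  proof (rule sum.cong[OF refl])
    fix z assume z: "z \<in> stab"
    have "ti w \<star> K (of_int (sg z)) \<star> ti z \<star> m = K (of_int (sg z)) \<star> ti (z \<circ> w) \<star> m"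
      by (simp only: ti_comp[OF stab_W[OF z] stab_W[OF assms]] act_mult K_act_commute[of "ti w"])
    moreover have "(of_int (sg (z \<circ> w)) :: complex) = of_int (sg w) * of_int (sg z)"
      by (simp add: sg_comp[OF stab_W[OF z] stab_W[OF assms]])
    ultimately show "K (of_int (sg w)) \<star> ti w \<star> K (of_int (sg z)) \<star> ti z \<star> m
        = K (of_int (sg (z \<circ> w))) \<star> ti (z \<circ> w) \<star> m"
      by (simp only: K_mult act_mult)
  qed
  also have "\<dots> = stab_vector" unfolding stab_vector_def by (rule sum.reindex_bij_betw[OF bij])
  finally have "K (of_int (sg w)) \<star> stab_vector = K (of_int (sg w) * of_int (sg w)) \<star> ti w \<star> stab_vector"
    by (simp only: K_mult act_mult)
  also have "(of_int (sg w) * of_int (sg w) :: complex) = 1"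
    by (metis of_int_1 of_int_mult sg_square)
  finally show ?thesis by (simp add: act_one)
qed

text \<open>Applying a high power of \<open>\<rho> - \<xi>(\<rho>)\<close> to \<open>stab_vector\<close> only leaves the contributions of the longest
  elements of the stabilizer, which are multiples of \<open>m\<close> by numbers of the same sign.\<close>

lemma stab_vector_nonzero: "stab_vector \<noteq> 0"
proof
  assume "stab_vector = 0"
  let ?D = "shift \<xi> (embedV rho)"
  define N where "N = Max (len ` stab)"
  have le: "len z \<le> N" if "z \<in> stab" for z
    unfolding N_def using finite_stab that by simp
  have "\<exists>q. 0 \<le> q \<and> (len z = N \<longrightarrow> 0 < q) \<and>
      ?D ^ N \<star> K (of_int (sg z)) \<star> ti z \<star> m = K (of_real ((- 1) ^ N * q)) \<star> m" if z: "z \<in> stab" for z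
  proof (cases "len z = N")
    case True
    then obtain \<kappa> where "\<kappa> > 0" "?D ^ N \<star> ti z \<star> m = K (of_real \<kappa>) \<star> m"
      using shift_rho_stab[OF z] by blast
    then have "?D ^ N \<star> K (of_int (sg z)) \<star> ti z \<star> m = K (of_int (sg z)) \<star> K (of_real \<kappa>) \<star> m"
      by (simp only: K_act_commute[of "?D ^ N"])
    also have "\<dots> = K (of_real ((- 1) ^ N * \<kappa>)) \<star> m"
      by (simp only: act_mult[symmetric] K_mult[symmetric]) (simp add: sgn_char_def True)
    finally show ?thesis using \<open>\<kappa> > 0\<close> by (intro exI[of _ \<kappa>]) simp
  next
    case False
    then have "?D ^ N \<star> ti z \<star> m = 0" using le[OF z] by (intro shift_stab_nilpotent z) simp
    then show ?thesis using False by (intro exI[of _ 0]) (simp add: K_act_commute[of "?D ^ N"])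
  qed
  then obtain q where q: "\<And>z. z \<in> stab \<Longrightarrow> 0 \<le> q z" "\<And>z. z \<in> stab \<Longrightarrow> len z = N \<Longrightarrow> 0 < q z"
      "\<And>z. z \<in> stab \<Longrightarrow> ?D ^ N \<star> K (of_int (sg z)) \<star> ti z \<star> m = K (of_real ((- 1) ^ N * q z)) \<star> m"
    by metis
  have "N \<in> len ` stab" unfolding N_def using finite_stab id_stab by (intro Max_in) auto
  then obtain z where "z \<in> stab" "len z = N" by blast
  then have pos: "0 < (\<Sum>z\<in>stab. q z)" using sum_pos2[OF finite_stab] q by blast
  have "?D ^ N \<star> stab_vector = (\<Sum>z\<in>stab. K (of_real ((- 1) ^ N * q z)) \<star> m)"
    unfolding stab_vector_def act_sum_right using q(3) by (rule sum.cong[OF refl])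
  also have "\<dots> = K (of_real ((- 1) ^ N * (\<Sum>z\<in>stab. q z))) \<star> m"
    by (simp only: M.scale_sum_left of_real_sum sum_distrib_left)
  finally show False
    using \<open>stab_vector = 0\<close> pos eigenvector
      by (simp add: K_act_eq_0 eigenvector_def del: of_real_sum of_real_mult)
qed

end

section \<open>Factors that remove the denominators\<close>

context hecke_module
begin

text \<open>For \<open>\<mu>\<close> negative at \<open>a\<close>, the reflected weight is positive
  there and its factor \<open>var (embedV a)\<close> supplies the root in a T(s_a \<mu>) = tau_a
  T(\<mu>), while \<open>tau a\<close> turns the factor \<open>c a - a\<close> of
  \<open>\<mu>\<close> into \<open>c a + a\<close>. The factors at other roots are only
  permuted.\<close>

definition factor :: "('v cplx \<Rightarrow> complex) \<Rightarrow> 'v \<Rightarrow> 'v free_poly" where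
  "factor \<mu> b = (if \<mu> (embedV b) = 0 then 1
    else if lex_le0 (\<mu> (embedV b)) then const (c b) - var (embedV b) else var (embedV b))"

definition factor_prod :: "('v cplx \<Rightarrow> complex) \<Rightarrow> 'h" where
  "factor_prod \<mu> = sym_map (\<Prod>b\<in>P. factor \<mu> b)"

lemma c_reflection: "a \<in> \<Delta> \<Longrightarrow> b \<in> R \<Longrightarrow> c (reflection a b) = c b"
  using parameter_invariant reflection_W simple_root by blast

lemma tau_factor:
  assumes "a \<in> \<Delta>" "b \<in> P"
  shows "tau a * sym_map (factor \<mu> b) = sym_map (factor (\<mu> \<circ> reflectionV a) (reflection a b)) * tau a"
proof -
  have "tau a * rt b = rt (reflection a b) * tau a"
    using tau_iota[OF assms(1), of "embedV b"] by simp
  then show ?thesis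
    by (simp add: factor_def sym_diff c_reflection[OF assms(1) positive_root[OF assms(2)]]
        left_diff_distrib right_diff_distrib K_commute[of "tau a"])
qed

lemma prod_factor_reflection:
  assumes "a \<in> \<Delta>"
  shows "tau a * sym_map (\<Prod>b\<in>P - {a}. factor \<mu> b)
    = sym_map (\<Prod>b\<in>P - {a}. factor (\<mu> \<circ> reflectionV a) b) * tau a"
proof -
  have "tau a * sym_map (\<Prod>b\<in>P - {a}. factor \<mu> b)
      = sym_map (\<Prod>b\<in>P - {a}. factor (\<mu> \<circ> reflectionV a) (reflection a b)) * tau a"
    using tau_factor[OF assms] finite_positive_roots by (intro tau_sym_map_prod) auto
  also have "(\<Prod>b\<in>P - {a}. factor (\<mu> \<circ> reflectionV a) (reflection a b))
      = (\<Prod>b\<in>P - {a}. factor (\<mu> \<circ> reflectionV a) b)"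
    by (rule prod.reindex_bij_betw[OF reflection_permutes[OF assms]])
  finally show ?thesis .
qed

lemma factor_prod_remove: "a \<in> \<Delta> \<Longrightarrow> factor_prod \<mu> = sym_map (factor \<mu> a) * sym_map (\<Prod>b\<in>P - {a}. factor \<mu> b)"
  unfolding factor_prod_def sym_mult[symmetric]
  by (simp only: prod.remove[OF finite_positive_roots simple_root_positive])

text \<open>Only the factor at \<open>a\<close> changes its type. The additional \<open>rt a\<close>
  on the left completes the product \<open>?Y\<close> over the other positive roots to
  \<open>factor_prod\<close> of the reflected weight.\<close>

lemma tau_factor_prod:
  assumes "a \<in> \<Delta>" "\<mu> \<in> dualV" "lex_le0 (\<mu> (embedV a))" "\<mu> (embedV a) \<noteq> 0"
  shows "rt a * (tau a * factor_prod \<mu>) = (K (c a) + rt a) * factor_prod (\<mu> \<circ> reflectionV a) * tau a"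
proof -
  let ?\<nu> = "\<mu> \<circ> reflectionV a"
  let ?X = "sym_map (\<Prod>b\<in>P - {a}. factor \<mu> b)" and ?Y = "sym_map (\<Prod>b\<in>P - {a}. factor ?\<nu> b)"
  have nu: "?\<nu> (embedV a) = - \<mu> (embedV a)" by (rule comp_reflectionV_root[OF assms(2)])
  have "\<not> lex_le0 (- \<mu> (embedV a))" using assms(3,4) lex_le0_uminus by blast
  then have \<nu>: "sym_map (factor ?\<nu> a) = rt a"
    using assms(4) by (simp only: factor_def nu) simp
  have \<mu>: "sym_map (factor \<mu> a) = K (c a) - rt a"
    using assms(3,4) by (simp add: factor_def sym_diff)
  have t1: "tau a * (K (c a) - rt a) = (K (c a) + rt a) * tau a"
    using tau_iota[OF assms(1), of "embedV a"] root_nonzero[OF simple_root[OF assms(1)]]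
    by (simp add: left_diff_distrib right_diff_distrib distrib_right K_commute[of "tau a"] embedV_minus iota_minus)
  have comm: "rt a * (K (c a) + rt a) = (K (c a) + rt a) * rt a"
    by (simp add: distrib_left distrib_right K_commute[of "rt a"])
  have "rt a * (tau a * factor_prod \<mu>) = rt a * (tau a * (K (c a) - rt a)) * ?X"
    by (simp only: factor_prod_remove[OF assms(1), of \<mu>] \<mu> mult.assoc)
  also have "\<dots> = rt a * (K (c a) + rt a) * (tau a * ?X)"
    by (simp only: t1 mult.assoc)
  also have "\<dots> = (K (c a) + rt a) * (rt a * ?Y) * tau a"
    by (simp only: comm prod_factor_reflection[OF assms(1)] mult.assoc)
  also have "rt a * ?Y = factor_prod ?\<nu>" by (simp only: factor_prod_remove[OF assms(1), of ?\<nu>] \<nu>)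
  finally show ?thesis .
qed

text \<open>The number \<open>z\<close> is zero or, up to sign, the scalar of the cross relation. It
  is opposite for \<open>b\<close> and its reflection because the coroot of \<open>a\<close> changes
  sign, so the two errors cancel in the product of the pair.\<close>

lemma s_factor:
  assumes "a \<in> \<Delta>" "b \<in> P" "\<mu> \<circ> reflectionV a = \<mu>"
  shows "\<exists>z. s a * sym_map (factor \<mu> b) = sym_map (factor \<mu> (reflection a b)) * s a + K z \<and>
      s a * sym_map (factor \<mu> (reflection a b)) = sym_map (factor \<mu> b) * s a - K z \<and>
      (reflection a b = b \<longrightarrow> z = 0)"
proof -
  have nz: "a \<noteq> 0" using root_nonzero simple_root assms(1) by blast
  let ?r = "c a * of_real (coroot a b)"
  have mu: "\<mu> (embedV (reflection a b)) = \<mu> (embedV b)"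
    using fun_cong[OF assms(3), of "embedV b"] by simp
  have c: "c (reflection a b) = c b" using c_reflection[OF assms(1) positive_root[OF assms(2)]] .
  have s1: "s a * rt b = rt (reflection a b) * s a + K ?r"
    using s_iota[OF assms(1), of "embedV b"] by simp
  have "coroot a (reflection a b) = - coroot a b"
    using nz by (simp add: reflection_def coroot_diff coroot_scaleR)
  then have s2: "s a * rt (reflection a b) = rt b * s a - K ?r"
    using s_iota[OF assms(1), of "embedV (reflection a b)"] by (simp add: K_minus)
  have s3: "?r = 0" if "reflection a b = b"
    using that nz by (simp add: reflection_def)
  consider "factor \<mu> b = 1" "factor \<mu> (reflection a b) = 1"
    | "factor \<mu> b = var (embedV b)" "factor \<mu> (reflection a b) = var (embedV (reflection a b))"
    | "factor \<mu> b = const (c b) - var (embedV b)"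
      "factor \<mu> (reflection a b) = const (c b) - var (embedV (reflection a b))"
    unfolding factor_def mu c by meson
  then show ?thesis
  proof cases
    case 1
    then show ?thesis by (intro exI[of _ 0]) simp
  next
    case 2
    then show ?thesis using s1 s2 s3 by (intro exI[of _ ?r]) simp
  next
    case 3
    then show ?thesis using s3
      by (intro exI[of _ "- ?r"])
        (simp add: sym_diff right_diff_distrib left_diff_distrib K_commute[of "s a"] s1 s2 K_minus)
  qed
qed

lemma s_factor_prod:
  assumes "a \<in> \<Delta>" "\<mu> \<in> dualV" "\<mu> (embedV a) = 0"
  shows "s a * factor_prod \<mu> = factor_prod \<mu> * s a"
proof -
  have "factor_prod \<mu> = sym_map (\<Prod>b\<in>P - {a}. factor \<mu> b)"
    using assms(3) by (simp add: factor_prod_remove[OF assms(1)] factor_def[of \<mu> a])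
  moreover have "s a * sym_map (\<Prod>b\<in>P - {a}. factor \<mu> b) = sym_map (\<Prod>b\<in>P - {a}. factor \<mu> b) * s a"
  proof (rule s_sym_map_prod[where \<sigma> = "reflection a"])
    show "reflection a ` (P - {a}) \<subseteq> P - {a}"
      using reflection_permutes[OF assms(1)] by (simp add: bij_betw_def)
  qed (use finite_positive_roots s_factor[OF assms(1) _ reflectionV_fixed[OF assms(2,3)]] in auto)
  ultimately show ?thesis by simp
qed

lemma factor_prod_gws: "n \<in> gws \<mu> \<Longrightarrow> factor_prod \<nu> \<star> n \<in> gws \<mu>"
  unfolding factor_prod_def by (erule gws_central) (rule iota_sym_map)

text \<open>At such a weight only the factors 1 and \<open>c b - b\<close> occur, and
  \<open>c b - \<mu> (embedV b)\<close> has positive real part.\<close>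

lemma factor_prod_injective:
  assumes "\<And>b. b \<in> P \<Longrightarrow> lex_le0 (\<mu> (embedV b))" "n \<in> gws \<mu>" "factor_prod \<mu> \<star> n = 0"
  shows "n = 0"
proof -
  have "sym_map (\<Prod>b\<in>I. factor \<mu> b) \<star> n = 0 \<Longrightarrow> n = 0" if "finite I" "I \<subseteq> P" "n \<in> gws \<mu>" for I n
    using that
  proof (induction arbitrary: n rule: finite_induct)
    case (insert b I)
    let ?F = "sym_map (factor \<mu> b)"
    have "sym_map (\<Prod>b\<in>insert b I. factor \<mu> b) = sym_map (\<Prod>b\<in>I. factor \<mu> b) * ?F"
      using insert.hyps by (simp add: sym_mult sym_commute)
    then have "sym_map (\<Prod>b\<in>I. factor \<mu> b) \<star> ?F \<star> n = 0"
      using insert.prems(1) by (simp add: act_mult)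
    moreover have "?F \<star> n \<in> gws \<mu>"
      by (rule gws_central[OF insert.prems(3)]) (rule iota_sym_map)
    ultimately have F: "?F \<star> n = 0" using insert.IH insert.prems(2) by blast
    have b: "b \<in> P" using insert.prems(2) by blast
    show "n = 0"
    proof (cases "\<mu> (embedV b) = 0")
      case True
      then show ?thesis using F by (simp add: factor_def act_one)
    next
      case False
      have "\<mu> (embedV b) \<noteq> c b"
        using assms(1)[OF b] c_positive(1)[OF positive_root[OF b]] by (auto simp: lex_le0_def)
      moreover have "(\<iota> (embedV b) - K (c b)) \<star> n = 0"
        using F False assms(1)[OF b] by (simp add: factor_def sym_diff act_diff_left)
      ultimately show ?thesis using gws_shift_injective[OF insert.prems(3)] by blast
    qed
  qed (simp add: act_one)
  then show ?thesis using finite_positive_roots assms(2,3) unfolding factor_prod_def by blast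
qed

lemma sign_vectorI:
  assumes "\<And>a. a \<in> \<Delta> \<Longrightarrow> s a \<star> e = - e" "w \<in> W"
  shows "t w \<star> e = of_int (sg w) \<star> e"
proof -
  obtain ds where ds: "set ds \<subseteq> \<Delta>" "length ds = len w" "w = word_prod ds"
    using len_word[OF assms(2)] .
  have "t (word_prod ds) \<star> e = of_int ((- 1) ^ length ds) \<star> e"
    using ds(1)
  proof (induction ds)
    case (Cons a ds)
    have "t (word_prod (a # ds)) = s a * t (word_prod ds)"
      unfolding word_prod_simps using Cons.prems word_prod_W simple_root
      by (intro t_mult reflection_W) auto
    then have "t (word_prod (a # ds)) \<star> e = s a \<star> K (of_int ((- 1) ^ length ds)) \<star> e"
      using Cons by (simp add: act_mult K_of_int del: of_int_power word_prod_simps)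
    also have "\<dots> = K (of_int ((- 1) ^ length ds)) \<star> - e"
      using assms(1) Cons.prems by (simp only: K_act_commute[of "s a"]) auto
    also have "\<dots> = of_int ((- 1) ^ length (a # ds)) \<star> e"
      by (simp only: K_of_int) (simp add: act_minus_right act_minus_left)
    finally show ?case .
  qed (simp only: word_prod_simps t_one, simp)
  then show ?thesis using ds by (simp add: sgn_char_def)
qed

definition W_orbit :: "('v cplx \<Rightarrow> complex) \<Rightarrow> ('v cplx \<Rightarrow> complex) set" where
  "W_orbit \<mu> = (\<lambda>w. \<mu> \<circ> cx w) ` W"

lemma W_orbit_dualV: "\<mu> \<in> dualV \<Longrightarrow> \<nu> \<in> W_orbit \<mu> \<Longrightarrow> \<nu> \<in> dualV"
  unfolding W_orbit_def using dualV_cx[OF _ reflection_group_linear] by blast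

lemma finite_W_orbit: "finite (W_orbit \<mu>)"
  using finite_W by (simp add: W_orbit_def)

lemma comp_cx_reflection: "\<mu> \<circ> cx (w \<circ> reflection a) = \<mu> \<circ> cx w \<circ> reflectionV a"
  by (simp only: cx_comp reflectionV_cx comp_assoc)

lemma W_orbit_reflection: "\<nu> \<in> W_orbit \<mu> \<Longrightarrow> a \<in> \<Delta> \<Longrightarrow> \<nu> \<circ> reflectionV a \<in> W_orbit \<mu>"
  unfolding W_orbit_def
  using comp_cx_reflection W_comp_reflection simple_root by (auto simp flip: comp_cx_reflection)

lemma self_in_W_orbit: "\<mu> \<in> W_orbit \<mu>"
  unfolding W_orbit_def by (rule image_eqI[of _ _ id]) (simp_all only: cx_id comp_id reflection_group.one)

end

section \<open>Vectors indexed by the orbit and their components\<close>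

context lex_antidominant_module
begin

abbreviation orbit :: "('v cplx \<Rightarrow> complex) set" where "orbit \<equiv> W_orbit \<xi>"

lemmas orbit_dualV = W_orbit_dualV[OF xi_dual]
lemmas xi_orbit = self_in_W_orbit[of \<xi>]

definition orbit_vector :: "('v cplx \<Rightarrow> complex) \<Rightarrow> 'm" where
  "orbit_vector \<mu> = (let w = SOME w. w \<in> W \<and> \<xi> \<circ> cx w = \<mu> in K (of_int (sg w)) \<star> ti w \<star> stab_vector)"

text \<open>Two choices \<open>u\<close> and \<open>w\<close> differ by the element
  \<open>u \<circ> inv w\<close> of the stabilizer. It acts on \<open>stab_vector\<close> by its
  sign, which the sign in the definition cancels.\<close>

lemma orbit_vector_eq:
  assumes "w \<in> W" shows "orbit_vector (\<xi> \<circ> cx w) = K (of_int (sg w)) \<star> ti w \<star> stab_vector"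
proof -
  define u where "u = (SOME u. u \<in> W \<and> \<xi> \<circ> cx u = \<xi> \<circ> cx w)"
  have u: "u \<in> W" "\<xi> \<circ> cx u = \<xi> \<circ> cx w"
    using someI_ex[of "\<lambda>u. u \<in> W \<and> \<xi> \<circ> cx u = \<xi> \<circ> cx w"] assms
      unfolding u_def by blast+
  define z where "z = u \<circ> inv w"
  have zW: "z \<in> W" unfolding z_def using u assms reflection_group_comp reflection_group_inv by blast
  have zw: "z \<circ> w = u" using assms by (simp add: z_def fun_eq_iff)
  have "\<xi> \<circ> cx z = (\<xi> \<circ> cx w) \<circ> cx (inv w)"
    by (simp only: z_def cx_comp comp_assoc[symmetric] u(2))
  also have "\<dots> = \<xi> \<circ> cx (w \<circ> inv w)" by (simp only: cx_comp comp_assoc)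
  also have "w \<circ> inv w = id" using assms by (simp add: fun_eq_iff)
  finally have z: "z \<in> stab" using zW unfolding stab_def by (simp only: cx_id comp_id) blast
  have "ti u \<star> stab_vector = ti w \<star> K (of_int (sg z)) \<star> stab_vector"
    by (simp only: zw[symmetric] ti_comp[OF zW assms] act_mult ti_stab_vector[OF z])
  moreover have "(of_int (sg u) * of_int (sg z) :: complex) = of_int (sg w)"
  proof -
    have "sg u * sg z = sg w * (sg z * sg z)"
      by (simp only: zw[symmetric] sg_comp[OF zW assms] mult.commute mult.left_commute)
    then show ?thesis by (metis mult.right_neutral of_int_mult sg_square)
  qed
  ultimately have "K (of_int (sg u)) \<star> ti u \<star> stab_vector = K (of_int (sg w)) \<star> ti w \<star> stab_vector"
    by (simp only: K_act_commute[of "ti w"] M.scale_scale)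
  then show ?thesis by (simp only: orbit_vector_def Let_def u_def)
qed

lemma orbit_vector_xi: "orbit_vector \<xi> = stab_vector"
  using orbit_vector_eq[OF reflection_group.one] unfolding cx_id comp_id ti_id
  by (simp add: sgn_char_def act_one)

lemma s_orbit_vector:
  assumes "\<mu> \<in> orbit" "a \<in> \<Delta>" shows "s a \<star> orbit_vector \<mu> = - orbit_vector (\<mu> \<circ> reflectionV a)"
proof -
  obtain w where w: "w \<in> W" "\<mu> = \<xi> \<circ> cx w" using assms(1) unfolding W_orbit_def by blast
  have aR: "a \<in> R" using simple_root assms(2) .
  have "orbit_vector (\<mu> \<circ> reflectionV a) = K (of_int (sg (w \<circ> reflection a))) \<star> ti (w \<circ> reflection a) \<star> stab_vector"
    unfolding w(2) comp_cx_reflection[symmetric] by (rule orbit_vector_eq[OF W_comp_reflection[OF w(1) aR]])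
  also have "\<dots> = - (K (of_int (sg w)) \<star> s a \<star> ti w \<star> stab_vector)"
    by (simp add: sg_comp_simple[OF w(1) assms(2)] ti_comp_reflection[OF w(1) aR] act_mult K_minus act_minus_left)
  also have "K (of_int (sg w)) \<star> s a \<star> ti w \<star> stab_vector = s a \<star> orbit_vector \<mu>"
    by (simp only: w(2) orbit_vector_eq[OF w(1)] K_act_commute[of "s a"])
  finally show ?thesis by (simp only: minus_minus)
qed

text \<open>Distance of a weight from \<open>\<xi>\<close> in the orbit. It filters the orbit so
  that the vector of \<open>\<mu>\<close> involves no weight deeper than
  \<open>\<mu>\<close>.\<close>

definition depth :: "('v cplx \<Rightarrow> complex) \<Rightarrow> nat" where
  "depth \<mu> = (LEAST n. \<exists>w\<in>W. \<xi> \<circ> cx w = \<mu> \<and> len w = n)"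

lemma depth_le: "w \<in> W \<Longrightarrow> depth (\<xi> \<circ> cx w) \<le> len w"
  unfolding depth_def by (rule Least_le) blast

lemma depth_ex:
  assumes "\<mu> \<in> orbit" obtains w where "w \<in> W" "\<mu> = \<xi> \<circ> cx w" "len w = depth \<mu>"
proof -
  have "\<exists>n. \<exists>w\<in>W. \<xi> \<circ> cx w = \<mu> \<and> len w = n" using assms
    unfolding W_orbit_def by blast
  from LeastI_ex[OF this] have "\<exists>w\<in>W. \<xi> \<circ> cx w = \<mu> \<and> len w = depth \<mu>"
    unfolding depth_def .
  then show ?thesis using that by blast
qed

lemma depth_reflection_le:
  assumes "\<mu> \<in> orbit" "a \<in> \<Delta>" shows "depth (\<mu> \<circ> reflectionV a) \<le> depth \<mu> + 1"
proof -
  obtain w where w: "w \<in> W" "\<mu> = \<xi> \<circ> cx w" "len w = depth \<mu>" using depth_ex[OF assms(1)] .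
  have "depth (\<mu> \<circ> reflectionV a) \<le> len (w \<circ> reflection a)"
    unfolding w(2) comp_cx_reflection[symmetric]
    by (rule depth_le[OF W_comp_reflection[OF w(1) simple_root[OF assms(2)]]])
  then show ?thesis using len_comp_simple(1)[OF w(1) assms(2)] w(3) by (auto split: if_splits)
qed

text \<open>A shortest \<open>w\<close> reaching the reflected weight sends \<open>a\<close> to a
  root at which \<open>\<xi>\<close> is lexicographically positive. This root is negative, so
  \<open>a\<close> is a descent of \<open>w\<close>, and removing it gives a shorter path to
  \<open>\<mu>\<close>.\<close>

lemma depth_reflection_less:
  assumes "\<mu> \<in> orbit" "a \<in> \<Delta>" "lex_le0 (\<mu> (embedV a))" "\<mu> (embedV a) \<noteq> 0"
  shows "depth \<mu> < depth (\<mu> \<circ> reflectionV a)"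
proof -
  let ?\<nu> = "\<mu> \<circ> reflectionV a"
  obtain w where w: "w \<in> W" "?\<nu> = \<xi> \<circ> cx w" "len w = depth ?\<nu>"
    using depth_ex[OF W_orbit_reflection[OF assms(1,2)]] .
  have "\<xi> (embedV (w a)) = ?\<nu> (embedV a)" by (simp only: w(2) xi_cx_embedV[OF w(1)])
  also have "\<dots> = - \<mu> (embedV a)" by (rule comp_reflectionV_root[OF orbit_dualV[OF assms(1)]])
  finally have "w a \<notin> P" using xi_lex[of "w a"] assms(3,4) lex_le0_uminus by metis
  then have "len (w \<circ> reflection a) < len w"
    by (rule len_comp_reflection_less[OF w(1) simple_root_positive[OF assms(2)]])
  moreover have "depth (\<xi> \<circ> cx (w \<circ> reflection a)) \<le> len (w \<circ> reflection a)"
    by (rule depth_le[OF W_comp_reflection[OF w(1) simple_root[OF assms(2)]]])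
  moreover have "\<xi> \<circ> cx (w \<circ> reflection a) = \<mu>"
    by (simp only: comp_cx_reflection w(2)[symmetric] comp_reflectionV_twice)
  ultimately show ?thesis using w(3) by simp
qed

text \<open>Each letter of a reduced word mixes a weight only with its reflection, whose depth is at
  most one larger.\<close>

lemma ti_stab_vector_gsum: "w \<in> W \<Longrightarrow> ti w \<star> stab_vector \<in> gsum {\<mu> \<in> orbit. depth \<mu> \<le> len w}"
proof (induction "len w" arbitrary: w rule: less_induct)
  case less
  show ?case
  proof (cases "w = id")
    case True
    have "depth (\<xi> \<circ> cx id) \<le> len id" by (rule depth_le[OF reflection_group.one])
    then have "\<xi> \<in> {\<mu> \<in> orbit. depth \<mu> \<le> len w}"
      using xi_orbit unfolding True cx_id comp_id by blast
    moreover have "ti w \<star> stab_vector = stab_vector" unfolding True ti_id by (rule act_one)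
    ultimately show ?thesis using gws_gsum[OF _ stab_vector_gws] by simp
  next
    case False
    then obtain a where a: "a \<in> \<Delta>" "w a \<notin> P" using descent_ex less(2) by blast
    define u where "u = w \<circ> reflection a"
    have u: "u \<in> W" unfolding u_def by (rule W_comp_reflection[OF less(2) simple_root[OF a(1)]])
    have lu: "len w = len u + 1"
      using len_comp_simple[OF less(2) a(1)] a(2) unfolding u_def by simp
    have "w = u \<circ> reflection a" unfolding u_def
      by (simp only: comp_assoc reflection_comp_reflection comp_id)
    then have "ti w \<star> stab_vector = s a \<star> ti u \<star> stab_vector"
      by (simp only: ti_comp_reflection[OF u simple_root[OF a(1)]] act_mult)
    moreover have "ti u \<star> stab_vector \<in> gsum {\<mu> \<in> orbit. depth \<mu> \<le> len u}"
      by (rule less(1)[OF _ u]) (simp add: lu)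
    then have "s a \<star> ti u \<star> stab_vector \<in> gsum {\<mu> \<in> orbit. depth \<mu> \<le> len w}"
    proof (rule gsum_s[OF a(1), rotated])
      fix \<mu> assume "\<mu> \<in> {\<mu> \<in> orbit. depth \<mu> \<le> len u}"
      then show "\<mu> \<in> {\<mu> \<in> orbit. depth \<mu> \<le> len w} \<and> (\<mu> \<circ> reflectionV a \<in> {\<mu> \<in> orbit. depth \<mu> \<le> len w}
          \<or> gws (\<mu> \<circ> reflectionV a) = {0})"
        using W_orbit_reflection[of \<mu> \<xi> a] depth_reflection_le[of \<mu> a] a(1) lu by simp
    qed (use orbit_dualV in blast)
    ultimately show ?thesis by simp
  qed
qed

lemma orbit_vector_gsum:
  assumes "\<mu> \<in> orbit" shows "orbit_vector \<mu> \<in> gsum {\<nu> \<in> orbit. depth \<nu> \<le> depth \<mu>}"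
proof -
  obtain w where w: "w \<in> W" "\<mu> = \<xi> \<circ> cx w" "len w = depth \<mu>" using depth_ex[OF assms] .
  show ?thesis
    using gsum_K[OF ti_stab_vector_gsum[OF w(1)], of "of_int (sg w)"] unfolding w(3)
      by (simp only: w(2) orbit_vector_eq[OF w(1)])
qed

text \<open>The vector T(\<mu>) of the overview. The depth bound on the remainder excludes the
  reflected weight in \<open>tau_orbit_component\<close>.\<close>

definition orbit_component :: "('v cplx \<Rightarrow> complex) \<Rightarrow> 'm" where
  "orbit_component \<mu> = (SOME n. n \<in> gws \<mu> \<and> orbit_vector \<mu> - n \<in> gsum ({\<nu> \<in> orbit. depth \<nu> \<le> depth \<mu>} - {\<mu>}))"

lemma
  assumes "\<mu> \<in> orbit"
  shows orbit_component_gws: "orbit_component \<mu> \<in> gws \<mu>"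
    and orbit_vector_minus_component: "orbit_vector \<mu> - orbit_component \<mu> \<in> gsum ({\<nu> \<in> orbit. depth \<nu> \<le> depth \<mu>} - {\<mu>})"
proof -
  have "\<exists>n. n \<in> gws \<mu> \<and> orbit_vector \<mu> - n \<in> gsum ({\<nu> \<in> orbit. depth \<nu> \<le> depth \<mu>} - {\<mu>})"
    using gsum_component[OF orbit_vector_gsum[OF assms], of \<mu>] assms by blast
  from someI_ex[OF this] show "orbit_component \<mu> \<in> gws \<mu>"
    "orbit_vector \<mu> - orbit_component \<mu> \<in> gsum ({\<nu> \<in> orbit. depth \<nu> \<le> depth \<mu>} - {\<mu>})"
    unfolding orbit_component_def by blast+
qed

lemma orbit_vector_minus_component_orbit: "\<mu> \<in> orbit \<Longrightarrow> orbit_vector \<mu> - orbit_component \<mu> \<in> gsum (orbit - {\<mu>})"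
  by (rule gsum_mono[OF _ orbit_vector_minus_component]) auto

lemma orbit_component_xi: "orbit_component \<xi> = stab_vector"
proof -
  have "stab_vector - orbit_component \<xi> \<in> gws \<xi>"
    using gws_diff[OF stab_vector_gws orbit_component_gws[OF xi_orbit]] .
  then have "stab_vector - orbit_component \<xi> = 0"
    using orbit_vector_minus_component_orbit[OF xi_orbit] gws_gsum_disjoint unfolding orbit_vector_xi by blast
  then show ?thesis by simp
qed

lemma gsum_orbit_s:
  assumes "a \<in> \<Delta>" "A \<subseteq> orbit" "\<And>\<mu>. \<mu> \<in> A \<Longrightarrow> \<mu> \<circ> reflectionV a \<in> A" "n \<in> gsum A"
  shows "s a \<star> n \<in> gsum A"
  using gsum_s[OF assms(1) _ assms(4)] assms(2,3) orbit_dualV by blast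

text \<open>Compare the components at \<open>\<mu>\<close> in
  \<open>s a \<star> orbit_vector \<mu> = - orbit_vector \<mu>\<close>; the reflection permutes the
  other weights, so \<open>s a\<close> preserves the sum of their spaces.\<close>

lemma s_orbit_component_fixed:
  assumes "\<mu> \<in> orbit" "a \<in> \<Delta>" "\<mu> (embedV a) = 0"
  shows "s a \<star> orbit_component \<mu> = - orbit_component \<mu>"
proof -
  have fix': "\<mu> \<circ> reflectionV a = \<mu>"
    by (rule reflectionV_fixed[OF orbit_dualV[OF assms(1)] assms(3)])
  have "s a \<star> (orbit_vector \<mu> - orbit_component \<mu>) \<in> gsum (orbit - {\<mu>})"
  proof (rule gsum_orbit_s[OF assms(2) _ _ orbit_vector_minus_component_orbit[OF assms(1)]])
    fix \<nu> assume \<nu>: "\<nu> \<in> orbit - {\<mu>}"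
    then have "\<nu> \<circ> reflectionV a \<noteq> \<mu>" using fix' comp_reflectionV_twice
      by (metis DiffD2 singletonI)
    then show "\<nu> \<circ> reflectionV a \<in> orbit - {\<mu>}" using \<nu> W_orbit_reflection assms(2)
      by blast
  qed blast
  then have "s a \<star> (orbit_vector \<mu> - orbit_component \<mu>) + (orbit_vector \<mu> - orbit_component \<mu>) \<in> gsum (orbit - {\<mu>})"
    using gsum_add orbit_vector_minus_component_orbit[OF assms(1)] by blast
  moreover have "s a \<star> (orbit_vector \<mu> - orbit_component \<mu>) + (orbit_vector \<mu> - orbit_component \<mu>) = - (s a \<star> orbit_component \<mu> + orbit_component \<mu>)"
    by (simp add: act_diff_right s_orbit_vector[OF assms(1,2)] fix')
  moreover have "- (s a \<star> orbit_component \<mu> + orbit_component \<mu>) \<in> gws \<mu>"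
    by (intro gws_minus gws_add gws_fixed[OF assms(2) _ fix'] orbit_component_gws[OF assms(1)])
  ultimately have "- (s a \<star> orbit_component \<mu> + orbit_component \<mu>) = 0"
    using gws_gsum_disjoint by (metis DiffD2 singletonI)
  then show ?thesis by (simp only: neg_equal_0_iff_equal eq_neg_iff_add_eq_0)
qed

lemma rt_injective: "n \<in> gws \<mu> \<Longrightarrow> \<mu> (embedV a) \<noteq> 0 \<Longrightarrow> rt a \<star> n = 0 \<Longrightarrow> n = 0"
  using gws_shift_injective[of n \<mu> "embedV a" 0] by simp

text \<open>Compare the components at the reflected weight \<open>?\<nu>\<close> in
  \<open>s a \<star> orbit_vector \<mu> = - orbit_vector ?\<nu>\<close>. As \<open>?\<nu>\<close> is
  deeper than \<open>\<mu>\<close>, the remainder of \<open>orbit_vector \<mu>\<close> has weights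
  other than \<open>\<mu>\<close> and \<open>?\<nu>\<close>, a set stable under the reflection. So
  only \<open>s a \<star> orbit_component \<mu>\<close> contributes.\<close>

lemma tau_orbit_component:
  assumes "\<mu> \<in> orbit" "a \<in> \<Delta>" "lex_le0 (\<mu> (embedV a))" "\<mu> (embedV a) \<noteq> 0"
  shows "tau a \<star> orbit_component \<mu> = rt a \<star> orbit_component (\<mu> \<circ> reflectionV a)"
proof -
  let ?\<nu> = "\<mu> \<circ> reflectionV a"
  have \<nu>: "?\<nu> \<in> orbit" using W_orbit_reflection assms by blast
  have neq: "?\<nu> \<noteq> \<mu>" using reflectionV_fixed_iff[OF orbit_dualV[OF assms(1)]] assms(4) by blast
  have "orbit_vector \<mu> - orbit_component \<mu> \<in> gsum (orbit - {\<mu>, ?\<nu>})"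
    by (rule gsum_mono[OF _ orbit_vector_minus_component[OF assms(1)]]) (use depth_reflection_less[OF assms] in auto)
  then have "s a \<star> (orbit_vector \<mu> - orbit_component \<mu>) \<in> gsum (orbit - {\<mu>, ?\<nu>})"
  proof (rule gsum_orbit_s[OF assms(2), rotated 2])
    fix \<kappa> assume l: "\<kappa> \<in> orbit - {\<mu>, ?\<nu>}"
    then have "\<kappa> \<circ> reflectionV a \<noteq> \<mu>" "\<kappa> \<circ> reflectionV a \<noteq> ?\<nu>"
      using comp_reflectionV_twice by (metis Diff_iff insert_iff)+
    then show "\<kappa> \<circ> reflectionV a \<in> orbit - {\<mu>, ?\<nu>}"
      using l W_orbit_reflection assms(2) by blast
  qed blast
  then have "s a \<star> (orbit_vector \<mu> - orbit_component \<mu>) \<in> gsum (orbit - {?\<nu>})"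
    by (rule gsum_mono[rotated]) blast
  from gsum_add[OF this orbit_vector_minus_component_orbit[OF \<nu>]]
  have 1: "- (s a \<star> orbit_component \<mu> + orbit_component ?\<nu>) \<in> gsum (orbit - {?\<nu>})"
    by (simp add: act_diff_right s_orbit_vector[OF assms(1,2)])
  have "s a \<star> orbit_component \<mu> \<in> gsum {\<mu>, ?\<nu>}"
    by (rule gws_s[OF assms(2) orbit_dualV[OF assms(1)] orbit_component_gws[OF assms(1)]])
  \<comment> \<open>The component at \<open>?\<nu>\<close> of
    \<open>s a \<star> orbit_component \<mu>\<close>, which will turn out to be
    \<open>- orbit_component ?\<nu>\<close>.\<close>
  then obtain z where z: "z \<in> gws ?\<nu>" "s a \<star> orbit_component \<mu> - z \<in> gsum ({\<mu>, ?\<nu>} - {?\<nu>})"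
    using gsum_component by blast
  have 2: "s a \<star> orbit_component \<mu> - z \<in> gsum {\<mu>}" by (rule gsum_mono[OF _ z(2)]) blast
  have "s a \<star> orbit_component \<mu> - z \<in> gsum (orbit - {?\<nu>})"
    by (rule gsum_mono[OF _ 2]) (use neq assms(1) in auto)
  from gsum_add[OF 1 this] have "- (orbit_component ?\<nu> + z) \<in> gsum (orbit - {?\<nu>})"
    by (simp add: algebra_simps)
  moreover have "- (orbit_component ?\<nu> + z) \<in> gws ?\<nu>"
    by (intro gws_minus gws_add orbit_component_gws[OF \<nu>] z(1))
  ultimately have "- (orbit_component ?\<nu> + z) = 0" using gws_gsum_disjoint by (metis DiffD2 singletonI)
  then have "z = - orbit_component ?\<nu>" by (simp only: neg_equal_0_iff_equal eq_neg_iff_add_eq_0 add.commute)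
  then have "s a \<star> orbit_component \<mu> + orbit_component ?\<nu> \<in> gsum {\<mu>}" using 2 by simp
  \<comment> \<open>Since \<open>rt a * s a = K (c a) - tau a\<close>, this element of
    \<open>gws \<mu>\<close> is also a difference of two vectors of weight \<open>?\<nu>\<close>,
    hence zero.\<close>
  then have "rt a \<star> (s a \<star> orbit_component \<mu> + orbit_component ?\<nu>) - K (c a) \<star> orbit_component \<mu> \<in> gsum {\<mu>}"
    by (intro gsum_diff gsum_iota gsum_K gws_gsum[OF _ orbit_component_gws[OF assms(1)]]) simp_all
  moreover have "rt a \<star> (s a \<star> orbit_component \<mu> + orbit_component ?\<nu>) - K (c a) \<star> orbit_component \<mu> = rt a \<star> orbit_component ?\<nu> - tau a \<star> orbit_component \<mu>"
    by (simp add: tau_eq[OF assms(2)] act_simps)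
  ultimately have "rt a \<star> orbit_component ?\<nu> - tau a \<star> orbit_component \<mu> \<in> gsum {\<mu>}" by simp
  moreover have "rt a \<star> orbit_component ?\<nu> - tau a \<star> orbit_component \<mu> \<in> gws ?\<nu>"
    by (intro gws_diff gws_iota gws_tau[OF assms(2)] orbit_component_gws \<nu> assms(1))
  ultimately have "rt a \<star> orbit_component ?\<nu> - tau a \<star> orbit_component \<mu> = 0"
    using gws_gsum_disjoint neq by blast
  then show ?thesis by simp
qed

section \<open>Assembling the sign vector from its weight components\<close>

definition sign_component :: "('v cplx \<Rightarrow> complex) \<Rightarrow> 'm" where "sign_component \<mu> = factor_prod \<mu> \<star> orbit_component \<mu>"

lemma sign_component_gws: "\<mu> \<in> orbit \<Longrightarrow> sign_component \<mu> \<in> gws \<mu>"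
  unfolding sign_component_def by (intro factor_prod_gws orbit_component_gws)

text \<open>For the first relation, \<open>rt a\<close> is cancelled on \<open>gws ?\<nu>\<close>.
  Applying \<open>tau a\<close> to it and using \<open>tau_square\<close> gives the second one up to
  the factor \<open>c a - a\<close>, which is injective on \<open>gws \<mu>\<close> because the real
  part of \<open>\<mu>\<close> at \<open>a\<close> is nonpositive and \<open>c a\<close> is
  positive.\<close>

lemma tau_sign_component:
  assumes "\<mu> \<in> orbit" "a \<in> \<Delta>" "lex_le0 (\<mu> (embedV a))" "\<mu> (embedV a) \<noteq> 0"
  shows "tau a \<star> sign_component \<mu> = (K (c a) + rt a) \<star> sign_component (\<mu> \<circ> reflectionV a)"
    and "tau a \<star> sign_component (\<mu> \<circ> reflectionV a) = (K (c a) + rt a) \<star> sign_component \<mu>"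
proof -
  let ?\<nu> = "\<mu> \<circ> reflectionV a"
  have dual: "\<mu> \<in> dualV" using orbit_dualV assms(1) .
  have \<nu>: "?\<nu> \<in> orbit" using W_orbit_reflection assms by blast
  have twice: "?\<nu> \<circ> reflectionV a = \<mu>" by (rule comp_reflectionV_twice)
  have comm: "factor_prod ?\<nu> * rt a = rt a * factor_prod ?\<nu>"
    unfolding factor_prod_def by (rule iota_sym_map[symmetric])
  have comm': "(K (c a) + rt a) * rt a = rt a * (K (c a) + rt a)"
    by (simp add: distrib_left distrib_right K_commute[of "rt a"])
  have "rt a \<star> tau a \<star> sign_component \<mu> = (K (c a) + rt a) \<star> factor_prod ?\<nu> \<star> tau a \<star> orbit_component \<mu>"
    unfolding sign_component_def act_mult[symmetric] mult.assoc[symmetric]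
    using tau_factor_prod[OF assms(2) dual assms(3,4)] by (simp only: mult.assoc)
  also have "\<dots> = ((K (c a) + rt a) * (factor_prod ?\<nu> * rt a)) \<star> orbit_component ?\<nu>"
    by (simp only: tau_orbit_component[OF assms] act_mult)
  also have "(K (c a) + rt a) * (factor_prod ?\<nu> * rt a) = rt a * ((K (c a) + rt a) * factor_prod ?\<nu>)"
    by (simp only: comm mult.assoc[symmetric] comm')
  finally have "rt a \<star> (tau a \<star> sign_component \<mu> - (K (c a) + rt a) \<star> sign_component ?\<nu>) = 0"
    by (simp only: act_diff_right act_mult sign_component_def) simp
  moreover have "tau a \<star> sign_component \<mu> - (K (c a) + rt a) \<star> sign_component ?\<nu> \<in> gws ?\<nu>"
    unfolding act_add_left
      by (intro gws_diff gws_add gws_K gws_iota gws_tau[OF assms(2)] sign_component_gws \<nu> assms(1))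
  moreover have "?\<nu> (embedV a) \<noteq> 0"
    unfolding comp_reflectionV_root[OF dual] using assms(4) by simp
  ultimately have "tau a \<star> sign_component \<mu> - (K (c a) + rt a) \<star> sign_component ?\<nu> = 0"
    using rt_injective by blast
  then show 1: "tau a \<star> sign_component \<mu> = (K (c a) + rt a) \<star> sign_component ?\<nu>" by simp
  have t1: "(K (c a) - rt a) * tau a = tau a * (K (c a) + rt a)"
    using tau_iota[OF assms(2), of "embedV a"] root_nonzero[OF simple_root[OF assms(2)]]
    by (simp add: left_diff_distrib distrib_left K_commute[of "tau a"] embedV_minus iota_minus)
  have "(K (c a) - rt a) \<star> tau a \<star> sign_component ?\<nu> = tau a \<star> (K (c a) + rt a) \<star> sign_component ?\<nu>"
    by (simp only: act_mult[symmetric] t1)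
  also have "\<dots> = (tau a * tau a) \<star> sign_component \<mu>" by (simp only: 1[symmetric] act_mult)
  also have "\<dots> = (K (c a) - rt a) \<star> (K (c a) + rt a) \<star> sign_component \<mu>"
    by (simp only: tau_square[OF assms(2)] act_mult)
  finally have "(rt a - K (c a)) \<star> (tau a \<star> sign_component ?\<nu> - (K (c a) + rt a) \<star> sign_component \<mu>) = 0"
    by (simp only: act_diff_right act_diff_left[of "rt a"] act_diff_left[of "K (c a)"]) (simp add: algebra_simps)
  moreover have "tau a \<star> sign_component ?\<nu> \<in> gws \<mu>"
    using gws_tau[OF assms(2) sign_component_gws[OF \<nu>]] unfolding twice .
  then have "tau a \<star> sign_component ?\<nu> - (K (c a) + rt a) \<star> sign_component \<mu> \<in> gws \<mu>"
    unfolding act_add_left by (intro gws_diff gws_add gws_K gws_iota sign_component_gws assms(1))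
  moreover have "\<mu> (embedV a) \<noteq> c a"
    using assms(3) c_positive(1)[OF simple_root[OF assms(2)]] by (auto simp: lex_le0_def)
  ultimately have "tau a \<star> sign_component ?\<nu> - (K (c a) + rt a) \<star> sign_component \<mu> = 0"
    using gws_shift_injective by blast
  then show "tau a \<star> sign_component ?\<nu> = (K (c a) + rt a) \<star> sign_component \<mu>" by simp
qed

text \<open>On the sum \<open>?f\<close> the intertwiner acts as \<open>c a + a\<close>, while by
  \<open>tau_eq\<close> it is \<open>c a - a * s a\<close>. Hence \<open>rt a\<close> kills
  \<open>(s a + 1) \<star> ?f\<close>, and it is injective on both weight spaces involved.\<close>

lemma s_sign_component_pair:
  assumes "\<mu> \<in> orbit" "a \<in> \<Delta>" "lex_le0 (\<mu> (embedV a))" "\<mu> (embedV a) \<noteq> 0"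
  shows "(s a + 1) \<star> (sign_component \<mu> + sign_component (\<mu> \<circ> reflectionV a)) = 0"
proof -
  let ?\<nu> = "\<mu> \<circ> reflectionV a"
  let ?f = "sign_component \<mu> + sign_component ?\<nu>"
  have dual: "\<mu> \<in> dualV" using orbit_dualV assms(1) .
  have \<nu>: "?\<nu> \<in> orbit" using W_orbit_reflection assms by blast
  have neq: "?\<nu> \<noteq> \<mu>" using reflectionV_fixed_iff[OF dual] assms(4) by blast
  have f: "?f \<in> gsum {\<mu>, ?\<nu>}"
    by (intro gsum_add gws_gsum[OF _ sign_component_gws[OF assms(1)]] gws_gsum[OF _ sign_component_gws[OF \<nu>]]) simp_all
  have "tau a \<star> ?f = (K (c a) + rt a) \<star> ?f"
    by (simp only: act_add_right[of "tau a"] tau_sign_component[OF assms] act_add_right[of "K (c a) + rt a"]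
        add.commute[of "_ \<star> sign_component \<mu>"])
  then have "- (rt a \<star> s a \<star> ?f) = rt a \<star> ?f"
    by (simp add: tau_eq[OF assms(2)] act_diff_left act_add_left act_mult)
  moreover have "rt a \<star> (s a + 1) \<star> ?f = rt a \<star> s a \<star> ?f + rt a \<star> ?f"
    by (simp only: act_add_left act_one act_add_right[of "rt a" "s a \<star> ?f"])
  ultimately have zero: "rt a \<star> (s a + 1) \<star> ?f = 0" by (metis add.right_inverse)
  have "s a \<star> ?f \<in> gsum {\<mu>, ?\<nu>}"
    by (rule gsum_orbit_s[OF assms(2) _ _ f]) (use assms(1) \<nu> comp_reflectionV_twice in auto)
  then have g: "(s a + 1) \<star> ?f \<in> gsum {\<mu>, ?\<nu>}" using gsum_add f
    by (simp only: act_add_left act_one)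
  obtain n where n: "n \<in> gws \<mu>" "(s a + 1) \<star> ?f - n \<in> gsum ({\<mu>, ?\<nu>} - {\<mu>})"
    using gsum_component[OF g] by blast
  let ?k = "(s a + 1) \<star> ?f - n"
  have k: "?k \<in> gsum {?\<nu>}" by (rule gsum_mono[OF _ n(2)]) blast
  then have k': "?k \<in> gws ?\<nu>" by (simp only: gsum_singleton)
  have sum: "rt a \<star> ?k = - (rt a \<star> n)" using zero by (simp add: act_diff_right)
  then have "rt a \<star> n \<in> gws ?\<nu>" using gws_minus[OF gws_iota[OF k']] by (metis minus_minus)
  then have rn: "rt a \<star> n = 0" using gws_disjoint[OF gws_iota[OF n(1)] _ neq[symmetric]] by simp
  then have "n = 0" using rt_injective[OF n(1)] assms(4) by blast
  moreover have "?\<nu> (embedV a) \<noteq> 0" unfolding comp_reflectionV_root[OF dual] using assms(4) by simp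
  then have "?k = 0" using rt_injective[OF k'] sum unfolding rn by (simp only: minus_zero)
  ultimately show ?thesis by simp
qed

lemma s_sign_component_orbit:
  assumes "\<mu> \<in> orbit" "a \<in> \<Delta>"
  shows "(s a + 1) \<star> sign_component \<mu> + (s a + 1) \<star> sign_component (\<mu> \<circ> reflectionV a) = 0"
proof -
  let ?\<nu> = "\<mu> \<circ> reflectionV a"
  have dual: "\<mu> \<in> dualV" using orbit_dualV assms(1) .
  have root: "?\<nu> (embedV a) = - \<mu> (embedV a)" by (rule comp_reflectionV_root[OF dual])
  consider "\<mu> (embedV a) = 0" | "\<mu> (embedV a) \<noteq> 0" "lex_le0 (\<mu> (embedV a))"
    | "?\<nu> (embedV a) \<noteq> 0" "lex_le0 (?\<nu> (embedV a))"
    using lex_le0_total unfolding root by fastforce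
  then show ?thesis
  proof cases
    case 1
    have "s a \<star> sign_component \<mu> = factor_prod \<mu> \<star> s a \<star> orbit_component \<mu>"
      unfolding sign_component_def act_mult[symmetric] s_factor_prod[OF assms(2) dual 1] ..
    then have "s a \<star> sign_component \<mu> = - sign_component \<mu>"
      by (simp only: s_orbit_component_fixed[OF assms 1] act_minus_right sign_component_def)
    then have "(s a + 1) \<star> sign_component \<mu> = 0" by (simp add: act_add_left act_one)
    moreover have "?\<nu> = \<mu>" by (rule reflectionV_fixed[OF dual 1])
    ultimately show ?thesis by (simp only: add_0)
  next
    case 2
    then show ?thesis using s_sign_component_pair[OF assms 2(2,1)] by (simp only: act_add_right)
  next
    case 3
    then show ?thesis using s_sign_component_pair[OF W_orbit_reflection[OF assms] assms(2) 3(2,1)]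
      by (simp only: act_add_right comp_reflectionV_twice add.commute)
  qed
qed

lemma sign_vector_ex: "\<exists>n. n \<noteq> 0 \<and> (\<forall>a\<in>\<Delta>. s a \<star> n = - n)"
proof (intro exI conjI ballI)
  let ?n = "\<Sum>\<mu>\<in>orbit. sign_component \<mu>"
  show "?n \<noteq> 0"
  proof
    assume "?n = 0"
    moreover have "?n = sign_component \<xi> + (\<Sum>\<mu>\<in>orbit - {\<xi>}. sign_component \<mu>)"
      using finite_W_orbit xi_orbit by (simp add: sum.remove)
    ultimately have "sign_component \<xi> = - (\<Sum>\<mu>\<in>orbit - {\<xi>}. sign_component \<mu>)"
      by (simp add: eq_neg_iff_add_eq_0)
    moreover have "- (\<Sum>\<mu>\<in>orbit - {\<xi>}. sign_component \<mu>) \<in> gsum (orbit - {\<xi>})"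
      by (intro gsum_minus gsum_sum gws_gsum[OF _ sign_component_gws]) auto
    ultimately have "sign_component \<xi> \<in> gsum (orbit - {\<xi>})" by simp
    then have "sign_component \<xi> = 0" using gws_gsum_disjoint[OF sign_component_gws[OF xi_orbit]] by blast
    then have "factor_prod \<xi> \<star> stab_vector = 0" by (simp only: sign_component_def orbit_component_xi)
    then have "stab_vector = 0" using factor_prod_injective[OF xi_lex stab_vector_gws] by blast
    then show False using stab_vector_nonzero by blast
  qed
  fix a assume a: "a \<in> \<Delta>"
  let ?h = "\<lambda>\<mu>. (s a + 1) \<star> sign_component \<mu>"
  have bij: "bij_betw (\<lambda>\<mu>. \<mu> \<circ> reflectionV a) orbit orbit"
    by (rule bij_betwI[where g = "\<lambda>\<mu>. \<mu> \<circ> reflectionV a"])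
      (use W_orbit_reflection a comp_reflectionV_twice in blast)+
  \<comment> \<open>Only \<open>?h\<close> at a weight plus \<open>?h\<close> at its reflection is
    known to vanish, so the sum over the orbit is doubled and the 2 is divided out.\<close>
  have "(\<Sum>\<mu>\<in>orbit. ?h \<mu>) + (\<Sum>\<mu>\<in>orbit. ?h \<mu>)
      = (\<Sum>\<mu>\<in>orbit. ?h \<mu>) + (\<Sum>\<mu>\<in>orbit. ?h (\<mu> \<circ> reflectionV a))"
    by (simp only: sum.reindex_bij_betw[OF bij, of ?h])
  also have "\<dots> = 0"
    unfolding sum.distrib[symmetric] by (rule sum.neutral) (use s_sign_component_orbit a in blast)
  finally have "K (1 + 1) \<star> (\<Sum>\<mu>\<in>orbit. ?h \<mu>) = 0"
    by (simp only: K_add K_simps act_add_left act_one)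
  then have "(\<Sum>\<mu>\<in>orbit. ?h \<mu>) = 0" unfolding K_act_eq_0 by simp
  then have "(s a + 1) \<star> ?n = 0" by (simp only: act_sum_right)
  then show "s a \<star> ?n = - ?n" by (simp add: act_add_left act_one eq_neg_iff_add_eq_0)
qed

end

section \<open>Weights of modules generated by a sign vector\<close>

context hecke_module
begin

text \<open>The square of \<open>tau a\<close> acts on m by the difference of the squares of
  \<open>c a\<close> and \<open>\<mu> (embedV a)\<close>, which is nonzero, so \<open>tau a\<close>
  cannot kill m.\<close>

lemma eigenvector_tau:
  assumes "a \<in> \<Delta>" "eigenvector \<mu> m" "\<mu> (embedV a) \<noteq> c a" "\<mu> (embedV a) \<noteq> - c a"
  shows "eigenvector (\<mu> \<circ> reflectionV a) (tau a \<star> m)"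
  unfolding eigenvector_def
proof (intro conjI allI)
  have ev: "\<iota> v \<star> m = K (\<mu> v) \<star> m" for v using assms(2) unfolding eigenvector_def by blast
  have "tau a \<star> tau a \<star> m = (K (c a) - rt a) \<star> (K (c a) + rt a) \<star> m"
    by (simp only: act_mult[symmetric] tau_square[OF assms(1)])
  also have "(K (c a) + rt a) \<star> m = K (c a + \<mu> (embedV a)) \<star> m"
    by (simp only: K_add act_add_left ev)
  also have "(K (c a) - rt a) \<star> K (c a + \<mu> (embedV a)) \<star> m
      = K (c a + \<mu> (embedV a)) \<star> (K (c a) - rt a) \<star> m"
    by (rule K_act_commute)
  also have "(K (c a) - rt a) \<star> m = K (c a - \<mu> (embedV a)) \<star> m"
    by (simp only: K_diff act_diff_left ev)
  finally have "tau a \<star> tau a \<star> m = K (c a + \<mu> (embedV a)) \<star> K (c a - \<mu> (embedV a)) \<star> m" .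
  moreover have "c a + \<mu> (embedV a) \<noteq> 0" using assms(4) by (metis add_eq_0_iff minus_minus)
  ultimately have "tau a \<star> tau a \<star> m \<noteq> 0"
    using assms(2,3) by (simp add: K_act_eq_0 eigenvector_def)
  then show "tau a \<star> m \<noteq> 0" by auto
  fix v
  have "\<iota> v \<star> tau a \<star> m = tau a \<star> \<iota> (reflectionV a v) \<star> m"
    by (simp only: act_mult[symmetric] iota_tau[OF assms(1)])
  then show "\<iota> v \<star> tau a \<star> m = K ((\<mu> \<circ> reflectionV a) v) \<star> tau a \<star> m"
    by (simp only: ev K_act_commute[of "tau a"] comp_apply)
qed

text \<open>The value at \<open>rho\<close> is the quantity minimised in both directions: a simple
  root of the wrong sign would make it smaller.\<close>

lemma reflectionV_rho:
  assumes "\<mu> \<in> dualV" "a \<in> \<Delta>"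
  shows "(\<mu> \<circ> reflectionV a) (embedV rho) = \<mu> (embedV rho) - 2 * \<mu> (embedV a)"
  unfolding comp_apply dualV_reflectionV[OF assms(1)] by (simp add: coroot_simple_rho[OF assms(2)])

lemma anti_dominant_imp_sign_vector:
  assumes "\<mu> \<in> dualV" "gws \<mu> \<noteq> {0}" "anti_dominant R \<Delta> \<mu>"
  shows "\<exists>n. n \<noteq> 0 \<and> (\<forall>a\<in>\<Delta>. s a \<star> n = - n)"
proof -
  \<comment> \<open>Among these weights one with minimal imaginary part at \<open>rho\<close> is
    lexicographically anti-dominant. At a simple root with value in i R_{>0}, reflection keeps all
    real parts, since the real part at that root is 0, and lowers the imaginary part at
    \<open>rho\<close>.\<close>
  define F where "F = {\<nu> \<in> W_orbit \<mu>. (\<exists>m. eigenvector \<nu> m) \<and> (\<forall>b\<in>P. Re (\<nu> (embedV b)) \<le> 0)}"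
  have "finite F" using finite_W_orbit by (simp add: F_def)
  moreover have "\<mu> \<in> F"
    using assms eigenvector_ex self_in_W_orbit unfolding F_def anti_dominant_def by blast
  ultimately obtain \<nu> where \<nu>: "\<nu> \<in> F"
      "\<And>\<kappa>. \<kappa> \<in> F \<Longrightarrow> \<not> Im (\<kappa> (embedV rho)) < Im (\<nu> (embedV rho))"
    using arg_min_if_finite[of F "\<lambda>\<nu>. Im (\<nu> (embedV rho))"] by blast
  then obtain m where m: "eigenvector \<nu> m" unfolding F_def by blast
  have dual: "\<nu> \<in> dualV" using \<nu>(1) W_orbit_dualV[OF assms(1)] unfolding F_def by blast
  have le: "Re (\<nu> (embedV b)) \<le> 0" if "b \<in> P" for b using \<nu>(1) that unfolding F_def by blast
  have "lex_le0 (\<nu> (embedV a))" if a: "a \<in> \<Delta>" for a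
  proof (rule ccontr)
    assume "\<not> lex_le0 (\<nu> (embedV a))"
    then have Re: "Re (\<nu> (embedV a)) = 0" and Im: "Im (\<nu> (embedV a)) > 0"
      using le[OF simple_root_positive[OF a]] by (auto simp: lex_le0_def)
    have "eigenvector (\<nu> \<circ> reflectionV a) (tau a \<star> m)"
      using c_positive(1)[OF simple_root[OF a]] Re by (intro eigenvector_tau[OF a m]) auto
    moreover have "Re ((\<nu> \<circ> reflectionV a) (embedV b)) \<le> 0" if "b \<in> P" for b
      unfolding comp_apply dualV_reflectionV[OF dual] using Re le[OF that] by simp
    ultimately have "\<nu> \<circ> reflectionV a \<in> F"
      using \<nu>(1) W_orbit_reflection a unfolding F_def by blast
    from \<nu>(2)[OF this] show False using Im unfolding reflectionV_rho[OF dual a] by simp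
  qed
  then have "lex_le0 (\<nu> (embedV b))" if "b \<in> P" for b
    using lex_le0_positive_root[OF dual] that by blast
  then interpret lex_antidominant_module R \<Delta> scaleH c t \<iota> act \<nu> m
    using dual m by unfold_locales
  show ?thesis by (rule sign_vector_ex)
qed

text \<open>The elements of the algebra that preserve \<open>N\<close> form a subalgebra, which
  contains V and the simple reflections and is therefore everything.\<close>

lemma is_submoduleI:
  assumes "M.subspace N" "\<And>v n. n \<in> N \<Longrightarrow> \<iota> v \<star> n \<in> N" "\<And>a n. a \<in> \<Delta> \<Longrightarrow> n \<in> N \<Longrightarrow> s a \<star> n \<in> N"
  shows "is_submodule act N"
proof -
  define S where "S = {h. \<forall>n\<in>N. h \<star> n \<in> N}"
  have "S = UNIV"
  proof (rule generated)
    show "is_subalgebra scaleH S"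
      using assms(1) unfolding is_subalgebra_def S_def
      by (auto simp: act_simps scaleH_eq M.subspace_add M.subspace_scale)
    show "range \<iota> \<subseteq> S" using assms(2) unfolding S_def by blast
    have "t w \<in> S" if "w \<in> reflection_group \<Delta>" for w
      using that
    proof (induction rule: reflection_group.induct)
      case one
      show ?case by (simp only: t_one) (simp add: S_def act_one)
    next
      case (step a w)
      have "t (reflection a \<circ> w) = s a * t w"
        using step simple_root simple_reflections_generate by (intro t_mult reflection_W) auto
      then show ?case using step assms(3) by (simp only: S_def mem_Collect_eq act_mult) blast
    qed
    then show "t ` W \<subseteq> S" using simple_reflections_generate by blast
  qed
  then have "h \<star> n \<in> N" if "n \<in> N" for h n using that unfolding S_def by blast
  then show ?thesis using assms(1) unfolding is_submodule_def
    by (simp add: M.subspace_0 M.subspace_add)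
qed

text \<open>Horner evaluation of a complex polynomial at \<open>\<iota> v\<close>, an element of a
  noncommutative ring.\<close>

definition eval_iota :: "'v cplx \<Rightarrow> complex poly \<Rightarrow> 'h" where
  "eval_iota v p = fold_coeffs (\<lambda>a h. K a + \<iota> v * h) p 0"

lemma eval_iota_0 [simp]: "eval_iota v 0 = 0"
  by (simp add: eval_iota_def)

lemma eval_iota_pCons [simp]: "eval_iota v (pCons a p) = K a + \<iota> v * eval_iota v p"
  by (cases "p = 0 \<and> a = 0") (auto simp: eval_iota_def)

lemma eval_iota_add: "eval_iota v (p + q) = eval_iota v p + eval_iota v q"
  by (induction p q rule: poly_induct2) (simp_all add: K_add distrib_left add_ac)

lemma eval_iota_smult: "eval_iota v (smult a p) = K a * eval_iota v p"
proof (induction p)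
  case (pCons b p)
  have "\<iota> v * (K a * eval_iota v p) = K a * (\<iota> v * eval_iota v p)"
    by (simp only: mult.assoc[symmetric] K_commute[of "\<iota> v"])
  then show ?case by (simp add: pCons K_mult distrib_left)
qed simp

lemma eval_iota_mult: "eval_iota v (p * q) = eval_iota v p * eval_iota v q"
  by (induction p) (simp_all add: eval_iota_add eval_iota_smult distrib_right mult.assoc)

lemma eval_iota_sum: "eval_iota v (\<Sum>i\<in>I. f i) = (\<Sum>i\<in>I. eval_iota v (f i))"
  by (induction I rule: infinite_finite_induct) (simp_all add: eval_iota_add)

end

locale irreducible_sign_module = hecke_module R \<Delta> scaleH c t \<iota> act
  for R \<Delta> :: "'v::real_inner set"
    and scaleH :: "complex \<Rightarrow> 'h::ring_1 \<Rightarrow> 'h"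
    and c :: "'v \<Rightarrow> complex"
    and t :: "('v \<Rightarrow> 'v) \<Rightarrow> 'h"
    and \<iota> :: "'v cplx \<Rightarrow> 'h"
    and act :: "'h \<Rightarrow> 'm::ab_group_add \<Rightarrow> 'm" +
  fixes m :: 'm
  assumes irreducible: "is_submodule act N \<Longrightarrow> N = {0} \<or> N = UNIV"
    and m_nonzero: "m \<noteq> 0"
    and s_m: "a \<in> \<Delta> \<Longrightarrow> t (reflection a) \<star> m = - m"
begin

text \<open>These are the S(V)-submodules of X.\<close>

definition stable :: "'m set \<Rightarrow> bool" where
  "stable N \<longleftrightarrow> M.subspace N \<and> (\<forall>v. \<forall>n\<in>N. \<iota> v \<star> n \<in> N)"

lemma stableI: "M.subspace N \<Longrightarrow> (\<And>v n. n \<in> N \<Longrightarrow> \<iota> v \<star> n \<in> N) \<Longrightarrow> stable N"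
  and stable_subspace: "stable N \<Longrightarrow> M.subspace N"
  and stable_iota: "stable N \<Longrightarrow> n \<in> N \<Longrightarrow> \<iota> v \<star> n \<in> N"
  unfolding stable_def by blast+

lemmas stable_zero = M.subspace_0[OF stable_subspace]
  and stable_add = M.subspace_add[OF stable_subspace]
  and stable_diff = M.subspace_diff[OF stable_subspace]
  and stable_neg = M.subspace_neg[OF stable_subspace]
  and stable_K = M.subspace_scale[OF stable_subspace]
  and stable_sum = M.subspace_sum[OF stable_subspace]

lemma stable_eval_iota: "stable N \<Longrightarrow> n \<in> N \<Longrightarrow> eval_iota v p \<star> n \<in> N"
  by (induction p arbitrary: n) (auto simp: act_add_left act_mult intro: stable_zero stable_add stable_K stable_iota)

text \<open>Since \<open>t (reflection a)\<close> negates \<open>m\<close>, moving it past the \<open>\<iota> v\<close> shows that \<open>S(V) m\<close> is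
  already a submodule.\<close>

lemma stable_UNIV:
  assumes "stable N" "m \<in> N" shows "N = UNIV"
proof -
  define U where "U = {n. \<forall>N. stable N \<and> m \<in> N \<longrightarrow> n \<in> N}"
  have "is_submodule act U"
  proof (rule is_submoduleI)
    show "M.subspace U"
      by (rule M.subspaceI) (auto simp: U_def intro: stable_zero stable_add stable_K)
    show "\<iota> v \<star> n \<in> U" if "n \<in> U" for v n
      using that stable_iota unfolding U_def by blast
    fix a n assume a: "a \<in> \<Delta>" and n: "n \<in> U"
    have "s a \<star> n \<in> N" if N: "stable N" "m \<in> N" for N
    proof -
      have "stable {n \<in> N. s a \<star> n \<in> N}"
      proof (rule stableI)
        show "M.subspace {n \<in> N. s a \<star> n \<in> N}"
          using stable_subspace[OF N(1)]
          by (intro M.subspaceI) (auto simp: M.subspace_0 M.subspace_add M.subspace_scale act_add_right K_act_commute[of "s a"])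
        fix v n assume n: "n \<in> {n \<in> N. s a \<star> n \<in> N}"
        have "s a \<star> \<iota> v \<star> n = \<iota> (reflectionV a v) \<star> s a \<star> n + K (c a * corootV a v) \<star> n"
          by (simp only: act_mult[symmetric] s_iota[OF a] act_add_left)
        then show "\<iota> v \<star> n \<in> {n \<in> N. s a \<star> n \<in> N}"
          using n stable_iota[OF N(1)] stable_add[OF N(1)] stable_K[OF N(1)] by simp
      qed
      moreover have "m \<in> {n \<in> N. s a \<star> n \<in> N}" using N(2) s_m[OF a] stable_neg[OF N(1)]
        by simp
      ultimately show ?thesis using n unfolding U_def by blast
    qed
    then show "s a \<star> n \<in> U" unfolding U_def by blast
  qed
  moreover have "m \<in> U" unfolding U_def by blast
  ultimately have "U = UNIV" using irreducible m_nonzero by blast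
  then show ?thesis using assms unfolding U_def by blast
qed

section \<open>A simple quotient of the S(V)-module and its character\<close>

lemma countable_spanning: "\<exists>G. countable G \<and> M.span G = UNIV"
proof -
  obtain B :: "'v cplx set" where B: "finite B" "\<And>v. \<exists>k. v = (\<Sum>b\<in>B. scaleV (k b) b)"
    using complex_basis by blast
  define G where "G = (\<lambda>bs. prod_list (map \<iota> bs) \<star> m) ` lists B"
  have "stable (M.span G)"
  proof (rule stableI)
    fix v n assume n: "n \<in> M.span G"
    have b: "\<iota> b \<star> n \<in> M.span G" if b: "b \<in> B" for b
    proof -
      have "G \<subseteq> {n. \<iota> b \<star> n \<in> M.span G}"
      proof
        fix x assume "x \<in> G"
        then obtain bs where bs: "bs \<in> lists B" "x = prod_list (map \<iota> bs) \<star> m"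
          unfolding G_def by blast
        have "\<iota> b \<star> x = prod_list (map \<iota> (b # bs)) \<star> m" by (simp add: bs(2) act_mult)
        moreover have "b # bs \<in> lists B" using b bs(1) by simp
        ultimately have "\<iota> b \<star> x \<in> G" unfolding G_def by blast
        then show "x \<in> {n. \<iota> b \<star> n \<in> M.span G}" using M.span_base by blast
      qed
      then have "M.span G \<subseteq> {n. \<iota> b \<star> n \<in> M.span G}"
        by (rule M.span_minimal) (rule subspace_preimage[OF M.subspace_span])
      then show ?thesis using n by blast
    qed
    obtain k where "v = (\<Sum>b\<in>B. scaleV (k b) b)" using B(2) by blast
    then have "\<iota> v \<star> n = (\<Sum>b\<in>B. K (k b) \<star> \<iota> b \<star> n)"
      by (simp only: iota_sum iota_scale act_sum_left act_mult)
    then show "\<iota> v \<star> n \<in> M.span G" using b by (simp only:) (intro M.span_sum M.span_scale)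
  qed (rule M.subspace_span)
  moreover have "m \<in> M.span G"
    by (rule M.span_base) (auto simp: G_def act_one intro!: image_eqI[of _ _ "[]"])
  moreover have "countable G" unfolding G_def using B(1) by (simp add: countable_finite)
  ultimately show ?thesis using stable_UNIV by blast
qed

text \<open>Zorn's lemma applies because a union of stable subspaces in a chain still avoids m. A
  stable subspace maximal among those avoiding m is maximal proper by
  \<open>stable_UNIV\<close>.\<close>

lemma maximal_stable_ex:
  "\<exists>N. stable N \<and> m \<notin> N \<and> (\<forall>N'. stable N' \<longrightarrow> N \<subseteq> N' \<longrightarrow> N' = N \<or> N' = UNIV)"
proof -
  define C where "C = {N. stable N \<and> m \<notin> N}"
  have "\<exists>N\<in>C. \<forall>X\<in>C. N \<subseteq> X \<longrightarrow> X = N"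
  proof (rule subset_Zorn_nonempty)
    have "stable {0}" by (intro stableI M.subspaceI) auto
    then have "{0} \<in> C" using m_nonzero by (simp add: C_def)
    then show "C \<noteq> {}" by blast
    fix D assume D: "D \<noteq> {}" "subset.chain C D"
    then have DC: "N \<in> D \<Longrightarrow> stable N" "N \<in> D \<Longrightarrow> m \<notin> N" for N
      by (auto simp: C_def subset_chain_def)
    have "stable (\<Union> D)"
    proof (intro stableI M.subspaceI)
      show "0 \<in> \<Union> D" using D(1) DC stable_zero by blast
      fix x y assume "x \<in> \<Union> D" "y \<in> \<Union> D"
      then obtain N N' where N: "N \<in> D" "N' \<in> D" "x \<in> N" "y \<in> N'" by blast
      then have "N \<subseteq> N' \<or> N' \<subseteq> N" using D(2) by (auto simp: subset_chain_def)
      then show "x + y \<in> \<Union> D" using N DC(1) stable_add by blast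
    next
      show "K b \<star> x \<in> \<Union> D" if "x \<in> \<Union> D" for b x using that DC(1) stable_K by blast
      show "\<iota> v \<star> x \<in> \<Union> D" if "x \<in> \<Union> D" for v x
        using that DC(1) stable_iota by blast
    qed
    then show "\<Union> D \<in> C" using DC(2) unfolding C_def by blast
  qed
  then show ?thesis using stable_UNIV unfolding C_def by blast
qed

definition max_stable :: "'m set" where
  "max_stable = (SOME N. stable N \<and> m \<notin> N \<and> (\<forall>N'. stable N' \<longrightarrow> N \<subseteq> N' \<longrightarrow> N' = N \<or> N' = UNIV))"

lemma stable_max_stable: "stable max_stable"
  and m_not_max_stable: "m \<notin> max_stable"
  and max_stable_maximal: "stable N' \<Longrightarrow> max_stable \<subseteq> N' \<Longrightarrow> N' = max_stable \<or> N' = UNIV"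
  using someI_ex[OF maximal_stable_ex] unfolding max_stable_def by blast+

lemma iota_shift_commute: "\<iota> u \<star> (\<iota> v - K a) \<star> x = (\<iota> v - K a) \<star> \<iota> u \<star> x"
  using shift_commute[of u 0 v a] by (simp flip: act_mult)

lemma stable_shift: "stable N \<Longrightarrow> n \<in> N \<Longrightarrow> (\<iota> v - K a) \<star> n \<in> N"
  by (simp add: act_diff_left stable_diff stable_iota stable_K)

text \<open>One half of Schur's lemma on the quotient by \<open>max_stable\<close>: the kernel of v
  - a there is an S(V)-submodule, so if it is nonzero it is everything.\<close>

lemma shift_preimage:
  assumes "(\<iota> v - K a) \<star> x \<in> max_stable" "x \<notin> max_stable" shows "(\<iota> v - K a) \<star> n \<in> max_stable"
proof -
  let ?N = "{n. (\<iota> v - K a) \<star> n \<in> max_stable}"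
  have "stable ?N"
    by (rule stableI) (auto intro: subspace_preimage stable_subspace[OF stable_max_stable] stable_iota[OF stable_max_stable]
        simp flip: iota_shift_commute)
  moreover have "max_stable \<subseteq> ?N" using stable_shift[OF stable_max_stable] by blast
  ultimately have "?N = UNIV" using max_stable_maximal assms by blast
  then show ?thesis by blast
qed

text \<open>Split off linear factors. As m is nonzero in the quotient, one of them has a kernel
  there, and by \<open>shift_preimage\<close> it acts as zero.\<close>

lemma scalar_from_polynomial:
  "q \<noteq> 0 \<Longrightarrow> eval_iota v q \<star> m \<in> max_stable \<Longrightarrow> \<exists>a. \<forall>n. (\<iota> v - K a) \<star> n \<in> max_stable"
proof (induction "degree q" arbitrary: q rule: less_induct)
  case less
  show ?case
  proof (cases "degree q = 0")
    case True
    then obtain b where b: "q = [:b:]" by (metis degree_eq_zeroE)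
    then have "K b \<star> m \<in> max_stable" "b \<noteq> 0" using less.prems by simp_all
    then have "K (1 / b) \<star> K b \<star> m \<in> max_stable" using stable_K[OF stable_max_stable] by blast
    then have "m \<in> max_stable" using \<open>b \<noteq> 0\<close> unfolding M.scale_scale
      by (simp add: act_one)
    then show ?thesis using m_not_max_stable by blast
  next
    case False
    then have "\<not> constant (poly q)" by (simp add: constant_degree)
    then obtain z where "poly q z = 0" using fundamental_theorem_of_algebra by blast
    then obtain q' where q': "q = [:- z, 1:] * q'" using poly_eq_0_iff_dvd by (metis dvdE)
    then have nz: "q' \<noteq> 0" using less.prems(1) by auto
    then have "degree q = Suc (degree q')" unfolding q' by (subst degree_mult_eq) auto
    then have IH: "eval_iota v q' \<star> m \<in> max_stable \<Longrightarrow> ?thesis"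
      using less.hyps[of q'] nz by simp
    have "eval_iota v [:- z, 1:] = \<iota> v - K z" by (simp add: K_minus)
    then have "(\<iota> v - K z) \<star> eval_iota v q' \<star> m \<in> max_stable" using less.prems(2)
      unfolding q' eval_iota_mult act_mult by simp
    then show ?thesis using IH shift_preimage by blast
  qed
qed

text \<open>The other half of Schur's lemma: the image of v - a on the quotient is zero or
  everything, and zero would make v a scalar there.\<close>

lemma scalar_or_solution:
  assumes "\<not> (\<exists>a. \<forall>n. (\<iota> v - K a) \<star> n \<in> max_stable)"
  shows "\<exists>x. m - (\<iota> v - K a) \<star> x \<in> max_stable"
proof -
  let ?N = "{n. \<exists>x. n - (\<iota> v - K a) \<star> x \<in> max_stable}"
  have "stable ?N"
  proof (intro stableI M.subspaceI)
    show "0 \<in> ?N" using stable_zero[OF stable_max_stable] by (auto intro: exI[of _ 0])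
  next
    fix n n' assume "n \<in> ?N" "n' \<in> ?N"
    then obtain x x' where "n - (\<iota> v - K a) \<star> x \<in> max_stable" "n' - (\<iota> v - K a) \<star> x' \<in> max_stable" by blast
    from stable_add[OF stable_max_stable this] have "n + n' - (\<iota> v - K a) \<star> (x + x') \<in> max_stable"
      by (simp add: act_add_right[of "\<iota> v - K a"] algebra_simps)
    then show "n + n' \<in> ?N" by blast
  next
    fix b n assume "n \<in> ?N"
    then obtain x where "n - (\<iota> v - K a) \<star> x \<in> max_stable" by blast
    from stable_K[OF stable_max_stable this, of b] have "K b \<star> n - (\<iota> v - K a) \<star> K b \<star> x \<in> max_stable"
      by (simp only: act_diff_right K_act_commute[of "\<iota> v - K a"])
    then show "K b \<star> n \<in> ?N" by blast
  next
    fix u n assume "n \<in> ?N"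
    then obtain x where "n - (\<iota> v - K a) \<star> x \<in> max_stable" by blast
    from stable_iota[OF stable_max_stable this, of u] have "\<iota> u \<star> n - (\<iota> v - K a) \<star> \<iota> u \<star> x \<in> max_stable"
      by (simp only: act_diff_right iota_shift_commute)
    then show "\<iota> u \<star> n \<in> ?N" by blast
  qed
  moreover have "max_stable \<subseteq> ?N" by (auto intro: exI[of _ 0])
  moreover have "?N \<noteq> max_stable"
  proof
    assume "?N = max_stable"
    moreover have "(\<iota> v - K a) \<star> n \<in> ?N" for n
      using stable_zero[OF stable_max_stable] by (auto intro!: exI[of _ n])
    ultimately show False using assms by blast
  qed
  ultimately have "?N = UNIV" using max_stable_maximal by blast
  then show ?thesis by blast
qed

text \<open>A countable spanning set has only countably many finite subsets. If each of their spans
  contained \<open>f r\<close> for only finitely many r, the reals would be countable.\<close>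

lemma infinite_in_finite_span:
  fixes f :: "real \<Rightarrow> 'm"
  shows "\<exists>F. finite F \<and> infinite {r. f r \<in> M.span F}"
proof -
  obtain G where G: "countable G" "M.span G = UNIV" using countable_spanning by blast
  have "\<exists>F. finite F \<and> F \<subseteq> G \<and> f r \<in> M.span F" for r
  proof -
    have "f r \<in> M.span G" using G by blast
    then obtain F u where "finite F" "F \<subseteq> G" "f r = (\<Sum>x\<in>F. K (u x) \<star> x)"
      unfolding M.span_explicit by blast
    then show ?thesis by (intro exI[of _ F]) (auto intro: M.span_sum M.span_scale M.span_base)
  qed
  then have UN: "UNIV = (\<Union>F\<in>{F. finite F \<and> F \<subseteq> G}. {r. f r \<in> M.span F})" by blast
  have count: "countable {F. finite F \<and> F \<subseteq> G}"
    using countable_Collect_finite_subset[OF G(1)] .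
  show ?thesis
  proof (rule ccontr)
    assume "\<not> ?thesis"
    then have "countable (\<Union>F\<in>{F. finite F \<and> F \<subseteq> G}. {r. f r \<in> M.span F})"
      by (intro countable_UN count) (auto intro: countable_finite)
    then show False using uncountable_UNIV_real unfolding UN[symmetric] by blast
  qed
qed

text \<open>If v is not a scalar on the quotient, then v - r is invertible there for every real r,
  and \<open>f r\<close> represents the inverse applied to m. A linear dependence among finitely
  many \<open>f r\<close> becomes, after clearing denominators, a nonzero polynomial in v that kills
  m, contradicting \<open>scalar_from_polynomial\<close>.\<close>

lemma scalar_ex: "\<exists>a. \<forall>n. (\<iota> v - K a) \<star> n \<in> max_stable"
proof (rule ccontr)
  assume no_scalar: "\<not> ?thesis"
  then have "\<exists>x. m - (\<iota> v - K (of_real r)) \<star> x \<in> max_stable" for r :: real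
    by (rule scalar_or_solution)
  then obtain f where f: "\<And>r :: real. m - (\<iota> v - K (of_real r)) \<star> f r \<in> max_stable"
    by metis
  have "inj f"
  proof (rule injI, rule ccontr)
    fix r r' assume eq: "f r = f r'" "r \<noteq> r'"
    let ?k = "complex_of_real r - of_real r'"
    have "K ?k \<star> f r = (\<iota> v - K (of_real r')) \<star> f r - (\<iota> v - K (of_real r)) \<star> f r"
      by (simp add: act_diff_left K_diff)
    also have "\<dots> = (m - (\<iota> v - K (of_real r)) \<star> f r) - (m - (\<iota> v - K (of_real r')) \<star> f r')"
      by (simp add: eq(1))
    finally have "K ?k \<star> f r \<in> max_stable" using stable_diff[OF stable_max_stable f f] by (simp only:)
    then have "K (1 / ?k) \<star> K ?k \<star> f r \<in> max_stable" using stable_K[OF stable_max_stable]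
      by blast
    then have "f r \<in> max_stable" using eq(2) unfolding M.scale_scale by (simp add: act_one)
    then have "(\<iota> v - K (of_real r)) \<star> f r \<in> max_stable"
      by (rule stable_shift[OF stable_max_stable])
    then have "m \<in> max_stable" using stable_add[OF stable_max_stable f[of r]] by fastforce
    then show False using m_not_max_stable by blast
  qed
  obtain F where F: "finite F" "infinite {r. f r \<in> M.span F}" using infinite_in_finite_span by blast
  obtain L where L: "L \<subseteq> {r. f r \<in> M.span F}" "finite L" "card L = Suc (card F)"
    using infinite_arbitrarily_large[OF F(2)] by blast
  have inj: "inj_on f L" using \<open>inj f\<close> inj_on_subset by blast
  have "\<not> M.independent (f ` L)"
    using M.independent_span_bound[OF F(1), of "f ` L"] L card_image[OF inj] by auto
  then obtain u where u: "\<exists>x\<in>f ` L. u x \<noteq> 0" "(\<Sum>x\<in>f ` L. K (u x) \<star> x) = 0"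
    using M.dependent_finite[of "f ` L"] L(2) by auto
  then obtain r0 where r0: "r0 \<in> L" "u (f r0) \<noteq> 0" by blast
  have rel: "(\<Sum>r\<in>L. K (u (f r)) \<star> f r) = 0" using u(2) by (simp add: sum.reindex[OF inj])
  define lin where "lin r = [:- complex_of_real r, 1:]" for r
  \<comment> \<open>The numerator of the sum of the fractions u / (v - r). At \<open>r0\<close>
    every term except its own vanishes, which shows \<open>q \<noteq> 0\<close>.\<close>
  define q where "q = (\<Sum>r\<in>L. smult (u (f r)) (\<Prod>r'\<in>L - {r}. lin r'))"
  have lin: "eval_iota v (lin r) = \<iota> v - K (of_real r)" for r by (simp add: lin_def K_minus)
  have "poly q (of_real r0) = (\<Sum>r\<in>L. if r = r0 then u (f r0) * (\<Prod>r'\<in>L - {r0}. of_real r0 - of_real r') else 0)"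
    unfolding q_def poly_sum
  proof (rule sum.cong[OF refl])
    fix r assume "r \<in> L"
    show "poly (smult (u (f r)) (\<Prod>r'\<in>L - {r}. lin r')) (of_real r0)
        = (if r = r0 then u (f r0) * (\<Prod>r'\<in>L - {r0}. of_real r0 - of_real r') else 0)"
    proof (cases "r = r0")
      case False
      then have "(\<Prod>r'\<in>L - {r}. poly (lin r') (of_real r0)) = 0"
        using L(2) r0(1) by (intro prod_zero) (auto simp: lin_def intro!: bexI[of _ r0])
      then show ?thesis using False by (simp add: poly_prod)
    qed (simp add: poly_prod lin_def)
  qed
  also have "\<dots> = u (f r0) * (\<Prod>r'\<in>L - {r0}. of_real r0 - of_real r')" using L(2) r0(1) by simp
  also have "\<dots> \<noteq> 0" using L(2) r0(2) by auto
  finally have "q \<noteq> 0" by auto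
  have "eval_iota v q \<star> m = (\<Sum>r\<in>L. K (u (f r)) \<star> eval_iota v (\<Prod>r'\<in>L - {r}. lin r') \<star> m)"
    by (simp only: q_def eval_iota_sum eval_iota_smult act_sum_left act_mult)
  \<comment> \<open>Subtracting this vanishing sum replaces m in the term of r by
    \<open>m - (\<iota> v - K (of_real r)) \<star> f r\<close>, which lies in
    \<open>max_stable\<close>.\<close>
  moreover have "(\<Sum>r\<in>L. K (u (f r)) \<star> eval_iota v (\<Prod>r'\<in>L. lin r') \<star> f r) = 0"
  proof -
    have "(\<Sum>r\<in>L. K (u (f r)) \<star> eval_iota v (\<Prod>r'\<in>L. lin r') \<star> f r)
        = eval_iota v (\<Prod>r'\<in>L. lin r') \<star> (\<Sum>r\<in>L. K (u (f r)) \<star> f r)"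
      by (simp only: act_sum_right K_act_commute[of "eval_iota v (\<Prod>r'\<in>L. lin r')"])
    then show ?thesis by (simp only: rel act_zero_right)
  qed
  ultimately have "eval_iota v q \<star> m = (\<Sum>r\<in>L. K (u (f r)) \<star> eval_iota v (\<Prod>r'\<in>L - {r}. lin r') \<star> m)
      - (\<Sum>r\<in>L. K (u (f r)) \<star> eval_iota v (\<Prod>r'\<in>L. lin r') \<star> f r)" by (simp only: diff_zero)
  also have "\<dots> = (\<Sum>r\<in>L. K (u (f r)) \<star> eval_iota v (\<Prod>r'\<in>L - {r}. lin r') \<star> (m - (\<iota> v - K (of_real r)) \<star> f r))"
    unfolding sum_subtractf[symmetric]
  proof (rule sum.cong[OF refl])
    fix r assume r: "r \<in> L"
    have "(\<Prod>r'\<in>L. lin r') = (\<Prod>r'\<in>L - {r}. lin r') * lin r"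
      using L(2) r by (simp add: prod.remove mult.commute)
    then have "eval_iota v (\<Prod>r'\<in>L. lin r') \<star> f r = eval_iota v (\<Prod>r'\<in>L - {r}. lin r') \<star> (\<iota> v - K (of_real r)) \<star> f r"
      by (simp only: eval_iota_mult act_mult lin)
    then show "K (u (f r)) \<star> eval_iota v (\<Prod>r'\<in>L - {r}. lin r') \<star> m - K (u (f r)) \<star> eval_iota v (\<Prod>r'\<in>L. lin r') \<star> f r
        = K (u (f r)) \<star> eval_iota v (\<Prod>r'\<in>L - {r}. lin r') \<star> (m - (\<iota> v - K (of_real r)) \<star> f r)"
      by (simp only: act_diff_right)
  qed
  also have "\<dots> \<in> max_stable" by (intro stable_sum stable_K stable_eval_iota stable_max_stable f)
  finally show False using scalar_from_polynomial[OF \<open>q \<noteq> 0\<close>] no_scalar by blast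
qed

text \<open>The character by which S(V) acts on the quotient by \<open>max_stable\<close>.\<close>

definition wt :: "'v cplx \<Rightarrow> complex" where
  "wt v = (SOME a. \<forall>n. (\<iota> v - K a) \<star> n \<in> max_stable)"

lemma wt: "(\<iota> v - K (wt v)) \<star> n \<in> max_stable"
  using someI_ex[OF scalar_ex[of v]] unfolding wt_def by blast

lemma wt_unique: "(\<iota> v - K a) \<star> m \<in> max_stable \<Longrightarrow> wt v = a"
proof (rule ccontr)
  assume "(\<iota> v - K a) \<star> m \<in> max_stable" "wt v \<noteq> a"
  then have "K (wt v - a) \<star> m \<in> max_stable"
    using stable_diff[OF stable_max_stable _ wt[of v m], of "(\<iota> v - K a) \<star> m"]
      by (simp add: act_diff_left K_diff)
  then have "K (1 / (wt v - a)) \<star> K (wt v - a) \<star> m \<in> max_stable"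
    using stable_K[OF stable_max_stable] by blast
  then have "m \<in> max_stable" using \<open>wt v \<noteq> a\<close> unfolding M.scale_scale
    by (simp add: act_one)
  then show False using m_not_max_stable by blast
qed

lemma wt_dualV: "wt \<in> dualV"
proof (rule dualV_I)
  fix u v
  have "(\<iota> (u + v) - K (wt u + wt v)) \<star> m = (\<iota> u - K (wt u)) \<star> m + (\<iota> v - K (wt v)) \<star> m"
    by (simp only: iota_add K_add act_diff_left act_add_left) (simp only: add_diff_add)
  then show "wt (u + v) = wt u + wt v"
    using stable_add[OF stable_max_stable wt wt] by (intro wt_unique) simp
next
  fix a v
  have "(\<iota> (scaleV a v) - K (a * wt v)) \<star> m = K a \<star> (\<iota> v - K (wt v)) \<star> m"
    by (simp only: iota_scale K_mult act_diff_left act_diff_right act_mult)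
  then show "wt (scaleV a v) = a * wt v"
    using stable_K[OF stable_max_stable wt] by (intro wt_unique) simp
qed

section \<open>From the quotient to weights of the module\<close>

lemma ti_iota:
  assumes "u \<in> W"
  shows "ti u \<star> \<iota> v \<star> x = \<iota> (cx (inv u) v) \<star> ti u \<star> x
    - (\<Sum>b\<in>inversions u. K (c b * corootV b (cx (inv u) v)) \<star> ti (u \<circ> reflection b) \<star> x)"
proof -
  have "cx u (cx (inv u) v) = v" using assms by (cases v) simp
  then have "\<iota> (cx (inv u) v) \<star> ti u \<star> x = ti u \<star> \<iota> v \<star> x
      + (\<Sum>b\<in>inversions u. K (c b * corootV b (cx (inv u) v)) \<star> ti (u \<circ> reflection b) \<star> x)"
    using iota_ti[OF assms, of "cx (inv u) v"]
      by (simp only: act_mult[symmetric] act_add_left[symmetric] act_sum_left[symmetric])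
  then show ?thesis by simp
qed

lemma weight_ex: "\<exists>\<nu> x. \<nu> \<in> dualV \<and> eigenvector \<nu> x"
proof -
  \<comment> \<open>By \<open>ti_iota\<close>, the \<open>\<iota> v\<close> act triangularly with respect to the length. On the vectors that are
    killed modulo \<open>max_stable\<close> by a maximal length ideal they therefore act by scalars.\<close>
  define good where "good A \<longleftrightarrow> A \<subseteq> W \<and> (\<forall>w\<in>A. \<forall>u\<in>W. len u < len w \<longrightarrow> u \<in> A) \<and>
    (\<exists>x. x \<noteq> 0 \<and> (\<forall>w\<in>A. ti w \<star> x \<in> max_stable))" for A
  have "{A. good A} \<subseteq> Pow W" unfolding good_def by blast
  then have fin: "finite {A. good A}" using finite_W by (simp add: finite_subset)
  have "good {}" using m_nonzero unfolding good_def by blast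
  then have ne: "{A. good A} \<noteq> {}" by blast
  obtain A where "A \<in> {A. good A}" "\<forall>B\<in>{A. good A}. A \<subseteq> B \<longrightarrow> A = B"
    using finite_has_maximal[OF fin ne] by blast
  then have A: "good A" "\<And>B. good B \<Longrightarrow> A \<subseteq> B \<Longrightarrow> A = B" by simp_all
  obtain x where x: "x \<noteq> 0" "\<And>w. w \<in> A \<Longrightarrow> ti w \<star> x \<in> max_stable"
    using A(1) unfolding good_def by blast
  have AW: "A \<subseteq> W" and ideal: "\<And>w u. w \<in> A \<Longrightarrow> u \<in> W \<Longrightarrow> len u < len w \<Longrightarrow> u \<in> A"
    using A(1) unfolding good_def by blast+
  have "A \<noteq> W"
  proof
    assume "A = W"
    \<comment> \<open>The kernel of the map to the coinduced module. It is a submodule not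
      containing m, hence zero.\<close>
    define Z where "Z = {x. \<forall>w\<in>W. ti w \<star> x \<in> max_stable}"
    have "is_submodule act Z"
    proof (rule is_submoduleI)
      show "M.subspace Z"
        by (rule M.subspaceI)
          (auto simp: Z_def act_add_right K_act_commute[of "ti _"] intro: stable_zero stable_add stable_K stable_max_stable)
      show "\<iota> v \<star> n \<in> Z" if n: "n \<in> Z" for v n
        unfolding Z_def mem_Collect_eq
      proof
        fix w assume w: "w \<in> W"
        have "ti u \<star> n \<in> max_stable" if "u \<in> W" for u using n that unfolding Z_def by blast
        then have "ti (w \<circ> reflection b) \<star> n \<in> max_stable" if "b \<in> inversions w" for b
          using W_comp_reflection[OF w positive_root[OF inversions_D(1)[OF that]]] by blast
        then show "ti w \<star> \<iota> v \<star> n \<in> max_stable"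
          unfolding ti_iota[OF w]
            using \<open>\<And>u. u \<in> W \<Longrightarrow> ti u \<star> n \<in> max_stable\<close> w
          by (intro stable_diff stable_sum stable_K stable_iota stable_max_stable) blast+
      qed
      show "s a \<star> n \<in> Z" if a: "a \<in> \<Delta>" and n: "n \<in> Z" for a n
        unfolding Z_def mem_Collect_eq
      proof
        fix w assume w: "w \<in> W"
        have aW: "reflection a \<in> W" by (rule reflection_W[OF simple_root[OF a]])
        have "ti w \<star> s a \<star> n = ti (reflection a \<circ> w) \<star> n"
          by (simp only: ti_comp[OF aW w] ti_reflection act_mult)
        moreover have "reflection a \<circ> w \<in> W" using aW w by (rule reflection_group_comp)
        ultimately show "ti w \<star> s a \<star> n \<in> max_stable" using n unfolding Z_def by simp
      qed
    qed
    moreover have "m \<notin> Z"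
    proof
      assume "m \<in> Z"
      then have "ti id \<star> m \<in> max_stable" using reflection_group.one unfolding Z_def by blast
      then show False using m_not_max_stable unfolding ti_id act_one by blast
    qed
    ultimately have "Z = {0}" using irreducible by blast
    moreover have "x \<in> Z" using x(2) \<open>A = W\<close> unfolding Z_def by blast
    ultimately show False using x(1) by blast
  qed
  then obtain w' where "w' \<in> W - A" using AW by blast
  \<comment> \<open>Minimal length outside \<open>A\<close> ensures that all shorter elements belong
    to \<open>A\<close>, so that adding \<open>w\<close> keeps the closure condition in
    \<open>good\<close>.\<close>
  then obtain w where w: "w \<in> W - A" "\<And>u. u \<in> W - A \<Longrightarrow> len w \<le> len u"
    using ex_has_least_nat[of "\<lambda>w. w \<in> W - A" w' len] by blast
  have wW: "w \<in> W" using w(1) by blast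
  have lower: "u \<in> A" if "u \<in> W" "len u < len w" for u using w(2) that by (meson DiffI not_le)
  have zero: "z = 0" if "\<And>u. u \<in> insert w A \<Longrightarrow> ti u \<star> z \<in> max_stable" for z
  proof (rule ccontr)
    assume "z \<noteq> 0"
    then have "good (insert w A)"
      using that AW wW ideal lower unfolding good_def by blast
    then have "A = insert w A" using A(2) by blast
    then show False using w(1) by blast
  qed
  have below: "ti (u \<circ> reflection b) \<star> x \<in> max_stable" if "u \<in> insert w A" "b \<in> inversions u" for u b
  proof -
    have u: "u \<in> W" using that AW wW by blast
    have "u \<circ> reflection b \<in> W"
      using W_comp_reflection[OF u positive_root[OF inversions_D(1)[OF that(2)]]] .
    moreover have "len (u \<circ> reflection b) < len u"
      by (rule len_comp_reflection_less[OF u inversions_D[OF that(2)]])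
    ultimately show ?thesis using that(1) ideal lower x(2) by blast
  qed
  \<comment> \<open>For \<open>u\<close> in \<open>A\<close> the vector
    \<open>ti u \<star> x\<close> is already zero in the quotient and any scalar would do; the
    weight is read off at \<open>w\<close>, the only element of \<open>insert w A\<close> where it
    may be nonzero.\<close>
  let ?\<nu> = "wt \<circ> cx (inv w)"
  have "\<iota> v \<star> x = K (?\<nu> v) \<star> x" for v
  proof -
    have "ti u \<star> (\<iota> v \<star> x - K (?\<nu> v) \<star> x) \<in> max_stable" if u: "u \<in> insert w A" for u
    proof -
      have uW: "u \<in> W" using u AW wW by blast
      let ?S = "\<Sum>b\<in>inversions u. K (c b * corootV b (cx (inv u) v)) \<star> ti (u \<circ> reflection b) \<star> x"
      have S: "?S \<in> max_stable" using below[OF u] by (intro stable_sum stable_K stable_max_stable)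
      have eq: "ti u \<star> (\<iota> v \<star> x - K (?\<nu> v) \<star> x) = (\<iota> (cx (inv u) v) - K (?\<nu> v)) \<star> ti u \<star> x - ?S"
        unfolding act_diff_right ti_iota[OF uW] act_diff_left K_act_commute[of "ti u"]
          by (simp add: algebra_simps)
      have "(\<iota> (cx (inv u) v) - K (?\<nu> v)) \<star> ti u \<star> x \<in> max_stable"
      proof (cases "u = w")
        case True
        then show ?thesis using wt[of "cx (inv w) v"] by (simp only: comp_apply)
      next
        case False
        then show ?thesis using u x(2) by (intro stable_shift[OF stable_max_stable]) blast
      qed
      then show ?thesis unfolding eq using S by (rule stable_diff[OF stable_max_stable])
    qed
    then have "\<iota> v \<star> x - K (?\<nu> v) \<star> x = 0" by (rule zero)
    then show ?thesis by simp
  qed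
  then have "eigenvector ?\<nu> x" using x(1) unfolding eigenvector_def by blast
  moreover have "?\<nu> \<in> dualV"
    by (rule dualV_cx[OF wt_dualV reflection_group_linear[OF reflection_group_inv[OF wW]]])
  ultimately show ?thesis by blast
qed

lemma anti_dominant_weight_ex: "\<exists>\<mu>. is_weight scaleH \<iota> act \<mu> \<and> anti_dominant R \<Delta> \<mu>"
proof -
  obtain \<nu>0 x where \<nu>0: "\<nu>0 \<in> dualV" "eigenvector \<nu>0 x" using weight_ex by blast
  let ?O = "W_orbit \<nu>0"
  have dual: "\<mu> \<in> ?O \<Longrightarrow> \<mu> \<in> dualV" for \<mu>
    by (rule W_orbit_dualV[OF \<nu>0(1)])
  have x0: "x \<noteq> 0" "x \<in> gws \<nu>0" using \<nu>0(2) eigenvector_gws by (auto simp: eigenvector_def)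
  have "is_submodule act (gsum ?O)"
  proof (rule is_submoduleI[OF subspace_gsum gsum_iota])
    show "s a \<star> n \<in> gsum ?O" if "a \<in> \<Delta>" "n \<in> gsum ?O" for a n
      using gsum_s[OF that(1) _ that(2)] dual W_orbit_reflection that(1) by blast
  qed
  moreover have "x \<in> gsum ?O" by (rule gws_gsum[OF self_in_W_orbit x0(2)])
  ultimately have all: "gsum ?O = UNIV" using irreducible x0(1) by blast
  \<comment> \<open>A weight with minimal real part at \<open>rho\<close> is sought: if it were
    positive at a simple root, the reflected weight would have smaller real part at
    \<open>rho\<close> and so could not occur.\<close>
  define F where "F = {\<mu> \<in> ?O. gws \<mu> \<noteq> {0}}"
  have "finite F" using finite_W_orbit by (simp add: F_def)
  moreover have "\<nu>0 \<in> F" using x0 self_in_W_orbit unfolding F_def by blast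
  ultimately obtain \<mu> where \<mu>: "\<mu> \<in> F"
      "\<And>\<kappa>. \<kappa> \<in> F \<Longrightarrow> \<not> Re (\<kappa> (embedV rho)) < Re (\<mu> (embedV rho))"
    using arg_min_if_finite[of F "\<lambda>\<mu>. Re (\<mu> (embedV rho))"] by blast
  have \<mu>O: "\<mu> \<in> ?O" and nz: "gws \<mu> \<noteq> {0}" using \<mu>(1) unfolding F_def by blast+
  have \<mu>d: "\<mu> \<in> dualV" using dual \<mu>O .
  have "Re (\<mu> (embedV a)) \<le> 0" if a: "a \<in> \<Delta>" for a
  proof (rule ccontr)
    assume "\<not> ?thesis"
    then have pos: "0 < Re (\<mu> (embedV a))" by simp
    let ?\<nu> = "\<mu> \<circ> reflectionV a"
    have cp: "0 < Re (c a)" by (rule c_positive(1)[OF simple_root[OF a]])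
    have "?\<nu> \<notin> F" using \<mu>(2)[of ?\<nu>] pos unfolding reflectionV_rho[OF \<mu>d a] by auto
    then have \<nu>z: "gws ?\<nu> = {0}" using W_orbit_reflection[OF \<mu>O a] unfolding F_def by blast
    \<comment> \<open>On \<open>gws \<mu>\<close> both forms of \<open>tau a\<close> vanish, so
      \<open>s a * rt a\<close> and \<open>rt a * s a\<close> act as \<open>c a\<close>. Hence the
      square of the root acts as the square of \<open>c a\<close>. The value \<open>- c a\<close> is
      excluded by the sign of the real part, so the root acts as \<open>c a\<close> and
      \<open>s a\<close> as 1.\<close>
    have s_id: "s a \<star> n = n" if n: "n \<in> gws \<mu>" for n
    proof -
      have tau: "tau a \<star> n = 0" using gws_tau[OF a n] \<nu>z by blast
      then have 1: "s a \<star> rt a \<star> n = K (c a) \<star> n"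
        by (simp add: tau_def act_diff_left act_mult)
      have 2: "K (c a) \<star> n = rt a \<star> s a \<star> n"
        using tau unfolding tau_eq[OF a] by (simp add: act_diff_left act_mult)
      have 3: "rt a \<star> n = K (c a) \<star> s a \<star> n"
        using arg_cong[OF 1, of "act (s a)"] by (simp only: s_act_square[OF a] K_act_commute[of "s a"])
      have "rt a \<star> rt a \<star> n = K (c a) \<star> K (c a) \<star> n"
        unfolding 3 K_act_commute[of "rt a"] by (simp only: 2)
      then have "(rt a - K (- c a)) \<star> (rt a - K (c a)) \<star> n = 0"
        by (simp add: K_minus act_simps K_act_commute[of "rt a"])
      moreover have "(rt a - K (c a)) \<star> n \<in> gws \<mu>"
        unfolding act_diff_left by (intro gws_diff gws_iota gws_K n)
      moreover have "\<mu> (embedV a) \<noteq> - c a" using pos cp by auto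
      ultimately have "(rt a - K (c a)) \<star> n = 0" using gws_shift_injective by blast
      then have "K (c a) \<star> (s a \<star> n - n) = 0" by (simp add: act_diff_left act_diff_right 3)
      then show ?thesis using cp by (auto simp: K_act_eq_0)
    qed
    obtain n where n: "n \<in> gws \<mu>" "m - n \<in> gsum (?O - {\<mu>})"
      using gsum_component[of m ?O \<mu>] all \<mu>O by blast
    have "s a \<star> (m - n) \<in> gsum (?O - {\<mu>})"
    proof (rule gsum_s[OF a _ n(2)])
      show "?O - {\<mu>} \<subseteq> dualV" using dual by blast
      fix \<kappa> assume \<kappa>: "\<kappa> \<in> ?O - {\<mu>}" "gws \<kappa> \<noteq> {0}"
      then have "\<kappa> \<noteq> ?\<nu>" using \<nu>z by blast
      then have "\<kappa> \<circ> reflectionV a \<noteq> \<mu>" using comp_reflectionV_twice by metis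
      then show "\<kappa> \<in> ?O - {\<mu>} \<and> (\<kappa> \<circ> reflectionV a \<in> ?O - {\<mu>} \<or> gws (\<kappa> \<circ> reflectionV a) = {0})"
        using \<kappa> W_orbit_reflection a by blast
    qed
    \<comment> \<open>As \<open>s a\<close> negates m but fixes its component n, the vector
      \<open>m - n\<close> plus its image under \<open>s a\<close> is -2n. It has no component at
      \<open>\<mu>\<close>, so n is zero.\<close>
    from gsum_add[OF this n(2)] have "- (K (1 + 1) \<star> n) \<in> gsum (?O - {\<mu>})"
      unfolding act_diff_right s_m[OF a] s_id[OF n(1)]
      by (simp only: K_add K_simps act_add_left act_one) (simp add: algebra_simps)
    then have "- (K (1 + 1) \<star> n) = 0"
      using gws_gsum_disjoint[OF gws_minus[OF gws_K[OF n(1)]]] by blast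
    then have "n = 0" unfolding neg_equal_0_iff_equal K_act_eq_0 by simp
    \<comment> \<open>The sum of the other weight spaces is stable under V and now contains m, which
      generates X over S(V), so nothing is left for \<open>\<mu>\<close>.\<close>
    then have "m \<in> gsum (?O - {\<mu>})" using n(2) by simp
    then have "gsum (?O - {\<mu>}) = UNIV"
      by (intro stable_UNIV stableI subspace_gsum gsum_iota)
    then have "gws \<mu> = {0}" using gws_gsum_disjoint[of _ \<mu> "?O - {\<mu>}"] gws_zero by blast
    then show False using nz by blast
  qed
  then have "Re (\<mu> (embedV b)) \<le> 0" if "b \<in> P" for b
    using linear_functional_nonneg[of "\<lambda>v. - Re (\<mu> (embedV v))" b] that
      linear_compose_neg[OF linear_embedV_functional(1)[OF \<mu>d]] by simp
  then have "anti_dominant R \<Delta> \<mu>" unfolding anti_dominant_def by blast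
  moreover have "is_weight scaleH \<iota> act \<mu>" unfolding is_weight_def using \<mu>d nz by blast
  ultimately show ?thesis by blast
qed

end

theorem theorem1p2:
  fixes R \<Delta> :: "'v::real_inner set"
    and scaleH :: "complex \<Rightarrow> 'h::ring_1 \<Rightarrow> 'h"
    and c :: "'v \<Rightarrow> complex"
    and t :: "('v \<Rightarrow> 'v) \<Rightarrow> 'h"
    and \<iota> :: "'v cplx \<Rightarrow> 'h"
    and act :: "'h \<Rightarrow> 'm::ab_group_add \<Rightarrow> 'm"
  assumes "graded_hecke_algebra R \<Delta> scaleH c t \<iota>"
    and "positive_parameter R c"
    and "irreducible_module act"
  shows "anti_spherical R \<Delta> t act \<longleftrightarrow>
    (\<exists>\<mu>. is_weight scaleH \<iota> act \<mu> \<and> anti_dominant R \<Delta> \<mu>)"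
proof -
  interpret graded_hecke_algebra R \<Delta> scaleH c t \<iota> by fact
  interpret left_module act using assms(3) by (simp add: irreducible_module_def)
  interpret hecke_module R \<Delta> scaleH c t \<iota> act by unfold_locales fact
  show ?thesis
  proof
    assume "anti_spherical R \<Delta> t act"
    then obtain m where m: "m \<noteq> 0" "\<And>w. w \<in> W \<Longrightarrow> act (t w) m = act (of_int (sg w)) m"
      unfolding anti_spherical_def by blast
    have "act (t (reflection a)) m = - m" if "a \<in> \<Delta>" for a
      using m(2)[OF reflection_W[OF simple_root[OF that]]]
      by (simp add: sg_simple[OF that] act_minus_left act_one)
    then interpret irreducible_sign_module R \<Delta> scaleH c t \<iota> act m
      using assms(3) m(1) by unfold_locales (auto simp: irreducible_module_def)
    show "\<exists>\<mu>. is_weight scaleH \<iota> act \<mu> \<and> anti_dominant R \<Delta> \<mu>"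
      by (rule anti_dominant_weight_ex)
  next
    assume "\<exists>\<mu>. is_weight scaleH \<iota> act \<mu> \<and> anti_dominant R \<Delta> \<mu>"
    then obtain n where "n \<noteq> 0" "\<And>a. a \<in> \<Delta> \<Longrightarrow> act (t (reflection a)) n = - n"
      using anti_dominant_imp_sign_vector unfolding is_weight_def by blast
    then show "anti_spherical R \<Delta> t act" unfolding anti_spherical_def using sign_vectorI by blast
  qed
qed

end
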